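(* Every qc $Q$-structure on a $(4n+3)$-dimensional manifold has a unique reduction $P$ to the group $B$ such that its $Q$-intrinsic torsion satisfies $$\Theta^Q(u)=\Theta_0^Q\quad\text{for all }u\in P .$$
   Context: Fix $n\ge 1$. $T=\mathbb R^{4n+3}=V\oplus W$ with $V=\mathbb R^{4n}$, $W=\mathbb R^3$; $e_1,\dots,e_{4n+3}$ is the standard basis, $e^a$ the dual basis, $e^{ab}=e^a\wedge e^b$, $w_s$ the class of $e_{4n+s}$ in $T/V$. Set $\omega_1=\sum_{j=1}^n(e^{4j-3,4j-2}-e^{4j-1,4j})$, $\omega_2=\sum_{j=1}^n(e^{4j-3,4j-1}+e^{4j-2,4j})$, $\omega_3=\sum_{j=1}^n(e^{4j-3,4j}-e^{4j-2,4j-1})$. $Q\subset\mathrm{GL}(T)$ is the stabilizer of the subspace $V$. A $Q$-structure $P$ on $M$ is a reduction to $Q$ of the bundle of frames $u\colon T\to T_xM$ (equivalently a rank $4n$ distribution $\mathcal D_x=u(V)$). Its intrinsic torsion $\Theta^Q\colon P\to\mathrm{coker}\,\partial_Q=\Lambda^2V^*\otimes T/V$ is the projection (restrict $2$-forms to $V$, project $T\to T/V$) of the torsion of any connection on $P$. Set $\Theta_0^Q=\omega_1\otimes w_1+\omega_2\otimes w_2+\omega_3\otimes w_3\in\Lambda^2V^*\otimes T/V$. A qc $Q$-structure is a $Q$-structure such that $\Theta^Q$ takes values in the $Q$-orbit of $\Theta_0^Q$. $B$ is the stabilizer of $\Theta_0^Q$ in $Q$. *)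

theory Defs
  imports "HOL-Analysis.Analysis"
begin

section \<open>Smooth maps and smooth manifolds\<close>

primrec higher_differentiable_on ::
  "'a::real_normed_vector set \<Rightarrow> ('a \<Rightarrow> 'b::real_normed_vector) \<Rightarrow> nat \<Rightarrow> bool" where
  "higher_differentiable_on S f 0 \<longleftrightarrow> continuous_on S f"
| "higher_differentiable_on S f (Suc k) \<longleftrightarrow>
     (\<forall>x\<in>S. f differentiable (at x)) \<and>
     (\<forall>v. higher_differentiable_on S (\<lambda>x. frechet_derivative f (at x) v) k)"

text \<open>Only used for open sets in finite-dimensional spaces, where continuity of all iterated
  directional derivatives is the usual notion of a map of class \<open>C\<^sup>\<infinity>\<close>.\<close>

definition smooth_on :: "'a::real_normed_vector set \<Rightarrow> ('a \<Rightarrow> 'b::real_normed_vector) \<Rightarrow> bool" where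
  "smooth_on S f \<longleftrightarrow> (\<forall>k. higher_differentiable_on S f k)"

type_synonym ('m, 'e) chart = "'m set \<times> ('m \<Rightarrow> 'e)"

definition chart_inv :: "('m, 'e) chart \<Rightarrow> 'e \<Rightarrow> 'm" where
  "chart_inv c = inv_into (fst c) (snd c)"

definition transition :: "('m, 'e) chart \<Rightarrow> ('m, 'e) chart \<Rightarrow> 'e \<Rightarrow> 'e" where
  "transition c d = snd d \<circ> chart_inv c"

definition topological_chart :: "'m topology \<Rightarrow> ('m, 'e::euclidean_space) chart \<Rightarrow> bool" where
  "topological_chart M c \<longleftrightarrow> openin M (fst c) \<and> open (snd c ` fst c) \<and>
     homeomorphic_map (subtopology M (fst c)) (top_of_set (snd c ` fst c)) (snd c)"

text \<open>The atlas is not required to be maximal; the dimension of the manifold is the dimension of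
  the model space \<open>'e\<close>.\<close>

definition smooth_manifold :: "'m topology \<Rightarrow> ('m, 'e::euclidean_space) chart set \<Rightarrow> bool" where
  "smooth_manifold M A \<longleftrightarrow>
     Hausdorff_space M \<and> second_countable M \<and>
     (\<forall>c\<in>A. topological_chart M c) \<and>
     (\<Union>c\<in>A. fst c) = topspace M \<and>
     (\<forall>c\<in>A. \<forall>d\<in>A. smooth_on (snd c ` (fst c \<inter> fst d)) (transition c d))"

section \<open>Tangent spaces and frames\<close>

definition charts_at :: "('m, 'e) chart set \<Rightarrow> 'm \<Rightarrow> ('m, 'e) chart set" where
  "charts_at A x = {c \<in> A. x \<in> fst c}"

text \<open>A tangent vector at \<open>x\<close> is the family of its coordinate representations in the charts
  around \<open>x\<close>, related by the derivatives of the transition maps. The value \<open>0\<close> at the irrelevant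
  charts makes the representation unique; the vector space operations are pointwise.\<close>

definition tangent_space ::
  "('m, 'e::euclidean_space) chart set \<Rightarrow> 'm \<Rightarrow> (('m, 'e) chart \<Rightarrow> 'e) set" where
  "tangent_space A x = {\<xi>.
     (\<forall>c\<in>charts_at A x. \<forall>d\<in>charts_at A x.
        \<xi> d = frechet_derivative (transition c d) (at (snd c x)) (\<xi> c)) \<and>
     (\<forall>c. c \<notin> charts_at A x \<longrightarrow> \<xi> c = 0)}"

type_synonym ('m, 'e) frame = "'m \<times> ('e \<Rightarrow> ('m, 'e) chart \<Rightarrow> 'e)"

text \<open>Pairs \<open>(x, u)\<close> with \<open>u\<close> a linear isomorphism from \<open>'e\<close> onto the tangent space at \<open>x\<close>.\<close>

definition frame_bundle ::
  "'m topology \<Rightarrow> ('m, 'e::euclidean_space) chart set \<Rightarrow> ('m, 'e) frame set" where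
  "frame_bundle M A = {(x, u). x \<in> topspace M \<and>
     bij_betw u UNIV (tangent_space A x) \<and> (\<forall>c. linear (\<lambda>v. u v c))}"

definition frame_field ::
  "'m topology \<Rightarrow> ('m, 'e::euclidean_space) chart set \<Rightarrow> 'm set \<Rightarrow>
     ('m \<Rightarrow> 'e \<Rightarrow> ('m, 'e) chart \<Rightarrow> 'e) \<Rightarrow> bool" where
  "frame_field M A U s \<longleftrightarrow>
     openin M U \<and> (\<forall>x\<in>U. (x, s x) \<in> frame_bundle M A) \<and>
     (\<forall>c\<in>A. \<forall>v. smooth_on (snd c ` (fst c \<inter> U)) (\<lambda>p. s (chart_inv c p) v c))"

section \<open>Reductions of the frame bundle, connections and torsion\<close>

text \<open>For a closed subgroup \<open>H\<close> of the general linear group, acting on frames from the right by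
  composition: \<open>P\<close> is a principal \<open>H\<close>-subbundle of the frame bundle, i.e. locally it is
  trivialized by a smooth section.\<close>

definition is_reduction ::
  "'m topology \<Rightarrow> ('m, 'e::euclidean_space) chart set \<Rightarrow> ('e \<Rightarrow> 'e) set \<Rightarrow>
     ('m, 'e) frame set \<Rightarrow> bool" where
  "is_reduction M A H P \<longleftrightarrow>
     P \<subseteq> frame_bundle M A \<and>
     (\<forall>x\<in>topspace M. \<exists>U s. x \<in> U \<and> frame_field M A U s \<and>
        {f \<in> P. fst f \<in> U} = {(y, s y \<circ> h) | y h. y \<in> U \<and> h \<in> H})"

text \<open>The tangent space at the identity; for a closed subgroup \<open>H\<close> of the general linear group
  this is the Lie algebra of \<open>H\<close>.\<close>

definition lie_algebra :: "('e::euclidean_space \<Rightarrow> 'e) set \<Rightarrow> ('e \<Rightarrow> 'e) set" where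
  "lie_algebra H = {a. \<exists>\<gamma> :: real \<Rightarrow> 'e \<Rightarrow> 'e. \<gamma> 0 = id \<and> (\<forall>t. \<gamma> t \<in> H) \<and>
     (\<forall>v. ((\<lambda>t. \<gamma> t v) has_vector_derivative a v) (at 0))}"

text \<open>Christoffel symbols of a covariant derivative on the tangent bundle, with the convention
  \<open>(\<nabla>\<^sub>X Y)\<^sub>c = D Y\<^sub>c (X\<^sub>c) + \<Gamma> c x X\<^sub>c Y\<^sub>c\<close> in the chart \<open>c\<close>; the last condition is
  the transformation law that makes \<open>\<nabla>\<close> independent of the chart.\<close>

definition linear_connection ::
  "('m, 'e::euclidean_space) chart set \<Rightarrow> (('m, 'e) chart \<Rightarrow> 'm \<Rightarrow> 'e \<Rightarrow> 'e \<Rightarrow> 'e) \<Rightarrow> bool" where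
  "linear_connection A \<Gamma> \<longleftrightarrow>
     (\<forall>c\<in>A. \<forall>x\<in>fst c. bilinear (\<Gamma> c x)) \<and>
     (\<forall>c\<in>A. \<forall>X Y. smooth_on (snd c ` fst c) (\<lambda>p. \<Gamma> c (chart_inv c p) X Y)) \<and>
     (\<forall>c\<in>A. \<forall>d\<in>A. \<forall>x \<in> fst c \<inter> fst d. \<forall>X Y.
        let J = (\<lambda>p. frechet_derivative (transition c d) (at p)); p = snd c x in
        J p (\<Gamma> c x X Y) =
          \<Gamma> d x (J p X) (J p Y) + frechet_derivative (\<lambda>q. J q Y) (at p) X)"

text \<open>A connection on the \<open>H\<close>-reduction \<open>P\<close> is a linear connection whose connection form, pulled
  back along any local smooth section \<open>s\<close> of \<open>P\<close> (that is, \<open>X \<mapsto> s\<^sup>-\<^sup>1 \<circ> \<nabla>\<^sub>X s\<close>), takes values in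
  the Lie algebra of \<open>H\<close>.\<close>

definition connection_on ::
  "'m topology \<Rightarrow> ('m, 'e::euclidean_space) chart set \<Rightarrow> ('e \<Rightarrow> 'e) set \<Rightarrow>
     ('m, 'e) frame set \<Rightarrow> (('m, 'e) chart \<Rightarrow> 'm \<Rightarrow> 'e \<Rightarrow> 'e \<Rightarrow> 'e) \<Rightarrow> bool" where
  "connection_on M A H P \<Gamma> \<longleftrightarrow>
     linear_connection A \<Gamma> \<and>
     (\<forall>U s. frame_field M A U s \<and> (\<forall>x\<in>U. (x, s x) \<in> P) \<longrightarrow>
       (\<forall>c\<in>A. \<forall>x \<in> U \<inter> fst c. \<forall>X. \<exists>a\<in>lie_algebra H. \<forall>v.
          frechet_derivative (\<lambda>p. s (chart_inv c p) v c) (at (snd c x)) X + \<Gamma> c x X (s x v c)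
            = s x (a v) c))"

text \<open>\<open>\<nabla>\<^sub>X Y - \<nabla>\<^sub>Y X - [X, Y]\<close> as a tangent vector at \<open>x\<close>; in a chart only the
  antisymmetrization of the Christoffel symbols remains.\<close>

definition torsion_tensor ::
  "('m, 'e::euclidean_space) chart set \<Rightarrow> (('m, 'e) chart \<Rightarrow> 'm \<Rightarrow> 'e \<Rightarrow> 'e \<Rightarrow> 'e) \<Rightarrow> 'm \<Rightarrow>
     (('m, 'e) chart \<Rightarrow> 'e) \<Rightarrow> (('m, 'e) chart \<Rightarrow> 'e) \<Rightarrow> (('m, 'e) chart \<Rightarrow> 'e)" where
  "torsion_tensor A \<Gamma> x \<xi> \<eta> =
     (\<lambda>c. if c \<in> charts_at A x then \<Gamma> c x (\<xi> c) (\<eta> c) - \<Gamma> c x (\<eta> c) (\<xi> c) else 0)"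

text \<open>The torsion as an equivariant function on frames, with values in \<open>\<Lambda>\<^sup>2T\<^sup>* \<otimes> T\<close>
  (realized as alternating bilinear maps).\<close>

definition torsion ::
  "('m, 'e::euclidean_space) chart set \<Rightarrow> (('m, 'e) chart \<Rightarrow> 'm \<Rightarrow> 'e \<Rightarrow> 'e \<Rightarrow> 'e) \<Rightarrow>
     ('m, 'e) frame \<Rightarrow> 'e \<Rightarrow> 'e \<Rightarrow> 'e" where
  "torsion A \<Gamma> f v w = (case f of (x, u) \<Rightarrow>
     inv_into UNIV u (torsion_tensor A \<Gamma> x (u v) (u w)))"

section \<open>The model space\<close>

text \<open>With \<open>n = CARD('n)\<close>: \<open>V\<close> is \<open>\<real>\<^sup>4\<^sup>n\<close>, grouped into \<open>n\<close> blocks of length four, so that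
  \<open>x $ j $ i\<close> is the coordinate number \<open>4(j - 1) + i\<close>, and \<open>T = V \<oplus> W\<close>. The subspace \<open>V\<close> of \<open>T\<close> is
  the kernel of \<open>snd\<close>, so \<open>snd\<close> identifies \<open>T/V\<close> with \<open>\<real>\<^sup>3\<close> and the class \<open>w\<^sub>s\<close> with the basis
  vector \<open>axis s 1\<close>.\<close>

type_synonym 'n modelV = "(real ^ 4) ^ 'n"
type_synonym modelW = "real ^ 3"
type_synonym 'n modelT = "'n modelV \<times> modelW"

definition subspaceV :: "'n::finite modelT set" where
  "subspaceV = {v. snd v = 0}"

text \<open>The two-form dual to coordinates \<open>a\<close> and \<open>b\<close> of block \<open>j\<close>.\<close>

definition wedge :: "'n::finite \<Rightarrow> 4 \<Rightarrow> 4 \<Rightarrow> 'n modelV \<Rightarrow> 'n modelV \<Rightarrow> real" where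
  "wedge j a b x y = x $ j $ a * y $ j $ b - x $ j $ b * y $ j $ a"

definition \<omega>1 :: "'n::finite modelV \<Rightarrow> 'n modelV \<Rightarrow> real" where
  "\<omega>1 x y = (\<Sum>j\<in>UNIV. wedge j 1 2 x y - wedge j 3 4 x y)"

definition \<omega>2 :: "'n::finite modelV \<Rightarrow> 'n modelV \<Rightarrow> real" where
  "\<omega>2 x y = (\<Sum>j\<in>UNIV. wedge j 1 3 x y + wedge j 2 4 x y)"

definition \<omega>3 :: "'n::finite modelV \<Rightarrow> 'n modelV \<Rightarrow> real" where
  "\<omega>3 x y = (\<Sum>j\<in>UNIV. wedge j 1 4 x y - wedge j 2 3 x y)"

text \<open>Elements of \<open>\<Lambda>\<^sup>2V\<^sup>* \<otimes> T/V\<close> are represented by the corresponding functions on pairs of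
  vectors of \<open>V\<close>.\<close>

type_synonym 'n coker = "'n modelV \<Rightarrow> 'n modelV \<Rightarrow> modelW"

definition \<Theta>0 :: "'n::finite coker" where
  "\<Theta>0 x y = \<omega>1 x y *\<^sub>R axis 1 1 + \<omega>2 x y *\<^sub>R axis 2 1 + \<omega>3 x y *\<^sub>R axis 3 1"

text \<open>The stabilizer of the subspace \<open>V\<close> in the general linear group of \<open>T\<close>.\<close>

definition groupQ :: "('n::finite modelT \<Rightarrow> 'n modelT) set" where
  "groupQ = {q. linear q \<and> bij q \<and> q ` subspaceV = subspaceV}"

text \<open>The natural action: \<open>q\<^sup>-\<^sup>1\<close> restricted to \<open>V\<close> on the arguments, the map induced by \<open>q\<close> on
  \<open>T/V\<close> on the values.\<close>

definition actQ :: "('n::finite modelT \<Rightarrow> 'n modelT) \<Rightarrow> 'n coker \<Rightarrow> 'n coker" where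
  "actQ q \<theta> x y = snd (q (0, \<theta> (fst (inv q (x, 0))) (fst (inv q (y, 0)))))"

definition groupB :: "('n::finite modelT \<Rightarrow> 'n modelT) set" where
  "groupB = {q \<in> groupQ. actQ q \<Theta>0 = \<Theta>0}"

section \<open>Q-structures and their intrinsic torsion\<close>

definition Q_structure ::
  "'m topology \<Rightarrow> ('m, 'n::finite modelT) chart set \<Rightarrow> ('m, 'n modelT) frame set \<Rightarrow> bool" where
  "Q_structure M A R \<longleftrightarrow> is_reduction M A groupQ R"

text \<open>The projection of \<open>\<Lambda>\<^sup>2T\<^sup>* \<otimes> T\<close> onto the cokernel \<open>\<Lambda>\<^sup>2V\<^sup>* \<otimes> T/V\<close>.\<close>

definition proj_coker ::
  "('n::finite modelT \<Rightarrow> 'n modelT \<Rightarrow> 'n modelT) \<Rightarrow> 'n coker" where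
  "proj_coker \<tau> x y = snd (\<tau> (x, 0) (y, 0))"

text \<open>On a \<open>Q\<close>-structure \<open>R\<close> and a frame of \<open>R\<close> this is well defined: connections exist, and the
  torsions of any two of them have the same projection.\<close>

definition intrinsic_torsion ::
  "'m topology \<Rightarrow> ('m, 'n::finite modelT) chart set \<Rightarrow> ('m, 'n modelT) frame set \<Rightarrow>
     ('m, 'n modelT) frame \<Rightarrow> 'n coker" where
  "intrinsic_torsion M A R f =
     (THE \<theta>. \<exists>\<Gamma>. connection_on M A groupQ R \<Gamma> \<and> \<theta> = proj_coker (torsion A \<Gamma> f))"

definition qc_Q_structure ::
  "'m topology \<Rightarrow> ('m, 'n::finite modelT) chart set \<Rightarrow> ('m, 'n modelT) frame set \<Rightarrow> bool" where
  "qc_Q_structure M A R \<longleftrightarrow> Q_structure M A R \<and>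
     (\<forall>f\<in>R. intrinsic_torsion M A R f \<in> {actQ q \<Theta>0 | q. q \<in> groupQ})"

end

theory Submission
  imports Defs
begin

text \<open>The reduction is \<open>P = {u \<in> R. \<Theta>(u) = \<Theta>0}\<close>. By \<open>Q\<close>-equivariance of the torsion \<open>\<Theta>\<close> it meets
  each fibre of \<open>R\<close> in one \<open>B\<close>-orbit, hence contains no smaller \<open>B\<close>-reduction. Equivariance and
  smoothness of \<open>\<Theta>\<close> are read off from a connection on \<open>R\<close>, glued from the flat connections of local
  frames: along a local frame, \<open>\<Theta>\<close> is minus the Lie bracket modulo the distribution. Local
  sections of \<open>P\<close> exist because the orbit map \<open>q \<mapsto> q \<cdot> \<Theta>0\<close> has smooth local lifts: a triple of forms
  in the orbit determines smoothly a conformal class of metrics on \<open>(T/V)\<^sup>*\<close>; an orthonormal triple for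
  it yields a quaternionic structure with a hermitian metric on \<open>V\<close>, and Gram--Schmidt produces a
  basis that brings the triple to its normal form.\<close>

section \<open>Calculus of smooth maps\<close>

text \<open>\<open>intrinsic_torsion\<close> is a definite description over connections on
  \<open>R\<close>, so it has a value only once a connection is constructed and all connections are
  seen to agree. They agree because, along an adapted frame, a connection enters the torsion only
  through Lie algebra terms that map \<open>V\<close> into \<open>V\<close> and so vanish in
  \<open>T/V\<close>. The obstacle to smooth local sections is that a point of the orbit determines
  neither the change of basis in \<open>V\<close> nor the one in \<open>T/V\<close> that produced
  it, while a section must choose both smoothly. The way out is a ratio: for covectors a, b of
  \<open>T/V\<close> the endomorphism (a.\<theta>)^-1 (b.\<theta>) of \<open>V\<close> is conjugate,
  by the unknown change of basis in \<open>V\<close>, to a multiple of a product of two imaginary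
  quaternions. Traces ignore the conjugation, and traces of such products are made of inner products
  of the imaginary quaternions; this is the source of the conformal class. From there on only
  inverses of linear maps and square roots occur, so smoothness in \<theta> is followed formula by
  formula.\<close>

abbreviation deriv_at ::
  "('a::real_normed_vector \<Rightarrow> 'b::real_normed_vector) \<Rightarrow> 'a \<Rightarrow> 'a \<Rightarrow> 'b" where
  "deriv_at f x \<equiv> frechet_derivative f (at x)"

lemma linear_inv:
  fixes f :: "'a::euclidean_space \<Rightarrow> 'a"
  shows "linear f \<Longrightarrow> bij f \<Longrightarrow> linear (inv f)"
  by (simp add: inj_linear_imp_inv_linear bij_is_inj)

text \<open>Turns a linear map at a varying vector into finitely many values at fixed vectors, which
  are the values whose smoothness is known in the applications.\<close>

lemma linear_sum_Basis:
  fixes v :: "'b::euclidean_space"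
  assumes "linear f"
  shows "(\<Sum>b\<in>Basis. (v \<bullet> b) *\<^sub>R f b) = f v"
proof -
  interpret linear f by fact
  have "f v = f (\<Sum>b\<in>Basis. (v \<bullet> b) *\<^sub>R b)" by (simp only: euclidean_representation)
  then show ?thesis by (simp only: sum scale)
qed

section \<open>Iterated directional derivatives up to a given order\<close>

lemma hdiff_continuous_on:
  "higher_differentiable_on S f k \<Longrightarrow> continuous_on S f" by (cases k)
    (auto intro!: continuous_at_imp_continuous_on simp: differentiable_imp_continuous_within)

lemma hdiff_subset:
  "higher_differentiable_on S f k \<Longrightarrow> T \<subseteq> S \<Longrightarrow> higher_differentiable_on T f k"
  by (induction k arbitrary: f) (auto intro: continuous_on_subset)

text \<open>Openness matters: \<open>frechet_derivative\<close> at a point sees a neighbourhood, so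
  agreement on \<open>S\<close> passes to derivatives only at interior points.\<close>

lemma hdiff_cong:
  assumes "open S" "\<And>x. x \<in> S \<Longrightarrow> f x = g x" "higher_differentiable_on S f k"
  shows "higher_differentiable_on S g k" using assms(2,3)
proof (induction k arbitrary: f g)
  case 0
  then show ?case by (auto cong: continuous_on_cong)
next
  case (Suc k)
  have d: "f differentiable at x" if "x \<in> S" for x
    using Suc.prems that by simp
  have "g differentiable at x" if "x \<in> S" for x
    using d[OF that] Suc.prems(1) assms(1) that
    by (metis differentiable_def has_derivative_transform_within_open)
  moreover have "deriv_at f x = deriv_at g x" if "x \<in> S" for x
    using frechet_derivative_transform_within_open[OF d[OF that] assms(1) that] Suc.prems(1) by simp
  moreover have "higher_differentiable_on S (\<lambda>x. deriv_at g x v) k" for v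
    by (rule Suc.IH[of "\<lambda>x. deriv_at f x v"]) (use Suc.prems(2) calculation in simp_all)
  ultimately show ?case by auto
qed

lemma hdiff_local:
  assumes "\<And>x. x \<in> S \<Longrightarrow> \<exists>T. open T \<and> x \<in> T \<and> higher_differentiable_on T f k"
  shows "higher_differentiable_on S f k" using assms
proof (induction k arbitrary: f)
  case 0
  have "isCont f x" if x: "x \<in> S" for x
  proof -
    obtain T where "open T" "x \<in> T" "higher_differentiable_on T f 0" using 0[OF x] by blast
    then show ?thesis by (simp add: continuous_on_eq_continuous_at)
  qed
  then show ?case by (simp add: continuous_at_imp_continuous_on)
next
  case (Suc k)
  have "f differentiable at x" if x: "x \<in> S" for x
  proof -
    obtain T where "open T" "x \<in> T" "higher_differentiable_on T f (Suc k)"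
      using Suc.prems[OF x] by blast
    then show ?thesis by simp
  qed
  moreover have "higher_differentiable_on S (\<lambda>x. deriv_at f x v) k" for v
  proof (rule Suc.IH)
    fix x assume x: "x \<in> S"
    obtain T where "open T" "x \<in> T" "higher_differentiable_on T f (Suc k)"
      using Suc.prems[OF x] by blast
    then show "\<exists>T. open T \<and> x \<in> T \<and>
        higher_differentiable_on T (\<lambda>x. deriv_at f x v) k" by (intro exI[of _ T]) simp
  qed
  ultimately show ?case by simp
qed

text \<open>The form in which closure properties are proved by induction on the order: exhibit the
  derivative, then treat its values in fixed directions by the induction hypothesis.\<close>

lemma hdiff_SucI:
  assumes "open S" "\<And>x. x \<in> S \<Longrightarrow> (f has_derivative f' x) (at x)"
    and "\<And>v. higher_differentiable_on S (\<lambda>x. f' x v) k"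
  shows "higher_differentiable_on S f (Suc k)"
proof -
  have "f' x = deriv_at f x" if "x \<in> S" for x
    using assms(2)[OF that] by (rule frechet_derivative_at)
  then have "higher_differentiable_on S (\<lambda>x. deriv_at f x v) k" for v
    by (intro hdiff_cong[OF assms(1) _ assms(3)[of v]]) simp
  then show ?thesis using assms(2) by (auto simp: differentiable_def)
qed

text \<open>Product and chain rule put an undifferentiated factor beside a differentiated one; this
  brings both to the same order.\<close>

lemma hdiff_SucD:
  "higher_differentiable_on S f (Suc k) \<Longrightarrow> higher_differentiable_on S f k"
proof (induction k arbitrary: f)
  case 0
  then show ?case using hdiff_continuous_on[of S f "Suc 0"] by simp
next
  case (Suc k)
  then show ?case by (metis higher_differentiable_on.simps(2))
qed

lemma has_derivative_frechet:
  "f differentiable F \<Longrightarrow> (f has_derivative frechet_derivative f F) F"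
  by (simp add: frechet_derivative_works)

lemma hdiff_const [simp]: "higher_differentiable_on S (\<lambda>x. c) k"
  by (induction k arbitrary: c) auto

lemma hdiff_bounded_linear:
  assumes "open S" "bounded_linear L" "higher_differentiable_on S f k"
  shows "higher_differentiable_on S (\<lambda>x. L (f x)) k" using assms(3)
proof (induction k arbitrary: f)
  case 0
  then show ?case by (simp add: bounded_linear.continuous_on[OF assms(2)])
next
  case (Suc k)
  show ?case
  proof (rule hdiff_SucI[OF assms(1)])
    show "((\<lambda>x. L (f x)) has_derivative (\<lambda>v. L (deriv_at f x v))) (at x)" if "x \<in> S" for x
      using Suc.prems that
      by (intro bounded_linear.has_derivative[OF assms(2)] has_derivative_frechet) auto
    show "higher_differentiable_on S (\<lambda>x. L (deriv_at f x v)) k" for v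
      using Suc.prems by (intro Suc.IH) simp
  qed
qed

lemma hdiff_ident [simp]: "higher_differentiable_on S (\<lambda>x. x) k"
  by (cases k) auto

lemma hdiff_add:
  assumes "open S" "higher_differentiable_on S f k" "higher_differentiable_on S g k"
  shows "higher_differentiable_on S (\<lambda>x. f x + g x) k" using assms(2,3)
proof (induction k arbitrary: f g)
  case 0
  then show ?case by (simp add: continuous_on_add)
next
  case (Suc k)
  show ?case
  proof (rule hdiff_SucI[OF assms(1)])
    show "((\<lambda>x. f x + g x) has_derivative
        (\<lambda>v. deriv_at f x v + deriv_at g x v)) (at x)"
      if "x \<in> S" for x
      using Suc.prems that by (intro has_derivative_add has_derivative_frechet) auto
    show "higher_differentiable_on S
        (\<lambda>x. deriv_at f x v + deriv_at g x v) k" for v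
      using Suc.prems by (intro Suc.IH) simp_all
  qed
qed

lemma hdiff_bounded_bilinear:
  assumes "open S" "bounded_bilinear B"
    and "higher_differentiable_on S f k" "higher_differentiable_on S g k"
  shows "higher_differentiable_on S (\<lambda>x. B (f x) (g x)) k" using assms(3,4)
proof (induction k arbitrary: f g)
  case 0
  then show ?case by (simp add: bounded_bilinear.continuous_on[OF assms(2)])
next
  case (Suc k)
  show ?case
  proof (rule hdiff_SucI[OF assms(1)])
    show "((\<lambda>x. B (f x) (g x)) has_derivative
        (\<lambda>v. B (f x) (deriv_at g x v) + B (deriv_at f x v) (g x)))
        (at x)" if "x \<in> S" for x
      using Suc.prems that
      by (intro bounded_bilinear.FDERIV[OF assms(2)] has_derivative_frechet) auto
    show "higher_differentiable_on S
        (\<lambda>x. B (f x) (deriv_at g x v) + B (deriv_at f x v) (g x)) k"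
      for v
      using Suc.prems hdiff_SucD[of S f k] hdiff_SucD[of S g k]
      by (intro hdiff_add[OF assms(1)] Suc.IH) auto
  qed
qed

lemma hdiff_sum:
  assumes "open S" "\<And>i. i \<in> I \<Longrightarrow> higher_differentiable_on S (f i) k"
  shows "higher_differentiable_on S (\<lambda>x. \<Sum>i\<in>I. f i x) k" using assms(2)
proof (induction I rule: infinite_finite_induct)
  case (insert i I)
  then show ?case by (simp add: hdiff_add[OF assms(1)])
qed auto

lemma hdiff_compose:
  fixes g :: "'a::real_normed_vector \<Rightarrow> 'b::euclidean_space"
  assumes "open S" "open T" "g ` S \<subseteq> T"
    and "higher_differentiable_on S g k" "higher_differentiable_on T f k"
  shows "higher_differentiable_on S (\<lambda>x. f (g x)) k" using assms(4,5)
proof (induction k arbitrary: f)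
  case 0
  then show ?case using assms(3) by (auto intro: continuous_on_compose2)
next
  case (Suc k)
  show ?case
  proof (rule hdiff_SucI[OF assms(1)])
    fix x assume x: "x \<in> S"
    then have fx: "f differentiable at (g x)" using Suc.prems assms(3) by auto
    have "((\<lambda>x. f (g x)) has_derivative
        (\<lambda>v. deriv_at f (g x) (deriv_at g x v))) (at x)" using Suc.prems x fx
      by (intro has_derivative_compose[OF _ has_derivative_frechet[of f]] has_derivative_frechet) auto
    \<comment> \<open>The direction \<open>deriv_at g x v\<close> moves with \<open>x\<close>, but
      the definition speaks of fixed directions; the basis expansion makes the chain rule a sum of
      products that the induction hypothesis covers.\<close>
    moreover have "deriv_at f (g x) (deriv_at g x v) =
        (\<Sum>b\<in>Basis. (deriv_at g x v \<bullet> b) *\<^sub>R deriv_at f (g x) b)"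
      for v
      by (rule linear_sum_Basis[symmetric, OF linear_frechet_derivative[OF fx]])
    ultimately show "((\<lambda>x. f (g x)) has_derivative
        (\<lambda>v. \<Sum>b\<in>Basis. (deriv_at g x v \<bullet> b) *\<^sub>R deriv_at f (g x) b))
        (at x)" by simp
  next
    fix v
    have g: "higher_differentiable_on S g k" using Suc.prems(1) by (rule hdiff_SucD)
    show "higher_differentiable_on S (\<lambda>x. \<Sum>b\<in>Basis.
        (deriv_at g x v \<bullet> b) *\<^sub>R deriv_at f (g x) b) k" using Suc.prems
      by (intro hdiff_sum[OF assms(1)] Suc.IH[OF g]
          hdiff_bounded_bilinear[OF assms(1) bounded_bilinear_scaleR]
          hdiff_bounded_linear[OF assms(1) bounded_linear_inner_left]) auto
  qed
qed

section \<open>Maps with derivatives of all orders\<close>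

lemma smooth_on_cong:
  "open S \<Longrightarrow> smooth_on S f \<Longrightarrow> (\<And>x. x \<in> S \<Longrightarrow> f x = g x) \<Longrightarrow> smooth_on S g"
  unfolding smooth_on_def by (blast intro: hdiff_cong)

lemma smooth_on_subset: "smooth_on S f \<Longrightarrow> T \<subseteq> S \<Longrightarrow> smooth_on T f"
  unfolding smooth_on_def by (blast intro: hdiff_subset)

lemma smooth_on_local:
  assumes "\<And>x. x \<in> S \<Longrightarrow> \<exists>T. open T \<and> x \<in> T \<and> smooth_on T f"
  shows "smooth_on S f"
  unfolding smooth_on_def
proof (intro allI hdiff_local)
  fix k x assume "x \<in> S"
  then show "\<exists>T. open T \<and> x \<in> T \<and> higher_differentiable_on T f k"
    using assms[of x] unfolding smooth_on_def by metis
qed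

lemma smooth_on_const [simp]: "smooth_on S (\<lambda>x. c)"
  by (simp add: smooth_on_def)

lemma smooth_on_ident [simp]: "smooth_on S (\<lambda>x. x)"
  by (simp add: smooth_on_def)

lemma smooth_on_add:
  "open S \<Longrightarrow> smooth_on S f \<Longrightarrow> smooth_on S g \<Longrightarrow> smooth_on S (\<lambda>x. f x + g x)"
  by (simp add: smooth_on_def hdiff_add)

lemma smooth_on_bounded_linear:
  "open S \<Longrightarrow> bounded_linear L \<Longrightarrow> smooth_on S f \<Longrightarrow> smooth_on S (\<lambda>x. L (f x))"
  by (simp add: smooth_on_def hdiff_bounded_linear)

lemma smooth_on_minus: "open S \<Longrightarrow> smooth_on S f \<Longrightarrow> smooth_on S (\<lambda>x. - f x)"
  by (rule smooth_on_bounded_linear[OF _ bounded_linear_minus[OF bounded_linear_ident]])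

lemma smooth_on_diff:
  "open S \<Longrightarrow> smooth_on S f \<Longrightarrow> smooth_on S g \<Longrightarrow> smooth_on S (\<lambda>x. f x - g x)"
  using smooth_on_add[OF _ _ smooth_on_minus] by fastforce

lemma smooth_on_bounded_bilinear:
  "open S \<Longrightarrow> bounded_bilinear B \<Longrightarrow> smooth_on S f \<Longrightarrow> smooth_on S g \<Longrightarrow>
    smooth_on S (\<lambda>x. B (f x) (g x))" by (simp add: smooth_on_def hdiff_bounded_bilinear)

lemmas smooth_on_scaleR = smooth_on_bounded_bilinear[OF _ bounded_bilinear_scaleR]
lemmas smooth_on_mult = smooth_on_bounded_bilinear[OF _ bounded_bilinear_mult]
lemmas smooth_on_inner = smooth_on_bounded_bilinear[OF _ bounded_bilinear_inner]

lemma smooth_on_sum: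
  "open S \<Longrightarrow> (\<And>i. i \<in> I \<Longrightarrow> smooth_on S (f i)) \<Longrightarrow> smooth_on S (\<lambda>x. \<Sum>i\<in>I. f i x)"
  by (simp add: smooth_on_def hdiff_sum)

lemma smooth_on_prod:
  fixes f :: "'i \<Rightarrow> 'a::real_normed_vector \<Rightarrow> real"
  shows "open S \<Longrightarrow> (\<And>i. i \<in> I \<Longrightarrow> smooth_on S (f i)) \<Longrightarrow> smooth_on S (\<lambda>x. \<Prod>i\<in>I. f i x)"
proof (induction I rule: infinite_finite_induct)
  case (insert i I)
  then show ?case by (simp add: smooth_on_mult)
qed auto

lemma smooth_on_compose:
  fixes g :: "'a::real_normed_vector \<Rightarrow> 'b::euclidean_space"
  shows "open S \<Longrightarrow> open T \<Longrightarrow> g ` S \<subseteq> T \<Longrightarrow> smooth_on S g \<Longrightarrow> smooth_on T f \<Longrightarrow>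
    smooth_on S (\<lambda>x. f (g x))" by (simp add: smooth_on_def hdiff_compose)

lemma smooth_on_imp_continuous_on: "smooth_on S f \<Longrightarrow> continuous_on S f"
  unfolding smooth_on_def using hdiff_continuous_on by blast

lemma smooth_on_imp_differentiable: "smooth_on S f \<Longrightarrow> x \<in> S \<Longrightarrow> f differentiable at x"
  unfolding smooth_on_def by (metis higher_differentiable_on.simps(2))

lemma smooth_on_deriv_at:
  "smooth_on S f \<Longrightarrow> smooth_on S (\<lambda>x. deriv_at f x v)"
  unfolding smooth_on_def by (metis higher_differentiable_on.simps(2))

lemma hdiff_real_SucI:
  fixes f :: "real \<Rightarrow> real"
  assumes "open S" "\<And>x. x \<in> S \<Longrightarrow> (f has_real_derivative f' x) (at x)"
    and "higher_differentiable_on S f' k"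
  shows "higher_differentiable_on S f (Suc k)" using assms
  by (intro hdiff_SucI[where f' = "\<lambda>x v. f' x * v"]
      hdiff_bounded_bilinear[OF _ bounded_bilinear_mult])
    (auto simp: has_field_derivative_def)

text \<open>The derivative is a polynomial in the function itself, so each order gives the
  next.\<close>

lemma smooth_on_inverse_real: "smooth_on (- {0}) (inverse :: real \<Rightarrow> real)"
proof -
  have op: "open (- {0::real})" by auto
  have "higher_differentiable_on (- {0}) (inverse :: real \<Rightarrow> real) k" for k
  proof (induction k)
    case 0
    then show ?case by (auto intro!: continuous_intros)
  next
    case (Suc k)
    show ?case
    proof (rule hdiff_real_SucI[OF op])
      show "(inverse has_real_derivative - 1 * (inverse x * inverse x)) (at x)"
        if "x \<in> - {0}" for x :: real
        using that by (auto intro!: derivative_eq_intros simp: power2_eq_square)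
      show "higher_differentiable_on (- {0}) (\<lambda>x::real. - 1 * (inverse x * inverse x)) k"
        by (intro hdiff_bounded_bilinear[OF op bounded_bilinear_mult] Suc)
          simp
    qed
  qed
  then show ?thesis by (simp add: smooth_on_def)
qed

lemma smooth_on_inverse:
  fixes f :: "'a::real_normed_vector \<Rightarrow> real"
  assumes "open S" "smooth_on S f" "\<And>x. x \<in> S \<Longrightarrow> f x \<noteq> 0"
  shows "smooth_on S (\<lambda>x. inverse (f x))"
  by (rule smooth_on_compose[OF assms(1) _ _ assms(2) smooth_on_inverse_real]) (use assms in auto)

text \<open>The derivative is half the reciprocal of the function, so each order gives the
  next.\<close>

lemma smooth_on_sqrt_real: "smooth_on {0<..} sqrt"
proof -
  have op: "open {0::real<..}" by auto
  have "higher_differentiable_on {0<..} sqrt k" for k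
  proof (induction k)
    case 0
    then show ?case by (auto intro!: continuous_intros)
  next
    case (Suc k)
    show ?case
    proof (rule hdiff_real_SucI[OF op])
      show "(sqrt has_real_derivative inverse (sqrt x) * (1/2)) (at x)" if "x \<in> {0<..}" for x
        using that DERIV_real_sqrt[of x] by (simp add: divide_simps)
      show "higher_differentiable_on {0<..} (\<lambda>x. inverse (sqrt x) * (1/2)) k"
        by (intro hdiff_bounded_bilinear[OF op bounded_bilinear_mult]
            hdiff_compose[where T = "- {0}", OF op _ _ Suc]
            smooth_on_inverse_real[unfolded smooth_on_def, rule_format]) auto
    qed
  qed
  then show ?thesis by (simp add: smooth_on_def)
qed

lemma smooth_on_sqrt:
  fixes f :: "'a::real_normed_vector \<Rightarrow> real"
  assumes "open S" "smooth_on S f" "\<And>x. x \<in> S \<Longrightarrow> f x > 0"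
  shows "smooth_on S (\<lambda>x. sqrt (f x))"
  by (rule smooth_on_compose[OF assms(1) _ _ assms(2) smooth_on_sqrt_real]) (use assms in auto)


section \<open>Families of linear maps and their inverses\<close>

lemma hdiff_linear_apply:
  fixes F :: "'a::real_normed_vector \<Rightarrow> 'b::euclidean_space \<Rightarrow> 'c::real_normed_vector"
  assumes "open S" "\<And>x. x \<in> S \<Longrightarrow> linear (F x)"
    and "\<And>v. higher_differentiable_on S (\<lambda>x. F x v) k" "higher_differentiable_on S w k"
  shows "higher_differentiable_on S (\<lambda>x. F x (w x)) k"
proof -
  have "(\<Sum>b\<in>Basis. (w x \<bullet> b) *\<^sub>R F x b) = F x (w x)" if "x \<in> S" for x
    by (rule linear_sum_Basis[OF assms(2)[OF that]])
  moreover have "higher_differentiable_on S (\<lambda>x. \<Sum>b\<in>Basis. (w x \<bullet> b) *\<^sub>R F x b) k"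
    by (intro hdiff_sum[OF assms(1)] assms
        hdiff_bounded_bilinear[OF assms(1) bounded_bilinear_scaleR]
        hdiff_bounded_linear[OF assms(1) bounded_linear_inner_left])
  ultimately show ?thesis by (rule hdiff_cong[OF assms(1)])
qed

lemma smooth_on_linear_apply:
  fixes F :: "'a::real_normed_vector \<Rightarrow> 'b::euclidean_space \<Rightarrow> 'c::real_normed_vector"
  assumes "open S" "\<And>x. x \<in> S \<Longrightarrow> linear (F x)"
    and "\<And>v. smooth_on S (\<lambda>x. F x v)" "smooth_on S w"
  shows "smooth_on S (\<lambda>x. F x (w x))"
  unfolding smooth_on_def
  by (rule allI, rule hdiff_linear_apply[OF assms(1,2)])
    (use assms(3,4) in \<open>simp_all add: smooth_on_def\<close>)

text \<open>\<open>F x0\<close> is bounded below by some \<open>B > 0\<close>, hence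
  \<open>F x\<close> by \<open>B / 2\<close> once the two differ by less than \<open>B / 2\<close>.
  Applied to \<open>inv (F x) v - inv (F x0) v\<close>, whose image under \<open>F x\<close> tends
  to 0, this gives continuity.\<close>

lemma continuous_at_inv_linear:
  fixes F :: "'a::real_normed_vector \<Rightarrow> 'b::euclidean_space \<Rightarrow> 'b"
  assumes lin: "eventually (\<lambda>x. linear (F x) \<and> bij (F x)) (nhds x0)"
    and cont: "\<And>v. isCont (\<lambda>x. F x v) x0"
  shows "isCont (\<lambda>x. inv (F x) v) x0"
proof -
  have F0: "linear (F x0)" "bij (F x0)" using eventually_nhds_x_imp_x[OF lin] by auto
  obtain B where B: "B > 0" "\<And>v. B * norm v \<le> norm (F x0 v)"
    using linear_inj_bounded_below_pos[OF F0(1) bij_is_inj[OF F0(2)]] by metis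
  \<comment> \<open>A bound for the operator norm of \<open>F x - F x0\<close> made of finitely many
    continuous terms.\<close>
  define e where "e = (\<lambda>x. \<Sum>b\<in>Basis. norm (F x b - F x0 b))"
  have "(e \<longlongrightarrow> (\<Sum>b\<in>Basis. norm (F x0 b - F x0 b))) (at x0)"
    unfolding e_def by (intro tendsto_intros isContD[OF cont])
  then have e: "eventually (\<lambda>x. e x < B / 2) (at x0)" by (rule order_tendstoD) (use B in auto)
  have lin': "eventually (\<lambda>x. linear (F x) \<and> bij (F x)) (at x0)"
    using lin by (simp add: eventually_at_filter eventually_mono)
  define u where "u = inv (F x0) v"
  have u: "F x0 u = v"
    unfolding u_def using F0(2) by (simp add: bij_is_surj surj_f_inv_f)
  have "eventually (\<lambda>x. norm (inv (F x) v - u) \<le> norm (v - F x u) * (2 / B)) (at x0)" using e lin'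
  proof eventually_elim
    case (elim x)
    interpret Fx: linear "F x" using elim by auto
    interpret F0: linear "F x0" using F0 by auto
    have diff: "norm (F x w - F x0 w) \<le> norm w * e x" for w
    proof -
      have "F x w - F x0 w = (\<Sum>b\<in>Basis. (w \<bullet> b) *\<^sub>R (F x b - F x0 b))"
        by (subst (1 2) euclidean_representation[of w, symmetric])
          (simp only: Fx.sum F0.sum Fx.scale F0.scale scaleR_diff_right sum_subtractf)
      also have "norm \<dots> \<le> (\<Sum>b\<in>Basis. norm w * norm (F x b - F x0 b))"
        by (intro sum_norm_le) (simp add: mult_right_mono Basis_le_norm)
      finally show ?thesis by (simp add: e_def sum_distrib_left)
    qed
    define d where "d = inv (F x) v - u"
    have Fd: "F x d = v - F x u" using elim by (simp add: d_def Fx.diff bij_is_surj surj_f_inv_f)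
    have "B * norm d \<le> norm (F x0 d)" by (rule B)
    also have "\<dots> \<le> norm (F x d) + norm (F x d - F x0 d)"
      by (metis add.commute norm_triangle_sub norm_minus_commute)
    also have "\<dots> \<le> norm (F x d) + norm d * (B / 2)"
      using diff[of d] elim by (smt (verit) mult_left_mono norm_ge_zero)
    finally have "B / 2 * norm d \<le> norm (v - F x u)" by (simp add: Fd mult.commute)
    then show ?case using B by (simp add: d_def field_simps)
  qed
  moreover have "((\<lambda>x. v - F x u) \<longlongrightarrow> v - F x0 u) (at x0)" by (intro tendsto_intros isContD[OF cont])
  then have "((\<lambda>x. v - F x u) \<longlongrightarrow> 0) (at x0)" by (simp add: u)
  ultimately have "((\<lambda>x. inv (F x) v - u) \<longlongrightarrow> 0) (at x0)" by (rule tendsto_0_le[rotated])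
  then show ?thesis
    unfolding isCont_def u_def by (simp add: LIM_zero_iff)
qed

text \<open>A product rule in which \<open>g\<close> is only continuous: since \<open>a\<close>
  vanishes at \<open>x0\<close>, the increment of \<open>g\<close> contributes a term of higher
  order. It allows the inverse to be differentiated from its continuity alone.\<close>

lemma has_derivative_scaleR_zero:
  fixes a :: "'a::real_normed_vector \<Rightarrow> real"
  assumes a: "(a has_derivative a') (at x0)" "a x0 = 0" and g: "isCont g x0"
  shows "((\<lambda>x. a x *\<^sub>R g x) has_derivative (\<lambda>h. a' h *\<^sub>R g x0)) (at x0)"
proof -
  have bl: "bounded_linear a'" using a(1) by (rule has_derivative_bounded_linear)
  then obtain K where K: "\<And>x. norm (a' x) \<le> norm x * K" using bounded_linear.bounded by blast
  have r: "((\<lambda>x. (a x - a' (x - x0)) /\<^sub>R norm (x - x0)) \<longlongrightarrow> 0) (at x0)"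
    using a by (simp add: has_derivative_at_within)
  have "((\<lambda>x. ((a x - a' (x - x0)) /\<^sub>R norm (x - x0)) *\<^sub>R g x) \<longlongrightarrow> 0 *\<^sub>R g x0) (at x0)"
    by (intro tendsto_intros r isContD[OF g])
  moreover have "((\<lambda>x. (a' (x - x0) /\<^sub>R norm (x - x0)) *\<^sub>R (g x - g x0)) \<longlongrightarrow> 0) (at x0)"
  proof (rule tendsto_0_le[where K = K])
    show "((\<lambda>x. g x - g x0) \<longlongrightarrow> 0) (at x0)" using g by (simp add: isCont_def LIM_zero_iff)
    have "norm ((a' (x - x0) /\<^sub>R norm (x - x0)) *\<^sub>R (g x - g x0)) \<le> norm (g x - g x0) * K"
      if "x \<noteq> x0" for x
    proof -
      have "norm (a' (x - x0) /\<^sub>R norm (x - x0)) \<le> K"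
        using K[of "x - x0"] that by (simp add: field_simps)
      then show ?thesis
        by (simp only: norm_scaleR real_norm_def mult.commute[of _ K]) (simp add: mult_right_mono)
    qed
    then show "eventually (\<lambda>x. norm ((a' (x - x0) /\<^sub>R norm (x - x0)) *\<^sub>R (g x - g x0))
        \<le> norm (g x - g x0) * K) (at x0)" by (simp add: eventually_at_filter)
  qed
  ultimately have "((\<lambda>x. ((a x - a' (x - x0)) /\<^sub>R norm (x - x0)) *\<^sub>R g x +
      (a' (x - x0) /\<^sub>R norm (x - x0)) *\<^sub>R (g x - g x0)) \<longlongrightarrow> 0 *\<^sub>R g x0 + 0) (at x0)"
    by (rule tendsto_add)
  then have "((\<lambda>x. (a x *\<^sub>R g x - a' (x - x0) *\<^sub>R g x0) /\<^sub>R norm (x - x0)) \<longlongrightarrow> 0) (at x0)"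
    by (simp add: algebra_simps scaleR_diff_left scaleR_diff_right)
  moreover have "bounded_linear (\<lambda>h. a' h *\<^sub>R g x0)" by (rule bounded_linear_scaleR_const[OF bl])
  ultimately show ?thesis using a(2) by (simp add: has_derivative_at_within)
qed

text \<open>With \<open>u = inv (F x0) w\<close> one has
  \<open>inv (F x) w = u - inv (F x) (F x u - w)\<close> near \<open>x0\<close>, and
  \<open>F x u - w\<close> vanishes at \<open>x0\<close>, so the preceding product rule applies to
  each component.\<close>

lemma has_derivative_inv_linear:
  fixes F :: "'a::real_normed_vector \<Rightarrow> 'b::euclidean_space \<Rightarrow> 'b"
  assumes lin: "eventually (\<lambda>x. linear (F x) \<and> bij (F x)) (nhds x0)"
    and der: "\<And>v. ((\<lambda>x. F x v) has_derivative (\<lambda>h. F' h v)) (at x0)"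
  shows "((\<lambda>x. inv (F x) w) has_derivative (\<lambda>h. - inv (F x0) (F' h (inv (F x0) w)))) (at x0)"
proof -
  have F0: "linear (F x0)" "bij (F x0)" using eventually_nhds_x_imp_x[OF lin] by auto
  have cont: "isCont (\<lambda>x. inv (F x) v) x0" for v
    by (rule continuous_at_inv_linear[OF lin]) (rule has_derivative_continuous[OF der])
  define u where "u = inv (F x0) w"
  have u: "F x0 u = w"
    unfolding u_def using F0(2) by (simp add: bij_is_surj surj_f_inv_f)
  have "((\<lambda>x. u - (\<Sum>b\<in>Basis. ((F x u - w) \<bullet> b) *\<^sub>R inv (F x) b)) has_derivative
      (\<lambda>h. 0 - (\<Sum>b\<in>Basis. (F' h u \<bullet> b) *\<^sub>R inv (F x0) b))) (at x0)"
    by (intro has_derivative_diff has_derivative_const has_derivative_sum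
        has_derivative_scaleR_zero cont has_derivative_inner_left)
      (use has_derivative_diff[OF der[of u] has_derivative_const[of w]] in \<open>auto simp: u\<close>)
  moreover have "(\<Sum>b\<in>Basis. (y \<bullet> b) *\<^sub>R inv (F x) b) = inv (F x) y"
    if "linear (F x)" "bij (F x)" for x y
    using that by (intro linear_sum_Basis inj_linear_imp_inv_linear bij_is_inj)
  moreover have "u - inv (F x) (F x u - w) = inv (F x) w" if "linear (F x)" "bij (F x)" for x
  proof -
    interpret linear "inv (F x)" using that by (simp add: linear_inv)
    show ?thesis using that by (simp add: diff bij_is_inj)
  qed
  ultimately have "((\<lambda>x. u - (\<Sum>b\<in>Basis. ((F x u - w) \<bullet> b) *\<^sub>R inv (F x) b)) has_derivative
      (\<lambda>h. - inv (F x0) (F' h u))) (at x0)"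
    and "eventually (\<lambda>x. u - (\<Sum>b\<in>Basis. ((F x u - w) \<bullet> b) *\<^sub>R inv (F x) b) = inv (F x) w) (nhds x0)"
    using F0 lin by (auto elim: eventually_mono)
  then show ?thesis
    unfolding u_def[symmetric]
    by (elim has_derivative_transform_eventually)
      (auto dest: eventually_nhds_x_imp_x simp: eventually_at_filter elim: eventually_mono)
qed

lemma linear_deriv_at_family:
  fixes F :: "'a::real_normed_vector \<Rightarrow> 'b::real_normed_vector \<Rightarrow> 'c::real_normed_vector"
  assumes lin: "eventually (\<lambda>x. linear (F x)) (nhds x)"
    and d: "\<And>v. (\<lambda>x. F x v) differentiable (at x)"
  shows "linear (\<lambda>v. deriv_at (\<lambda>x. F x v) x h)"
proof (rule linearI)
  fix u v :: 'b and c :: real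
  note F' = has_derivative_frechet[OF d]
  have e: "eventually (\<lambda>y. F y u + F y v = F y (u + v)) (nhds x)"
    "eventually (\<lambda>y. c *\<^sub>R F y u = F y (c *\<^sub>R u)) (nhds x)"
    using lin by (auto elim!: eventually_mono simp: linear_add linear_scale)
  have "((\<lambda>y. F y (u + v)) has_derivative (\<lambda>h. deriv_at (\<lambda>x. F x u) x h +
      deriv_at (\<lambda>x. F x v) x h)) (at x)" using has_derivative_add[OF F'[of u] F'[of v]] e(1)
    by (elim has_derivative_transform_eventually)
      (auto dest: eventually_nhds_x_imp_x simp: eventually_at_filter elim: eventually_mono)
  then show "deriv_at (\<lambda>x. F x (u + v)) x h =
      deriv_at (\<lambda>x. F x u) x h + deriv_at (\<lambda>x. F x v) x h"
    using fun_cong[OF has_derivative_unique[OF F'[of "u + v"]], of _ h] by simp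
  have "((\<lambda>y. F y (c *\<^sub>R u)) has_derivative
      (\<lambda>h. c *\<^sub>R deriv_at (\<lambda>x. F x u) x h)) (at x)"
    using has_derivative_scaleR_right[OF F'[of u], of c] e(2)
    by (elim has_derivative_transform_eventually)
      (auto dest: eventually_nhds_x_imp_x simp: eventually_at_filter elim: eventually_mono)
  then show "deriv_at (\<lambda>x. F x (c *\<^sub>R u)) x h =
      c *\<^sub>R deriv_at (\<lambda>x. F x u) x h"
    using fun_cong[OF has_derivative_unique[OF F'[of "c *\<^sub>R u"]], of _ h] by simp
qed

text \<open>The derivative of the inverse contains the inverse only undifferentiated, so each order
  gives the next.\<close>

lemma hdiff_inv_linear:
  fixes F :: "'a::real_normed_vector \<Rightarrow> 'b::euclidean_space \<Rightarrow> 'b"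
  assumes "open S" and lin: "\<And>x. x \<in> S \<Longrightarrow> linear (F x)" "\<And>x. x \<in> S \<Longrightarrow> bij (F x)"
    and "\<And>v. higher_differentiable_on S (\<lambda>x. F x v) k"
  shows "higher_differentiable_on S (\<lambda>x. inv (F x) w) k"
proof -
  have ev: "eventually (\<lambda>x. linear (F x) \<and> bij (F x)) (nhds x0)" if "x0 \<in> S" for x0
    using that assms(1) lin by (auto simp: eventually_nhds)
  have linv: "linear (inv (F x))" if "x \<in> S" for x
    using lin that by (simp add: linear_inv)
  show ?thesis using assms(4)
  proof (induction k arbitrary: w)
    case 0
    then show ?case using continuous_at_inv_linear[OF ev] assms(1)
      by (auto simp: continuous_on_eq_continuous_at)
  next
    case (Suc k)
    have d: "(\<lambda>x. F x v) differentiable (at x)" if "x \<in> S" for v x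
      using Suc.prems[of v] that by simp
    define F' where "F' = (\<lambda>x h v. deriv_at (\<lambda>x. F x v) x h)"
    have F': "((\<lambda>x. F x v) has_derivative (\<lambda>h. F' x h v)) (at x)" if "x \<in> S" for x v
      unfolding F'_def by (rule has_derivative_frechet[OF d[OF that]])
    have linF': "linear (F' x h)" if "x \<in> S" for x h
      unfolding F'_def
      by (rule linear_deriv_at_family[OF eventually_mono[OF ev[OF that]] d[OF that]]) simp
    have IH: "higher_differentiable_on S (\<lambda>x. inv (F x) w) k" for w
      by (rule Suc.IH) (rule hdiff_SucD[OF Suc.prems])
    show ?case
    proof (rule hdiff_SucI[OF assms(1)])
      show "((\<lambda>x. inv (F x) w) has_derivative (\<lambda>h. - inv (F x) (F' x h (inv (F x) w)))) (at x)"
        if "x \<in> S" for x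
        by (rule has_derivative_inv_linear[OF ev[OF that] F'[OF that]])
      have "higher_differentiable_on S (\<lambda>x. F' x v u) k" for u v
        using Suc.prems[of u] by (simp add: F'_def)
      then have "higher_differentiable_on S (\<lambda>x. F' x v (inv (F x) w)) k" for v
        using hdiff_linear_apply[where F = "\<lambda>x. F' x v", OF assms(1) linF' _ IH] by simp
      then have "higher_differentiable_on S (\<lambda>x. inv (F x) (F' x v (inv (F x) w))) k" for v
        using hdiff_linear_apply[where F = "\<lambda>x. inv (F x)", OF assms(1) linv IH] by simp
      then show "higher_differentiable_on S (\<lambda>x. - inv (F x) (F' x v (inv (F x) w))) k" for v
        by (rule hdiff_bounded_linear[OF assms(1)
              bounded_linear_minus[OF bounded_linear_ident]])
    qed
  qed
qed

lemma smooth_on_inv_linear: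
  fixes F :: "'a::real_normed_vector \<Rightarrow> 'b::euclidean_space \<Rightarrow> 'b"
  assumes "open S" "\<And>x. x \<in> S \<Longrightarrow> linear (F x)" "\<And>x. x \<in> S \<Longrightarrow> bij (F x)"
    and "\<And>v. smooth_on S (\<lambda>x. F x v)"
  shows "smooth_on S (\<lambda>x. inv (F x) w)"
  unfolding smooth_on_def
  by (rule allI, rule hdiff_inv_linear[OF assms(1-3)])
    (use assms(4) in \<open>simp_all add: smooth_on_def\<close>)

section \<open>Flat functions and bump functions\<close>

definition exp_glue :: "nat \<Rightarrow> real \<Rightarrow> real" where
  "exp_glue m x = (if x > 0 then inverse x ^ m * exp (- inverse x) else 0)"

lemma exp_glue_tendsto_0: "(exp_glue m \<longlongrightarrow> 0) (at 0)"
proof (rule filterlim_split_at)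
  have "eventually (\<lambda>x. exp_glue m x = 0) (at_left (0::real))"
    by (auto simp: exp_glue_def eventually_at_filter)
  then show "(exp_glue m \<longlongrightarrow> 0) (at_left 0)" by (simp add: tendsto_eventually)
  have "((\<lambda>x::real. inverse x ^ m / exp (inverse x)) \<longlongrightarrow> 0) (at_right 0)"
    by (rule filterlim_compose[OF tendsto_power_div_exp_0 filterlim_inverse_at_top_right])
  moreover have "eventually (\<lambda>x. inverse x ^ m / exp (inverse x) = exp_glue m x) (at_right (0::real))"
    by (auto simp: exp_glue_def eventually_at_filter exp_minus divide_inverse)
  ultimately show "(exp_glue m \<longlongrightarrow> 0) (at_right 0)" by (rule Lim_transform_eventually)
qed

text \<open>The family is closed under differentiation; this is why powers of
  \<open>inverse x\<close> are built into \<open>exp_glue\<close>.\<close>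

lemma exp_glue_has_derivative:
  "(exp_glue m has_real_derivative exp_glue (m + 2) x - real m * exp_glue (m + 1) x) (at x)"
proof (cases x "0 :: real" rule: linorder_cases)
  case less
  have "((\<lambda>x. 0) has_real_derivative 0) (at x)" by simp
  moreover have "eventually (\<lambda>y. 0 = exp_glue m y) (nhds x)"
    using less eventually_nhds_in_open[of "{..<0}" x] by (auto simp: exp_glue_def elim!: eventually_mono)
  ultimately have "(exp_glue m has_real_derivative 0) (at x)"
    by (subst DERIV_cong_ev[symmetric, where f = "\<lambda>x. 0"]) auto
  then show ?thesis using less by (simp add: exp_glue_def)
next
  case equal
  \<comment> \<open>The difference quotient at 0 is \<open>exp_glue (Suc m)\<close>, again a member
    of the family.\<close>
  have "((\<lambda>h. exp_glue m h / h) \<longlongrightarrow> 0) (at 0)" using exp_glue_tendsto_0[of "Suc m"]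
    by (rule Lim_transform_eventually) (auto simp: exp_glue_def eventually_at_filter divide_inverse)
  then show ?thesis using equal by (simp add: DERIV_def exp_glue_def)
next
  case greater
  have "real m * (inverse x ^ (m - Suc 0) * (inverse x * inverse x)) = real m * inverse x ^ (m + 1)"
    by (cases m) auto
  then have "((\<lambda>x. inverse x ^ m * exp (- inverse x)) has_real_derivative
      exp_glue (m + 2) x - real m * exp_glue (m + 1) x) (at x)" using greater
    by (auto intro!: derivative_eq_intros simp: exp_glue_def power2_eq_square algebra_simps)
  moreover have "eventually (\<lambda>y. inverse y ^ m * exp (- inverse y) = exp_glue m y) (nhds x)"
    using greater eventually_nhds_in_open[of "{0<..}" x] by (auto simp: exp_glue_def elim!: eventually_mono)
  ultimately show ?thesis
    by (subst DERIV_cong_ev[symmetric, where f = "\<lambda>x. inverse x ^ m * exp (- inverse x)"]) auto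
qed

lemma smooth_on_exp_glue: "smooth_on UNIV (exp_glue m)"
proof -
  have "higher_differentiable_on UNIV (exp_glue m) k" for k
  proof (induction k arbitrary: m)
    case 0
    then show ?case
      using exp_glue_has_derivative by (auto intro!: continuous_at_imp_continuous_on DERIV_isCont)
  next
    case (Suc k)
    show ?case
    proof (rule hdiff_real_SucI[OF open_UNIV exp_glue_has_derivative])
      have "higher_differentiable_on UNIV (\<lambda>x. exp_glue (m + 2) x + (- real m) * exp_glue (m + 1) x) k"
        by (intro hdiff_add
            hdiff_bounded_linear[OF _ bounded_linear_mult_right] Suc) auto
      then show "higher_differentiable_on UNIV (\<lambda>x. exp_glue (m + 2) x - real m * exp_glue (m + 1) x) k"
        by simp
    qed
  qed
  then show ?thesis by (simp add: smooth_on_def)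
qed

lemma smooth_bump:
  fixes p :: "'a::euclidean_space"
  assumes "r > 0"
  obtains \<beta> :: "'a \<Rightarrow> real" where "smooth_on UNIV \<beta>"
    "\<And>q. q \<in> ball p r \<Longrightarrow> \<beta> q = 1" "\<And>q. q \<notin> cball p (2 * r) \<Longrightarrow> \<beta> q = 0"
proof -
  define f where "f = exp_glue 0"
  have f: "smooth_on UNIV f" unfolding f_def by (rule smooth_on_exp_glue)
  have f0: "f x \<ge> 0" "f x > 0 \<longleftrightarrow> x > 0" for x
    by (auto simp: f_def exp_glue_def)
  \<comment> \<open>\<open>h\<close> is at least 1 on the ball of radius \<open>r\<close> and at
    most 0 off the ball of radius \<open>2 * r\<close>. Composed with
    \<open>f t / (f t + f (1 - t))\<close>, a smooth step from 0 to 1, it gives the bump.\<close>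
  define h where "h = (\<lambda>q. 2 - ((q - p) \<bullet> (q - p)) / r\<^sup>2)"
  have h: "smooth_on UNIV h"
    unfolding h_def divide_inverse
    by (intro smooth_on_diff smooth_on_mult smooth_on_inner) auto
  have fh: "smooth_on UNIV (\<lambda>q. f (h q))" by (rule smooth_on_compose[OF _ _ _ h f]) auto
  have "smooth_on UNIV (\<lambda>q. 1 - h q)" by (intro smooth_on_diff h) auto
  then have fh': "smooth_on UNIV (\<lambda>q. f (1 - h q))"
    using smooth_on_compose[of UNIV UNIV "\<lambda>q. 1 - h q" f] f by auto
  \<comment> \<open>Of \<open>x\<close> and \<open>1 - x\<close> at least one is positive.\<close>
  have pos: "f x + f (1 - x) > 0" for x
    using f0[of x] f0[of "1 - x"] by (cases "x > 0") (smt (verit))+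
  show ?thesis
  proof
    show "smooth_on UNIV (\<lambda>q. f (h q) * inverse (f (h q) + f (1 - h q)))"
    proof (rule smooth_on_mult[OF _ fh smooth_on_inverse[OF _ smooth_on_add[OF _ fh fh']]])
      show "f (h q) + f (1 - h q) \<noteq> 0" for q
        using pos[of "h q"] by linarith
    qed auto
  next
    fix q assume "q \<in> ball p r"
    then have "norm (q - p) ^ 2 \<le> r ^ 2"
      by (intro power_mono) (auto simp: dist_norm norm_minus_commute)
    then have "h q \<ge> 1" using assms by (simp add: h_def power2_norm_eq_inner[symmetric] field_simps)
    then have "f (1 - h q) = 0" "f (h q) > 0" using f0[of "1 - h q"] f0[of "h q"] by auto
    then show "f (h q) * inverse (f (h q) + f (1 - h q)) = 1" by simp
  next
    fix q assume "q \<notin> cball p (2 * r)"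
    then have "(2 * r) ^ 2 \<le> norm (q - p) ^ 2"
      using assms by (intro power_mono) (auto simp: dist_norm norm_minus_commute)
    then have "h q \<le> 0"
      using assms by (simp add: h_def power2_norm_eq_inner[symmetric] field_simps power_mult_distrib)
        (smt (verit) zero_le_power2)
    then have "f (h q) = 0" using f0[of "h q"] by auto
    then show "f (h q) * inverse (f (h q) + f (1 - h q)) = 0" by simp
  qed
qed

section \<open>Symmetry of second derivatives\<close>

lemma has_real_derivative_line:
  fixes f :: "'a::real_normed_vector \<Rightarrow> real"
  assumes "f differentiable at (z + s *\<^sub>R X)"
  shows "((\<lambda>s. f (z + s *\<^sub>R X)) has_real_derivative deriv_at f (z + s *\<^sub>R X) X) (at s)"
proof -
  have "((\<lambda>s. z + s *\<^sub>R X) has_derivative (\<lambda>h. h *\<^sub>R X)) (at s)"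
    by (auto intro!: derivative_eq_intros)
  then have "((\<lambda>s. f (z + s *\<^sub>R X)) has_derivative
      (\<lambda>h. deriv_at f (z + s *\<^sub>R X) (h *\<^sub>R X))) (at s)"
    by (rule has_derivative_compose[where g = f and f = "\<lambda>s. z + s *\<^sub>R X",
          OF _ has_derivative_frechet[OF assms]])
  then show ?thesis
    by (simp add: has_field_derivative_def linear_scale[OF linear_frechet_derivative[OF assms]]
        mult.commute[of _ "deriv_at f (z + s *\<^sub>R X) X"])
qed

text \<open>The second difference is symmetric in \<open>X\<close> and \<open>Y\<close>. Two
  applications of the mean value theorem make it \<open>h\<^sup>2\<close> times a value of the mixed
  derivative close to \<open>x\<close>, and the mixed derivative is continuous.\<close>

lemma second_difference_approx:
  fixes f :: "'a::real_normed_vector \<Rightarrow> real"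
  assumes S: "open S" "x \<in> S" and f: "smooth_on S f" and e: "e > 0"
  shows "\<exists>d>0. \<forall>h. 0 < h \<and> h < d \<longrightarrow>
    \<bar>(f (x + h *\<^sub>R X + h *\<^sub>R Y) - f (x + h *\<^sub>R X) - f (x + h *\<^sub>R Y) + f x) / h\<^sup>2 -
      deriv_at (\<lambda>q. deriv_at f q X) x Y\<bar> < e"
proof -
  define f1 where "f1 = (\<lambda>q. deriv_at f q X)"
  define f2 where "f2 = (\<lambda>q. deriv_at f1 q Y)"
  have f1: "smooth_on S f1"
    unfolding f1_def by (rule smooth_on_deriv_at[OF f])
  have "smooth_on S f2"
    unfolding f2_def by (rule smooth_on_deriv_at[OF f1])
  then have "isCont f2 x"
    using S smooth_on_imp_continuous_on continuous_on_eq_continuous_at by blast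
  then have "eventually (\<lambda>q. dist (f2 q) (f2 x) < e) (nhds x)"
    using e by (simp add: isCont_def tendsto_iff eventually_nhds_conv_at)
  moreover have "eventually (\<lambda>q. q \<in> S) (nhds x)" using S by (rule eventually_nhds_in_open)
  ultimately have "eventually (\<lambda>q. q \<in> S \<and> dist (f2 q) (f2 x) < e) (nhds x)" by eventually_elim auto
  then obtain r where r: "r > 0" "\<And>q. dist q x < r \<Longrightarrow> q \<in> S \<and> dist (f2 q) (f2 x) < e"
    by (auto simp: eventually_nhds_metric)
  \<comment> \<open>Keeps the parallelogram spanned by \<open>d *\<^sub>R X\<close> and
    \<open>d *\<^sub>R Y\<close> within radius \<open>r\<close>; the summand 1 excludes division by
    0.\<close>
  define d where "d = r / (norm X + norm Y + 1)"
  have n1: "norm X + norm Y + 1 > 0" by (smt (verit) norm_ge_zero)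
  have d: "d > 0" using r n1 by (simp add: d_def)
  have near: "x + s *\<^sub>R X + t *\<^sub>R Y \<in> S \<and> \<bar>f2 (x + s *\<^sub>R X + t *\<^sub>R Y) - f2 x\<bar> < e"
    if "0 \<le> s" "s < d" "0 \<le> t" "t < d" for s t
  proof -
    have "norm (s *\<^sub>R X + t *\<^sub>R Y) \<le> s * norm X + t * norm Y"
      using that norm_triangle_ineq[of "s *\<^sub>R X" "t *\<^sub>R Y"] by simp
    also have "\<dots> \<le> d * norm X + d * norm Y" using that by (intro add_mono mult_right_mono) auto
    also have "\<dots> < d * (norm X + norm Y + 1)" using d by (simp add: algebra_simps)
    also have "\<dots> = r" using n1 by (simp add: d_def)
    finally show ?thesis using r(2)[of "x + s *\<^sub>R X + t *\<^sub>R Y"] by (simp add: dist_norm add.assoc)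
  qed
  have "\<bar>(f (x + h *\<^sub>R X + h *\<^sub>R Y) - f (x + h *\<^sub>R X) - f (x + h *\<^sub>R Y) + f x) / h\<^sup>2 - f2 x\<bar> < e"
    if h: "0 < h" "h < d" for h
  proof -
    \<comment> \<open>Mean value theorem along \<open>X\<close>, for the difference of
      \<open>f\<close> on two lines at distance \<open>h *\<^sub>R Y\<close>; the one further down
      runs along \<open>Y\<close>.\<close>
    have "\<exists>s>0. s < h \<and> (f ((x + h *\<^sub>R Y) + h *\<^sub>R X) - f (x + h *\<^sub>R X)) -
        (f ((x + h *\<^sub>R Y) + 0 *\<^sub>R X) - f (x + 0 *\<^sub>R X)) =
        (h - 0) * (f1 ((x + h *\<^sub>R Y) + s *\<^sub>R X) - f1 (x + s *\<^sub>R X))"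
    proof (rule MVT2)
      fix s assume s: "0 \<le> s" "s \<le> h"
      have "x + h *\<^sub>R Y + s *\<^sub>R X \<in> S" "x + s *\<^sub>R X \<in> S"
        using near[of s h] near[of s 0] s h by (auto simp: algebra_simps)
      then show "((\<lambda>s. f (x + h *\<^sub>R Y + s *\<^sub>R X) - f (x + s *\<^sub>R X)) has_real_derivative
          f1 (x + h *\<^sub>R Y + s *\<^sub>R X) - f1 (x + s *\<^sub>R X)) (at s)"
        unfolding f1_def
        by (intro DERIV_diff has_real_derivative_line smooth_on_imp_differentiable[OF f])
    qed (use h in auto)
    then obtain s where s: "0 < s" "s < h" "f (x + h *\<^sub>R X + h *\<^sub>R Y) - f (x + h *\<^sub>R X) - f (x + h *\<^sub>R Y) + f x
        = h * (f1 (x + s *\<^sub>R X + h *\<^sub>R Y) - f1 (x + s *\<^sub>R X))" by (auto simp: algebra_simps)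
    have "\<exists>t>0. t < h \<and> f1 (x + s *\<^sub>R X + h *\<^sub>R Y) - f1 (x + s *\<^sub>R X + 0 *\<^sub>R Y) =
        (h - 0) * f2 (x + s *\<^sub>R X + t *\<^sub>R Y)"
    proof (rule MVT2)
      fix t assume "0 \<le> t" "t \<le> h"
      then have "x + s *\<^sub>R X + t *\<^sub>R Y \<in> S" using near[of s t] s h by auto
      then show "((\<lambda>t. f1 (x + s *\<^sub>R X + t *\<^sub>R Y)) has_real_derivative f2 (x + s *\<^sub>R X + t *\<^sub>R Y)) (at t)"
        unfolding f2_def by (intro has_real_derivative_line smooth_on_imp_differentiable[OF f1])
    qed (use h in auto)
    then obtain t where t: "0 < t" "t < h"
      "f1 (x + s *\<^sub>R X + h *\<^sub>R Y) - f1 (x + s *\<^sub>R X) = h * f2 (x + s *\<^sub>R X + t *\<^sub>R Y)" by auto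
    have "(f (x + h *\<^sub>R X + h *\<^sub>R Y) - f (x + h *\<^sub>R X) - f (x + h *\<^sub>R Y) + f x) / h\<^sup>2 =
        f2 (x + s *\<^sub>R X + t *\<^sub>R Y)" using h by (simp add: s t power2_eq_square)
    then show ?thesis using near[of s t] s t h by simp
  qed
  then show ?thesis using d unfolding f2_def f1_def by blast
qed

lemma deriv_at_commute_real:
  fixes f :: "'a::real_normed_vector \<Rightarrow> real"
  assumes S: "open S" "x \<in> S" and f: "smooth_on S f"
  shows "deriv_at (\<lambda>q. deriv_at f q X) x Y =
    deriv_at (\<lambda>q. deriv_at f q Y) x X" (is "?a = ?b")
proof (rule ccontr)
  assume "?a \<noteq> ?b"
  then have e: "\<bar>?a - ?b\<bar> / 2 > 0" by simp
  define \<Delta> where "\<Delta> = (\<lambda>h. (f (x + h *\<^sub>R X + h *\<^sub>R Y) - f (x + h *\<^sub>R X) - f (x + h *\<^sub>R Y) + f x) / h\<^sup>2)"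
  have sym: "\<Delta> h = (f (x + h *\<^sub>R Y + h *\<^sub>R X) - f (x + h *\<^sub>R Y) - f (x + h *\<^sub>R X) + f x) / h\<^sup>2" for h
    by (simp add: \<Delta>_def algebra_simps)
  obtain d1 where d1: "d1 > 0" "\<And>h. 0 < h \<Longrightarrow> h < d1 \<Longrightarrow> \<bar>\<Delta> h - ?a\<bar> < \<bar>?a - ?b\<bar> / 2"
    using second_difference_approx[OF S f e, of X Y] unfolding \<Delta>_def by blast
  obtain d2 where d2: "d2 > 0" "\<And>h. 0 < h \<Longrightarrow> h < d2 \<Longrightarrow> \<bar>\<Delta> h - ?b\<bar> < \<bar>?a - ?b\<bar> / 2"
    using second_difference_approx[OF S f e, of Y X] unfolding sym by blast
  have "0 < min d1 d2 / 2" "min d1 d2 / 2 < d1" "min d1 d2 / 2 < d2" using d1(1) d2(1) by auto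
  then have "\<bar>\<Delta> (min d1 d2 / 2) - ?a\<bar> < \<bar>?a - ?b\<bar> / 2" "\<bar>\<Delta> (min d1 d2 / 2) - ?b\<bar> < \<bar>?a - ?b\<bar> / 2"
    using d1(2) d2(2) by blast+
  moreover have "\<not> (\<bar>z - a\<bar> < \<bar>a - b\<bar> / 2 \<and> \<bar>z - b\<bar> < \<bar>a - b\<bar> / 2)" for z a b :: real
    using abs_triangle_ineq[of "z - b" "a - z"] by (simp add: abs_minus_commute[of a z])
  ultimately show False by blast
qed

lemma deriv_at_bounded_linear:
  assumes "bounded_linear L" "f differentiable at x"
  shows "deriv_at (\<lambda>q. L (f q)) x v = L (deriv_at f x v)"
  using frechet_derivative_at[OF bounded_linear.has_derivative[OF assms(1)
      has_derivative_frechet[OF assms(2)]]] by metis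

lemma deriv_at_cong:
  assumes "open S" "x \<in> S" "\<And>q. q \<in> S \<Longrightarrow> f q = g q" "f differentiable at x"
  shows "deriv_at f x = deriv_at g x"
  using frechet_derivative_transform_within_open[OF assms(4,1,2)] assms(3) by blast

lemma deriv_at_commute:
  fixes f :: "'a::real_normed_vector \<Rightarrow> 'b::euclidean_space"
  assumes S: "open S" "x \<in> S" and f: "smooth_on S f"
  shows "deriv_at (\<lambda>q. deriv_at f q X) x Y =
    deriv_at (\<lambda>q. deriv_at f q Y) x X"
proof (rule euclidean_eqI)
  fix b :: 'b
  have fb: "smooth_on S (\<lambda>q. f q \<bullet> b)"
    by (rule smooth_on_bounded_linear[OF S(1) bounded_linear_inner_left f])
  have "deriv_at (\<lambda>q. deriv_at (\<lambda>q. f q \<bullet> b) q X) x Y =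
      deriv_at (\<lambda>q. deriv_at f q X) x Y \<bullet> b" for X Y
  proof -
    have eq: "deriv_at (\<lambda>q. f q \<bullet> b) q X = deriv_at f q X \<bullet> b" if "q \<in> S" for q
      by (rule deriv_at_bounded_linear[OF bounded_linear_inner_left
            smooth_on_imp_differentiable[OF f that]])
    have "deriv_at (\<lambda>q. deriv_at (\<lambda>q. f q \<bullet> b) q X) x =
        deriv_at (\<lambda>q. deriv_at f q X \<bullet> b) x" by (rule deriv_at_cong[OF S])
        (use eq smooth_on_imp_differentiable[OF smooth_on_deriv_at[OF fb] S(2)] in auto)
    then show ?thesis
      by (simp add: deriv_at_bounded_linear[OF bounded_linear_inner_left
            smooth_on_imp_differentiable[OF smooth_on_deriv_at[OF f] S(2)]])
  qed
  then show "deriv_at (\<lambda>q. deriv_at f q X) x Y \<bullet> b =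
      deriv_at (\<lambda>q. deriv_at f q Y) x X \<bullet> b"
    using deriv_at_commute_real[OF S fb, of X Y] by simp
qed

section \<open>Manifolds, frames and partitions of unity\<close>

locale manifold =
  fixes M :: "'m topology" and A :: "('m, 'e::euclidean_space) chart set"
  assumes manifold: "smooth_manifold M A"
begin

abbreviation cimage :: "('m, 'e) chart \<Rightarrow> 'm set \<Rightarrow> 'e set" where
  "cimage c U \<equiv> snd c ` (fst c \<inter> U)"

lemma openin_chart: "c \<in> A \<Longrightarrow> openin M (fst c)"
  and open_chart_range: "c \<in> A \<Longrightarrow> open (snd c ` fst c)"
  and chart_homeomorphic:
    "c \<in> A \<Longrightarrow> homeomorphic_map (subtopology M (fst c)) (top_of_set (snd c ` fst c)) (snd c)"
  using manifold by (auto simp: smooth_manifold_def topological_chart_def)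

lemma chart_subset: "c \<in> A \<Longrightarrow> fst c \<subseteq> topspace M"
  by (rule openin_subset[OF openin_chart])

lemma chart_inj: "c \<in> A \<Longrightarrow> inj_on (snd c) (fst c)"
  using homeomorphic_imp_injective_map[OF chart_homeomorphic] chart_subset
  by (simp add: inf_absorb2)

lemma chart_inv_left [simp]: "c \<in> A \<Longrightarrow> x \<in> fst c \<Longrightarrow> chart_inv c (snd c x) = x"
  by (simp add: chart_inv_def chart_inj)

lemma open_chart_image:
  assumes "c \<in> A" "openin M U" shows "open (cimage c U)"
proof -
  have "openin (subtopology M (fst c)) (fst c \<inter> U)"
    using assms by (simp add: openin_subtopology_Int2)
  then have "openin (top_of_set (snd c ` fst c)) (cimage c U)"
    using homeomorphic_imp_open_map[OF chart_homeomorphic[OF assms(1)]] by (auto simp: open_map_def)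
  then show ?thesis using open_chart_range[OF assms(1)] openin_open_trans by blast
qed

lemma openin_chart_vimage:
  assumes "c \<in> A" "open T" shows "openin M (fst c \<inter> snd c -` T)"
proof -
  have "openin (top_of_set (snd c ` fst c)) (snd c ` fst c \<inter> T)"
    using assms(2) by (simp add: openin_open_Int)
  then have "openin (subtopology M (fst c)) {x \<in> topspace (subtopology M (fst c)). snd c x \<in> snd c ` fst c \<inter> T}"
    by (intro openin_continuous_map_preimage[OF homeomorphic_imp_continuous_map[OF chart_homeomorphic[OF assms(1)]]])
  moreover have "{x \<in> topspace (subtopology M (fst c)). snd c x \<in> snd c ` fst c \<inter> T} = fst c \<inter> snd c -` T"
    using chart_subset[OF assms(1)] by auto
  ultimately show ?thesis using openin_trans_full[OF _ openin_chart[OF assms(1)]] by simp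
qed

text \<open>The set is closed in all of \<open>M\<close>, not just in the chart, because it is
  compact and \<open>M\<close> is Hausdorff. Functions supported in it can then be extended by
  0.\<close>

lemma closedin_chart_vimage:
  assumes "c \<in> A" "compact K" "K \<subseteq> snd c ` fst c" shows "closedin M (fst c \<inter> snd c -` K)"
proof -
  obtain g where g: "homeomorphic_maps (subtopology M (fst c)) (top_of_set (snd c ` fst c)) (snd c) g"
    using chart_homeomorphic[OF assms(1)] by (auto simp: homeomorphic_map_maps)
  have "compactin (top_of_set (snd c ` fst c)) K"
    using assms(2,3) by (simp add: compactin_subtopology)
  then have "compactin (subtopology M (fst c)) (g ` K)"
    using g by (intro image_compactin) (auto simp: homeomorphic_maps_def)
  then have "compactin M (g ` K)" by (simp add: compactin_subtopology)
  moreover have "g ` K = fst c \<inter> snd c -` K"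
  proof -
    have g': "g (snd c x) = x" if "x \<in> fst c" for x
      using g that chart_subset[OF assms(1)] by (auto simp: homeomorphic_maps_def)
    show ?thesis
    proof (intro equalityI subsetI)
      fix y assume "y \<in> g ` K"
      then obtain p where "p \<in> K" "y = g p" by auto
      then show "y \<in> fst c \<inter> snd c -` K" using assms(3) g' by auto
    next
      fix y assume "y \<in> fst c \<inter> snd c -` K"
      then show "y \<in> g ` K" using g'[of y] by (intro image_eqI[of _ _ "snd c y"]) auto
    qed
  qed
  ultimately show ?thesis
    using manifold compactin_imp_closedin by (fastforce simp: smooth_manifold_def)
qed

lemma chart_cover: "x \<in> topspace M \<Longrightarrow> \<exists>c\<in>A. x \<in> fst c"
  using manifold by (auto simp: smooth_manifold_def)

lemma transition_apply [simp]: "c \<in> A \<Longrightarrow> x \<in> fst c \<Longrightarrow> transition c d (snd c x) = snd d x"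
  by (simp add: transition_def)

lemma open_overlap: "c \<in> A \<Longrightarrow> d \<in> A \<Longrightarrow> open (cimage c (fst d))"
  by (rule open_chart_image[OF _ openin_chart])

lemma smooth_transition: "c \<in> A \<Longrightarrow> d \<in> A \<Longrightarrow> smooth_on (cimage c (fst d)) (transition c d)"
  using manifold by (auto simp: smooth_manifold_def)

lemma transition_deriv:
  assumes "c \<in> A" "d \<in> A" "x \<in> fst c" "x \<in> fst d"
  shows "(transition c d has_derivative deriv_at (transition c d) (snd c x)) (at (snd c x))"
  by (rule has_derivative_frechet[OF smooth_on_imp_differentiable[OF smooth_transition[OF assms(1,2)]]])
    (use assms in auto)

lemma linear_transition:
  assumes "c \<in> A" "d \<in> A" "x \<in> fst c" "x \<in> fst d"
  shows "linear (deriv_at (transition c d) (snd c x))"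
  using transition_deriv[OF assms] by (rule has_derivative_linear)

lemma tangent_space_transition:
  assumes "\<xi> \<in> tangent_space A x" "c \<in> A" "d \<in> A" "x \<in> fst c" "x \<in> fst d"
  shows "\<xi> d = deriv_at (transition c d) (snd c x) (\<xi> c)"
  using assms unfolding tangent_space_def charts_at_def by blast

lemma tangent_space_outside: "\<xi> \<in> tangent_space A x \<Longrightarrow> c \<notin> charts_at A x \<Longrightarrow> \<xi> c = 0"
  unfolding tangent_space_def by blast

lemma tangent_space_eqI:
  assumes "\<xi> \<in> tangent_space A x" "\<eta> \<in> tangent_space A x" "c \<in> A" "x \<in> fst c" "\<xi> c = \<eta> c"
  shows "\<xi> = \<eta>"
proof
  fix d show "\<xi> d = \<eta> d"
  proof (cases "d \<in> charts_at A x")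
    case True
    then have d: "d \<in> A" "x \<in> fst d" by (auto simp: charts_at_def)
    show ?thesis by (simp only: assms(5) tangent_space_transition[OF assms(1,3) d(1) assms(4) d(2)]
          tangent_space_transition[OF assms(2,3) d(1) assms(4) d(2)])
  qed (simp add: tangent_space_outside[OF assms(1)] tangent_space_outside[OF assms(2)])
qed

lemma frame_bundleD:
  assumes "(x, u) \<in> frame_bundle M A"
  shows "x \<in> topspace M" "u v \<in> tangent_space A x" "bij_betw u UNIV (tangent_space A x)"
    "linear (\<lambda>v. u v c)"
  using assms by (auto simp: frame_bundle_def bij_betw_def simp del: split_paired_All)

lemma frame_bij:
  assumes "(x, u) \<in> frame_bundle M A" "c \<in> A" "x \<in> fst c"
  shows "bij (\<lambda>v. u v c)"
proof -
  have "inj (\<lambda>v. u v c)"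
  proof (rule injI)
    fix v w assume "u v c = u w c"
    then have "u v = u w"
      by (rule tangent_space_eqI[OF frame_bundleD(2)[OF assms(1)] frame_bundleD(2)[OF assms(1)] assms(2,3)])
    then show "v = w" using frame_bundleD(3)[OF assms(1)] by (auto simp: bij_betw_def inj_on_def)
  qed
  then show ?thesis
    using frame_bundleD(4)[OF assms(1)] by (simp add: bij_def linear_injective_imp_surjective)
qed

lemma frame_compose:
  assumes "(x, u) \<in> frame_bundle M A" "linear q" "bij q"
  shows "(x, u \<circ> q) \<in> frame_bundle M A"
proof -
  have "linear (\<lambda>v. u (q v) c)" for c
    using linear_compose[OF assms(2) frame_bundleD(4)[OF assms(1), of c]] by (simp add: o_def)
  moreover have "bij_betw (u \<circ> q) UNIV (tangent_space A x)"
    using assms(3) frame_bundleD(3)[OF assms(1)] by (intro bij_betw_trans) auto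
  ultimately show ?thesis using frame_bundleD(1)[OF assms(1)] by (simp add: frame_bundle_def)
qed

lemma cutoff_function:
  assumes "openin M U" "x \<in> U"
  obtains \<phi> :: "'m \<Rightarrow> real" and K N where "openin M N" "x \<in> N" "closedin M K" "K \<subseteq> U"
    "\<And>c. c \<in> A \<Longrightarrow> smooth_on (snd c ` fst c) (\<lambda>p. \<phi> (chart_inv c p))"
    "\<And>y. y \<in> N \<Longrightarrow> \<phi> y = 1" "\<And>y. y \<in> topspace M \<Longrightarrow> y \<notin> K \<Longrightarrow> \<phi> y = 0"
proof -
  obtain c where c: "c \<in> A" "x \<in> fst c" using assms openin_subset chart_cover by blast
  have "open (cimage c U)" "snd c x \<in> cimage c U"
    using open_chart_image[OF c(1) assms(1)] c(2) assms(2) by auto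
  then obtain e where e: "e > 0" "cball (snd c x) e \<subseteq> cimage c U"
    using open_contains_cball by blast
  obtain \<beta> :: "'e \<Rightarrow> real" where \<beta>: "smooth_on UNIV \<beta>"
    "\<And>q. q \<in> ball (snd c x) (e / 2) \<Longrightarrow> \<beta> q = 1" "\<And>q. q \<notin> cball (snd c x) e \<Longrightarrow> \<beta> q = 0"
    using smooth_bump[of "e / 2" "snd c x"] e(1) by auto
  define \<phi> where "\<phi> = (\<lambda>y. if y \<in> fst c then \<beta> (snd c y) else 0)"
  define K where "K = fst c \<inter> snd c -` cball (snd c x) e"
  have K: "closedin M K"
    unfolding K_def using c(1) e(2) by (intro closedin_chart_vimage) auto
  have \<phi>0: "\<phi> y = 0" if "y \<notin> K" for y
    using that \<beta>(3) by (auto simp: \<phi>_def K_def)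
  show thesis
  proof (rule that)
    show "openin M (fst c \<inter> snd c -` ball (snd c x) (e / 2))"
      using c(1) by (intro openin_chart_vimage) auto
    show "x \<in> fst c \<inter> snd c -` ball (snd c x) (e / 2)" using c(2) e(1) by auto
    show "K \<subseteq> U"
    proof
      fix y assume y: "y \<in> K"
      then obtain z where "z \<in> fst c \<inter> U" "snd c y = snd c z" using e(2) by (auto simp: K_def)
      then show "y \<in> U" using y inj_onD[OF chart_inj[OF c(1)], of y z] by (auto simp: K_def)
    qed
    show "\<phi> y = 1" if "y \<in> fst c \<inter> snd c -` ball (snd c x) (e / 2)" for y
      using that \<beta>(2) by (auto simp: \<phi>_def)
  next
    fix d assume d: "d \<in> A"
    show "smooth_on (snd d ` fst d) (\<lambda>p. \<phi> (chart_inv d p))"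
    proof (rule smooth_on_local)
      fix p assume "p \<in> snd d ` fst d"
      then obtain y where y: "y \<in> fst d" "p = snd d y" by auto
      show "\<exists>T. open T \<and> p \<in> T \<and> smooth_on T (\<lambda>p. \<phi> (chart_inv d p))"
      proof (cases "y \<in> fst c")
        case True
        have "smooth_on (cimage d (fst c)) (\<lambda>p. \<beta> (transition d c p))"
          by (rule smooth_on_compose[OF open_overlap[OF d c(1)] open_UNIV _ smooth_transition[OF d c(1)] \<beta>(1)]) simp
        then have "smooth_on (cimage d (fst c)) (\<lambda>p. \<phi> (chart_inv d p))"
          by (rule smooth_on_cong[OF open_overlap[OF d c(1)]]) (use d in \<open>auto simp: \<phi>_def\<close>)
        then show ?thesis using y True open_overlap[OF d c(1)] by blast
      next
        case False
        have op: "open (cimage d (topspace M - K))"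
          using d K by (intro open_chart_image) auto
        have "smooth_on (cimage d (topspace M - K)) (\<lambda>p. \<phi> (chart_inv d p))"
          by (rule smooth_on_cong[OF op smooth_on_const[of _ 0]]) (use d \<phi>0 in auto)
        moreover have "p \<in> cimage d (topspace M - K)"
          using y False chart_subset[OF d] by (auto simp: K_def)
        ultimately show ?thesis using op by blast
      qed
    qed
  qed (use K \<phi>0 in auto)
qed

text \<open>The products \<open>\<phi> i * (\<Prod>j<i. 1 - \<phi> j)\<close> vanish on \<open>N j\<close> for \<open>i > j\<close> because \<open>\<phi> j = 1\<close> there,
  so a countable cover suffices and no locally finite refinement is needed.\<close>

lemma partition_of_unity:
  assumes ne: "topspace M \<noteq> {}"
    and cover: "\<And>x. x \<in> topspace M \<Longrightarrow> \<exists>U. openin M U \<and> x \<in> U \<and> P U"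
  obtains U N :: "nat \<Rightarrow> 'm set" and K and \<rho> :: "nat \<Rightarrow> 'm \<Rightarrow> real" where
    "\<And>i. openin M (U i)" "\<And>i. P (U i)" "\<And>i. openin M (N i)" "(\<Union>i. N i) = topspace M"
    "\<And>i. closedin M (K i)" "\<And>i. K i \<subseteq> U i"
    "\<And>i c. c \<in> A \<Longrightarrow> smooth_on (snd c ` fst c) (\<lambda>p. \<rho> i (chart_inv c p))"
    "\<And>i y. y \<in> topspace M \<Longrightarrow> y \<notin> K i \<Longrightarrow> \<rho> i y = 0"
    "\<And>i j y. y \<in> N j \<Longrightarrow> j < i \<Longrightarrow> \<rho> i y = 0"
    "\<And>j y. y \<in> N j \<Longrightarrow> (\<Sum>i\<le>j. \<rho> i y) = 1"
proof -
  define good where "good = (\<lambda>N U K (\<phi> :: 'm \<Rightarrow> real). openin M N \<and> openin M U \<and> P U \<and> closedin M K \<and> K \<subseteq> U \<and>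
    (\<forall>c\<in>A. smooth_on (snd c ` fst c) (\<lambda>p. \<phi> (chart_inv c p))) \<and>
    (\<forall>y\<in>N. \<phi> y = 1) \<and> (\<forall>y\<in>topspace M. y \<notin> K \<longrightarrow> \<phi> y = 0))"
  define \<N> where "\<N> = {N. \<exists>U K \<phi>. good N U K \<phi>}"
  have "\<exists>N\<in>\<N>. x \<in> N" if x: "x \<in> topspace M" for x
  proof -
    obtain U where U: "openin M U" "x \<in> U" "P U" using cover[OF x] by auto
    obtain \<phi> :: "'m \<Rightarrow> real" and K N where "openin M N" "x \<in> N" "closedin M K" "K \<subseteq> U"
      "\<And>c. c \<in> A \<Longrightarrow> smooth_on (snd c ` fst c) (\<lambda>p. \<phi> (chart_inv c p))"
      "\<And>y. y \<in> N \<Longrightarrow> \<phi> y = 1" "\<And>y. y \<in> topspace M \<Longrightarrow> y \<notin> K \<Longrightarrow> \<phi> y = 0"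
      using cutoff_function[OF U(1,2)] by metis
    then have "good N U K \<phi>" using U by (auto simp: good_def)
    then show ?thesis using \<open>x \<in> N\<close> by (auto simp: \<N>_def)
  qed
  moreover have op: "\<forall>N\<in>\<N>. openin M N" by (auto simp: \<N>_def good_def)
  ultimately have "\<Union>\<N> = topspace M" using openin_subset by blast
  moreover have "Lindelof_space M"
    using manifold second_countable_imp_Lindelof_space by (auto simp: smooth_manifold_def)
  ultimately obtain \<V> where \<V>: "countable \<V>" "\<V> \<subseteq> \<N>" "\<Union>\<V> = topspace M"
    using op unfolding Lindelof_space_def by metis
  then have ne: "\<V> \<noteq> {}" using ne by (metis Union_empty)
  \<comment> \<open>The enumeration may repeat sets; the sum below telescopes all the same.\<close>
  define N where "N = from_nat_into \<V>"
  have N: "range N = \<V>"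
    unfolding N_def using ne \<V>(1) by (rule range_from_nat_into)
  then have "N i \<in> \<N>" for i
    using \<V>(2) by blast
  then have "\<forall>i. \<exists>U K \<phi>. good (N i) U K \<phi>"
    unfolding \<N>_def by blast
  then obtain U K \<phi> where good: "\<And>i. good (N i) (U i) (K i) (\<phi> i)" by metis
  define \<rho> where "\<rho> = (\<lambda>i y. \<phi> i y * (\<Prod>j<i. 1 - \<phi> j y))"
  \<comment> \<open>The product left over contains the factor \<open>1 - \<phi> j y\<close>, which
    is 0 on \<open>N j\<close>.\<close>
  have telescope: "(\<Sum>i\<le>j. \<rho> i y) = 1 - (\<Prod>i\<le>j. 1 - \<phi> i y)" for j y
  proof (induction j)
    case (Suc j)
    have "\<rho> (Suc j) y = \<phi> (Suc j) y * (\<Prod>i\<le>j. 1 - \<phi> i y)" by (simp only: \<rho>_def lessThan_Suc_atMost)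
    then show ?case using Suc by (simp add: algebra_simps)
  qed (simp add: \<rho>_def)
  show thesis
  proof (rule that[of U N K \<rho>])
    show "\<Union> (range N) = topspace M" using N \<V>(3) by simp
    show "smooth_on (snd c ` fst c) (\<lambda>p. \<rho> i (chart_inv c p))" if "c \<in> A" for i c
      unfolding \<rho>_def using good that
      by (intro smooth_on_mult smooth_on_prod smooth_on_diff open_chart_range) (auto simp: good_def)
    show "\<rho> i y = 0" if "y \<in> N j" "j < i" for i j y
    proof -
      have "1 - \<phi> j y = 0" using good[of j] that by (simp add: good_def)
      then have "(\<Prod>j<i. 1 - \<phi> j y) = 0"
        using that(2) by (meson finite_lessThan lessThan_iff prod_zero)
      then show ?thesis by (simp add: \<rho>_def)
    qed
    show "(\<Sum>i\<le>j. \<rho> i y) = 1" if "y \<in> N j" for j y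
    proof -
      have "1 - \<phi> j y = 0" using good[of j] that by (simp add: good_def)
      then have "(\<Prod>i\<le>j. 1 - \<phi> i y) = 0" by (meson atMost_iff finite_atMost order_refl prod_zero)
      then show ?thesis by (simp add: telescope)
    qed
  qed (use good in \<open>auto simp: good_def \<rho>_def\<close>)
qed

end

section \<open>The flat connection of a frame field\<close>

lemma has_derivative_linear_apply:
  fixes F :: "'a::real_normed_vector \<Rightarrow> 'b::euclidean_space \<Rightarrow> 'c::real_normed_vector"
  assumes lin: "eventually (\<lambda>q. linear (F q)) (nhds p)"
    and d: "\<And>v. (\<lambda>q. F q v) differentiable (at p)" and w: "(w has_derivative w') (at p)"
  shows "((\<lambda>q. F q (w q)) has_derivative
    (\<lambda>h. deriv_at (\<lambda>q. F q (w p)) p h + F p (w' h))) (at p)"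
proof -
  have "((\<lambda>q. \<Sum>b\<in>Basis. (w q \<bullet> b) *\<^sub>R F q b) has_derivative
      (\<lambda>h. \<Sum>b\<in>Basis. (w p \<bullet> b) *\<^sub>R deriv_at (\<lambda>q. F q b) p h + (w' h \<bullet> b) *\<^sub>R F p b)) (at p)"
    by (intro has_derivative_sum has_derivative_scaleR has_derivative_frechet[OF d]
        has_derivative_inner_left w)
  moreover have "(\<lambda>h. \<Sum>b\<in>Basis. (w p \<bullet> b) *\<^sub>R deriv_at (\<lambda>q. F q b) p h + (w' h \<bullet> b) *\<^sub>R F p b) =
      (\<lambda>h. deriv_at (\<lambda>q. F q (w p)) p h + F p (w' h))"
    using linear_sum_Basis[OF linear_deriv_at_family[OF lin d]]
      linear_sum_Basis[OF eventually_nhds_x_imp_x[OF lin]] by (simp add: sum.distrib)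
  moreover have "eventually (\<lambda>q. (\<Sum>b\<in>Basis. (w q \<bullet> b) *\<^sub>R F q b) = F q (w q)) (at p)"
    using lin by (auto simp: eventually_at_filter linear_sum_Basis elim: eventually_mono)
  moreover have "(\<Sum>b\<in>Basis. (w p \<bullet> b) *\<^sub>R F p b) = F p (w p)"
    by (rule linear_sum_Basis[OF eventually_nhds_x_imp_x[OF lin]])
  ultimately show ?thesis using has_derivative_transform_eventually by fastforce
qed

text \<open>The frame field as a function of the chart coordinate with values in the invertible
  linear maps, so that the calculus of linear families applies.\<close>

definition coords ::
  "('m \<Rightarrow> 'e \<Rightarrow> ('m, 'e) chart \<Rightarrow> 'e) \<Rightarrow> ('m, 'e) chart \<Rightarrow> 'e \<Rightarrow> 'e \<Rightarrow> 'e" where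
  "coords s c p v = s (chart_inv c p) v c"

text \<open>The Christoffel symbols of the flat connection for which the frame field \<open>s\<close> is parallel.\<close>

definition flat_conn ::
  "('m \<Rightarrow> 'e \<Rightarrow> ('m, 'e::euclidean_space) chart \<Rightarrow> 'e) \<Rightarrow> ('m, 'e) chart \<Rightarrow> 'm \<Rightarrow> 'e \<Rightarrow> 'e \<Rightarrow> 'e" where
  "flat_conn s c y X Y =
    - deriv_at (\<lambda>q. coords s c q (inv (coords s c (snd c y)) Y)) (snd c y) X"

context manifold
begin

lemma frame_fieldD:
  assumes "frame_field M A U s"
  shows "openin M U" "y \<in> U \<Longrightarrow> (y, s y) \<in> frame_bundle M A"
    "c \<in> A \<Longrightarrow> smooth_on (cimage c U) (\<lambda>p. coords s c p v)"
  using assms unfolding frame_field_def coords_def by blast+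

lemma coords_at [simp]:
  "c \<in> A \<Longrightarrow> y \<in> fst c \<Longrightarrow> coords s c (snd c y) = (\<lambda>v. s y v c)"
  by (simp add: coords_def fun_eq_iff)

lemma coords_linear:
  assumes "frame_field M A U s" "c \<in> A" "p \<in> cimage c U"
  shows "linear (coords s c p)" "bij (coords s c p)"
proof -
  obtain y where y: "y \<in> fst c" "y \<in> U" "p = snd c y" using assms(3) by auto
  show "linear (coords s c p)" "bij (coords s c p)"
    using frame_bij[OF frame_fieldD(2)[OF assms(1) y(2)] assms(2) y(1)]
      frame_bundleD(4)[OF frame_fieldD(2)[OF assms(1) y(2)]] assms(2) y by simp_all
qed

lemma eventually_chart_image:
  assumes "c \<in> A" "openin M U" "y \<in> fst c" "y \<in> U"
  shows "eventually (\<lambda>q. q \<in> (cimage c U)) (nhds (snd c y))"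
  using assms by (intro eventually_nhds_in_open open_chart_image) auto

lemma eventually_linear_coords:
  assumes "frame_field M A U s" "c \<in> A" "y \<in> fst c" "y \<in> U"
  shows "eventually (\<lambda>q. linear (coords s c q)) (nhds (snd c y))"
  using eventually_chart_image[OF assms(2) frame_fieldD(1)[OF assms(1)] assms(3,4)]
  by (rule eventually_mono) (rule coords_linear[OF assms(1,2)])

lemma coords_differentiable:
  assumes "frame_field M A U s" "c \<in> A" "y \<in> fst c" "y \<in> U"
  shows "(\<lambda>q. coords s c q v) differentiable (at (snd c y))"
  by (rule smooth_on_imp_differentiable[OF frame_fieldD(3)[OF assms(1,2)]]) (use assms in auto)

lemma coords_transition:
  assumes "frame_field M A U s" "c \<in> A" "d \<in> A" "p \<in> cimage c (fst d \<inter> U)"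
  shows "coords s d (transition c d p) v =
    deriv_at (transition c d) p (coords s c p v)"
proof -
  obtain y where y: "y \<in> fst c" "y \<in> fst d" "y \<in> U" "p = snd c y" using assms(4) by auto
  show ?thesis
    using tangent_space_transition[OF frame_bundleD(2)[OF frame_fieldD(2)[OF assms(1) y(3)]] assms(2,3) y(1,2)]
    using y assms(2,3) by simp
qed

text \<open>Differentiates \<open>s_d o transition = J s_c\<close> by the chain rule on the left and
  the product rule on the right. The second derivative of the transition map that appears is the
  inhomogeneous term in the transformation law of Christoffel symbols.\<close>

lemma coords_transition_derivative:
  assumes s: "frame_field M A U s" and c: "c \<in> A" "y \<in> fst c" and d: "d \<in> A" "y \<in> fst d" and y: "y \<in> U"
  defines "J \<equiv> \<lambda>q. deriv_at (transition c d) q"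
  shows "deriv_at (\<lambda>q. coords s d q v) (snd d y) (J (snd c y) X) =
    deriv_at (\<lambda>q. J q (s y v c)) (snd c y) X +
    J (snd c y) (deriv_at (\<lambda>q. coords s c q v) (snd c y) X)"
proof -
  have op: "openin M (fst d \<inter> U)" using openin_chart[OF d(1)] frame_fieldD(1)[OF s] by blast
  have t: "(transition c d has_derivative J (snd c y)) (at (snd c y))"
    unfolding J_def by (rule transition_deriv[OF c(1) d(1) c(2) d(2)])
  have td: "transition c d (snd c y) = snd d y" using c by simp
  have 1: "((\<lambda>q. coords s d (transition c d q) v) has_derivative
      (\<lambda>h. deriv_at (\<lambda>q. coords s d q v) (snd d y) (J (snd c y) h))) (at (snd c y))"
    by (rule has_derivative_compose[OF t, where g = "\<lambda>q. coords s d q v"])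
      (use has_derivative_frechet[OF coords_differentiable[OF s d y]] td in simp)
  have lin: "eventually (\<lambda>q. linear (J q)) (nhds (snd c y))"
    using eventually_chart_image[OF c(1) openin_chart[OF d(1)] c(2) d(2)]
    by (rule eventually_mono) (auto simp: J_def intro: linear_transition[OF c(1) d(1)])
  have diffJ: "(\<lambda>q. J q u) differentiable (at (snd c y))" for u
    unfolding J_def
    by (rule smooth_on_imp_differentiable[OF smooth_on_deriv_at[OF smooth_transition[OF c(1) d(1)]]])
      (use c d in auto)
  have 2: "((\<lambda>q. J q (coords s c q v)) has_derivative
      (\<lambda>h. deriv_at (\<lambda>q. J q (coords s c (snd c y) v)) (snd c y) h +
        J (snd c y) (deriv_at (\<lambda>q. coords s c q v) (snd c y) h))) (at (snd c y))"
    by (rule has_derivative_linear_apply[OF lin diffJ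
          has_derivative_frechet[OF coords_differentiable[OF s c y]]])
  have "eventually (\<lambda>q. coords s d (transition c d q) v = J q (coords s c q v)) (nhds (snd c y))"
    using eventually_chart_image[OF c(1) op c(2)] d(2) y
    by (auto simp: J_def coords_transition[OF s c(1) d(1)] elim!: eventually_mono)
  then have "((\<lambda>q. J q (coords s c q v)) has_derivative
      (\<lambda>h. deriv_at (\<lambda>q. coords s d q v) (snd d y) (J (snd c y) h))) (at (snd c y))"
    by (intro has_derivative_transform_eventually[OF 1])
      (auto dest: eventually_nhds_x_imp_x simp: eventually_at_filter elim: eventually_mono)
  from fun_cong[OF has_derivative_unique[OF this 2], of X] show ?thesis using c by simp
qed

lemma flat_conn_eq:
  "c \<in> A \<Longrightarrow> y \<in> fst c \<Longrightarrow> flat_conn s c y X Y =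
    - deriv_at (\<lambda>q. coords s c q (inv (\<lambda>v. s y v c) Y)) (snd c y) X"
  by (simp add: flat_conn_def)

lemma flat_conn_frame:
  assumes "frame_field M A U s" "c \<in> A" "y \<in> fst c" "y \<in> U"
  shows "flat_conn s c y X (s y v c) =
    - deriv_at (\<lambda>q. coords s c q v) (snd c y) X"
  using bij_is_inj[OF frame_bij[OF frame_fieldD(2)[OF assms(1,4)] assms(2,3)]] assms(2,3)
  by (simp add: flat_conn_eq inv_f_eq)

lemma frame_surj:
  assumes "frame_field M A U s" "c \<in> A" "y \<in> fst c" "y \<in> U"
  obtains v where "Y = s y v c"
  using bij_is_surj[OF frame_bij[OF frame_fieldD(2)[OF assms(1,4)] assms(2,3)]] by (metis surjD)

lemma flat_conn_bilinear:
  assumes "frame_field M A U s" "c \<in> A" "y \<in> fst c" "y \<in> U"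
  shows "bilinear (flat_conn s c y)"
proof -
  have "linear (flat_conn s c y X)" for X
  proof -
    have "linear (\<lambda>v. deriv_at (\<lambda>q. coords s c q v) (snd c y) X)"
      by (rule linear_deriv_at_family[OF eventually_linear_coords[OF assms]
            coords_differentiable[OF assms]])
    moreover have "linear (inv (\<lambda>v. s y v c))"
      using frame_bij[OF frame_fieldD(2)[OF assms(1,4)] assms(2,3)]
        frame_bundleD(4)[OF frame_fieldD(2)[OF assms(1,4)]]
      by (simp add: bij_is_inj inj_linear_imp_inv_linear)
    ultimately have "linear (\<lambda>Y. - deriv_at (\<lambda>q. coords s c q (inv (\<lambda>v. s y v c) Y)) (snd c y) X)"
      by (intro linear_compose_neg) (auto dest: linear_compose simp: o_def)
    moreover have "flat_conn s c y X =
        (\<lambda>Y. - deriv_at (\<lambda>q. coords s c q (inv (\<lambda>v. s y v c) Y)) (snd c y) X)"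
      using assms(2,3) by (intro ext flat_conn_eq)
    ultimately show ?thesis by simp
  qed
  moreover have "linear (\<lambda>X. flat_conn s c y X Y)" for Y
    using linear_frechet_derivative[OF coords_differentiable[OF assms]]
    unfolding flat_conn_def by (intro linear_compose_neg)
  ultimately show ?thesis by (simp add: bilinear_def)
qed

lemma smooth_on_coords_inv:
  assumes "frame_field M A U s" "c \<in> A"
  shows "smooth_on (cimage c U) (\<lambda>p. inv (coords s c p) w)"
  by (rule smooth_on_inv_linear[OF open_chart_image[OF assms(2) frame_fieldD(1)[OF assms(1)]]
        coords_linear[OF assms] frame_fieldD(3)[OF assms]])

lemma smooth_on_flat_conn:
  assumes "frame_field M A U s" "c \<in> A"
  shows "smooth_on (cimage c U) (\<lambda>p. flat_conn s c (chart_inv c p) X Y)"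
proof -
  let ?D = "cimage c U"
  have op: "open ?D" by (rule open_chart_image[OF assms(2) frame_fieldD(1)[OF assms(1)]])
  have lin: "linear (\<lambda>v. deriv_at (\<lambda>q. coords s c q v) p X)" if p: "p \<in> ?D" for p
  proof -
    obtain y where y: "y \<in> fst c" "y \<in> U" "p = snd c y" using p by auto
    show ?thesis
      unfolding y(3) by (rule linear_deriv_at_family[OF
            eventually_linear_coords[OF assms y(1,2)] coords_differentiable[OF assms y(1,2)]])
  qed
  have "smooth_on ?D (\<lambda>p. deriv_at (\<lambda>q. coords s c q (inv (coords s c p) Y)) p X)"
    by (rule smooth_on_linear_apply[where F = "\<lambda>p v. deriv_at (\<lambda>q. coords s c q v) p X",
          OF op lin smooth_on_deriv_at[OF frame_fieldD(3)[OF assms]] smooth_on_coords_inv[OF assms]])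
  then show ?thesis
    by (rule smooth_on_cong[OF op smooth_on_minus[OF op]]) (use assms(2) in \<open>auto simp: flat_conn_eq\<close>)
qed

lemma flat_conn_transition:
  assumes s: "frame_field M A U s" and c: "c \<in> A" "y \<in> fst c" and d: "d \<in> A" "y \<in> fst d" and y: "y \<in> U"
  defines "J \<equiv> \<lambda>q. deriv_at (transition c d) q"
  shows "J (snd c y) (flat_conn s c y X Y) =
    flat_conn s d y (J (snd c y) X) (J (snd c y) Y) + deriv_at (\<lambda>q. J q Y) (snd c y) X"
proof -
  \<comment> \<open>Every vector at \<open>y\<close> is a value of the frame, and there the
    Christoffel symbols are minus derivatives of \<open>s\<close>.\<close>
  obtain v where Y: "Y = s y v c" using frame_surj[OF s c y] by metis
  have JY: "J (snd c y) Y = s y v d"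
    using tangent_space_transition[OF frame_bundleD(2)[OF frame_fieldD(2)[OF s y]] c(1) d(1) c(2) d(2)]
    by (simp add: Y J_def)
  interpret J: linear "J (snd c y)"
    unfolding J_def by (rule linear_transition[OF c(1) d(1) c(2) d(2)])
  show ?thesis
    unfolding JY flat_conn_frame[OF s d y]
    using coords_transition_derivative[OF s c d y, of v X]
    by (simp add: Y flat_conn_frame[OF s c y] J.neg) (simp add: J_def)
qed

end

section \<open>Existence of a compatible connection\<close>

lemma groupQ_iff:
  fixes q :: "'n::finite modelT \<Rightarrow> 'n modelT"
  shows "q \<in> groupQ \<longleftrightarrow> linear q \<and> inj q \<and> (\<forall>x. snd (q (x, 0)) = 0)"
proof
  assume q: "q \<in> groupQ"
  have "snd (q (x, 0)) = 0" for x
  proof -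
    have "(x, 0) \<in> subspaceV" by (simp add: subspaceV_def)
    then have "q (x, 0) \<in> subspaceV" using q unfolding groupQ_def by blast
    then show ?thesis by (simp add: subspaceV_def)
  qed
  then show "linear q \<and> inj q \<and> (\<forall>x. snd (q (x, 0)) = 0)"
    using q by (auto simp: groupQ_def bij_is_inj)
next
  assume q: "linear q \<and> inj q \<and> (\<forall>x. snd (q (x, 0)) = 0)"
  have sub: "subspace (subspaceV :: 'n modelT set)" by (auto simp: subspace_def subspaceV_def)
  have "q v \<in> subspaceV" if "v \<in> subspaceV" for v
    using q that by (cases v) (auto simp: subspaceV_def)
  \<comment> \<open>An injective linear map of \<open>V\<close> into itself is onto by
    dimension.\<close>
  then have "q ` subspaceV = subspaceV" using q sub by (intro subspace_dim_equal)
      (auto simp: linear_subspace_image dim_image_eq inj_on_subset)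
  then show "q \<in> groupQ" using q by (simp add: groupQ_def bij_def linear_injective_imp_surjective)
qed

lemma groupQ_linear: "q \<in> groupQ \<Longrightarrow> linear q"
  and groupQ_bij: "q \<in> groupQ \<Longrightarrow> bij q" by (auto simp: groupQ_def)

lemma groupQ_snd: "q \<in> groupQ \<Longrightarrow> snd (q (x, 0)) = 0"
  by (simp add: groupQ_iff)

lemma groupQ_fst: "q \<in> groupQ \<Longrightarrow> q (x, 0) = (fst (q (x, 0)), 0)"
  by (simp add: prod_eq_iff groupQ_snd)

lemma groupQ_id [simp]: "id \<in> groupQ"
  by (simp add: groupQ_def linear_id)

lemma groupQ_comp:
  assumes "q \<in> groupQ" "r \<in> groupQ" shows "q \<circ> r \<in> groupQ"
proof -
  have "snd (q (r (x, 0))) = 0" for x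
    by (subst groupQ_fst[OF assms(2)]) (rule groupQ_snd[OF assms(1)])
  then show ?thesis using assms by (simp add: groupQ_iff linear_compose inj_compose)
qed

lemma groupQ_inv: "q \<in> groupQ \<Longrightarrow> inv q \<in> groupQ"
proof -
  assume q: "q \<in> groupQ"
  have "inv q ` (q ` subspaceV) = subspaceV"
    using groupQ_bij[OF q] by (simp add: image_inv_f_f bij_is_inj)
  then show ?thesis
    using q by (simp add: groupQ_def inj_linear_imp_inv_linear bij_is_inj bij_imp_bij_inv)
qed

lemma lie_algebra_linear:
  assumes H: "\<And>h. h \<in> H \<Longrightarrow> linear h" and "a \<in> lie_algebra H"
  shows "linear a"
proof -
  obtain \<gamma> where \<gamma>: "\<And>t. \<gamma> t \<in> H" "\<And>v. ((\<lambda>t. \<gamma> t v) has_vector_derivative a v) (at 0)"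
    using assms(2) unfolding lie_algebra_def by blast
  note lin = H[OF \<gamma>(1)]
  show ?thesis
  proof (rule linearI)
    fix v w and c :: real
    have "((\<lambda>t. \<gamma> t (v + w)) has_vector_derivative a v + a w) (at 0)"
      using has_vector_derivative_add[OF \<gamma>(2)[of v] \<gamma>(2)[of w]] by (simp add: linear_add[OF lin])
    then show "a (v + w) = a v + a w" by (rule vector_derivative_unique_at[OF \<gamma>(2)])
    have "((\<lambda>t. \<gamma> t (c *\<^sub>R v)) has_vector_derivative c *\<^sub>R a v) (at 0)"
      using bounded_linear.has_vector_derivative[OF bounded_linear_scaleR_right \<gamma>(2)[of v], of c]
      by (simp add: linear_scale[OF lin])
    then show "a (c *\<^sub>R v) = c *\<^sub>R a v" by (rule vector_derivative_unique_at[OF \<gamma>(2)])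
  qed
qed

lemma lie_algebra_groupQ:
  fixes a :: "'n::finite modelT \<Rightarrow> 'n modelT"
  shows "linear a \<Longrightarrow> (\<And>x. snd (a (x, 0)) = 0) \<Longrightarrow> a \<in> lie_algebra groupQ"
    and "a \<in> lie_algebra groupQ \<Longrightarrow> snd (a (x, 0)) = 0"
proof -
  assume a: "linear a" "\<And>x. snd (a (x, 0)) = 0"
  obtain B where B: "B > 0" "\<And>v. norm (a v) \<le> B * norm v" using linear_bounded_pos[OF a(1)] by auto
  \<comment> \<open>\<open>lie_algebra\<close> asks for a curve defined for all \<open>t\<close>,
    while \<open>id + t a\<close> is certain to be invertible only for small \<open>t\<close>. The
    derivative at 0 sees small \<open>t\<close> only, so the curve is set to \<open>id\<close>
    elsewhere.\<close>
  define \<gamma> where "\<gamma> = (\<lambda>t::real. if \<bar>t\<bar> * B < 1 then (\<lambda>v. v + t *\<^sub>R a v) else id)"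
  have "\<gamma> t \<in> groupQ" for t
  proof (cases "\<bar>t\<bar> * B < 1")
    case True
    have lin: "linear (\<lambda>v. v + t *\<^sub>R a v)"
      by (intro linear_compose_add linear_ident linear_compose_scale_right a(1))
    moreover have "inj (\<lambda>v. v + t *\<^sub>R a v)"
      unfolding linear_injective_0[OF lin]
    proof (intro allI impI)
      fix v assume "v + t *\<^sub>R a v = 0"
      then have "v = - (t *\<^sub>R a v)" by (simp add: eq_neg_iff_add_eq_0)
      then have "norm v = \<bar>t\<bar> * norm (a v)" by (metis norm_minus_cancel norm_scaleR real_norm_def)
      also have "\<dots> \<le> (\<bar>t\<bar> * B) * norm v"
        using mult_left_mono[OF B(2)[of v], of "\<bar>t\<bar>"] by (simp add: mult.assoc)
      finally have "(1 - \<bar>t\<bar> * B) * norm v \<le> 0" by (simp add: algebra_simps)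
      then show "v = 0" using True by (simp add: mult_le_0_iff)
    qed
    moreover have "snd ((x, 0) + t *\<^sub>R a (x, 0)) = 0" for x
      using a(2)[of x] by simp
    ultimately show ?thesis using True by (simp add: \<gamma>_def groupQ_iff)
  qed (simp add: \<gamma>_def)
  moreover have "((\<lambda>t. \<gamma> t v) has_vector_derivative a v) (at 0)" for v
  proof -
    have "((\<lambda>t. v + t *\<^sub>R a v) has_vector_derivative a v) (at 0)"
      by (auto intro!: derivative_eq_intros)
    moreover have "open {-(1/B)<..<1/B}" "0 \<in> {-(1/B)<..<1/B}" using B(1) by auto
    moreover have "v + t *\<^sub>R a v = \<gamma> t v" if "t \<in> {-(1/B)<..<1/B}" for t
      using that B(1) by (auto simp: \<gamma>_def field_simps abs_if)
    ultimately show ?thesis by (rule has_vector_derivative_transform_within_open)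
  qed
  moreover have "\<gamma> 0 = id" by (auto simp: \<gamma>_def)
  ultimately show "a \<in> lie_algebra groupQ"
    unfolding lie_algebra_def by blast
next
  assume "a \<in> lie_algebra groupQ"
  then obtain \<gamma> where \<gamma>: "\<And>t. \<gamma> t \<in> groupQ" "((\<lambda>t. \<gamma> t (x, 0)) has_vector_derivative a (x, 0)) (at 0)"
    unfolding lie_algebra_def by blast
  have "((\<lambda>t. snd (\<gamma> t (x, 0))) has_vector_derivative snd (a (x, 0))) (at 0)"
    by (rule bounded_linear.has_vector_derivative[OF bounded_linear_snd \<gamma>(2)])
  then have "((\<lambda>t::real. 0) has_vector_derivative snd (a (x, 0))) (at 0)"
    by (simp add: groupQ_snd[OF \<gamma>(1)])
  then show "snd (a (x, 0)) = 0"
    using vector_derivative_unique_at[OF _ has_vector_derivative_const] by blast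
qed

context manifold
begin

section \<open>Local sections, right action and transitivity in a reduction\<close>

lemma frame_field_subset:
  assumes "frame_field M A U s" "openin M V" "V \<subseteq> U"
  shows "frame_field M A V s" using assms unfolding frame_field_def
  by (blast intro: smooth_on_subset[OF _ image_mono[OF Int_mono[OF order_refl assms(3)]]])

lemma frame_field_compose_const:
  assumes "frame_field M A U s" "linear q" "bij q"
  shows "frame_field M A U (\<lambda>y. s y \<circ> q)"
  using assms(1) frame_compose[OF _ assms(2,3)] unfolding frame_field_def by simp

lemma reduction_subset: "is_reduction M A H P \<Longrightarrow> P \<subseteq> frame_bundle M A"
  by (simp add: is_reduction_def)

lemma reduction_frame_field:
  assumes "is_reduction M A H P" "x \<in> topspace M" "id \<in> H"
  obtains U s where "x \<in> U" "frame_field M A U s" "\<And>y. y \<in> U \<Longrightarrow> (y, s y) \<in> P"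
    "{f \<in> P. fst f \<in> U} = {(y, s y \<circ> h) | y h. y \<in> U \<and> h \<in> H}"
proof -
  obtain U s where U: "x \<in> U" "frame_field M A U s"
    "{f \<in> P. fst f \<in> U} = {(y, s y \<circ> h) | y h. y \<in> U \<and> h \<in> H}"
    using assms(1,2) unfolding is_reduction_def by meson
  have "(y, s y) \<in> P" if "y \<in> U" for y
  proof -
    have "(y, s y \<circ> id) \<in> {(y, s y \<circ> h) | y h. y \<in> U \<and> h \<in> H}" using that assms(3) by blast
    then show ?thesis
      unfolding U(3)[symmetric] by simp
  qed
  then show ?thesis using that U by blast
qed

lemma reduction_local_section:
  assumes "is_reduction M A H P" "x \<in> topspace M" "id \<in> H"
  obtains U s where "x \<in> U" "frame_field M A U s" "\<forall>y\<in>U. (y, s y) \<in> P"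
proof (rule reduction_frame_field[OF assms])
  fix U s assume "x \<in> U" "frame_field M A U s" "\<And>y. y \<in> U \<Longrightarrow> (y, s y) \<in> P"
  then show thesis by (intro that ballI)
qed

lemma reduction_right_action:
  assumes P: "is_reduction M A H P" and f: "(x, u) \<in> P" and q: "q \<in> H"
    and H: "id \<in> H" "\<And>h k. h \<in> H \<Longrightarrow> k \<in> H \<Longrightarrow> h \<circ> k \<in> H"
  shows "(x, u \<circ> q) \<in> P"
proof -
  have x: "x \<in> topspace M" using reduction_subset[OF P] f frame_bundleD(1) by blast
  obtain U s where U: "x \<in> U" "{f \<in> P. fst f \<in> U} = {(y, s y \<circ> h) | y h. y \<in> U \<and> h \<in> H}"
    by (rule reduction_frame_field[OF P x H(1)])
  have "(x, u) \<in> {(y, s y \<circ> h) | y h. y \<in> U \<and> h \<in> H}" using f U(1) unfolding U(2)[symmetric] by simp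
  then obtain h where h: "h \<in> H" "u = s x \<circ> h" by auto
  have "(x, s x \<circ> (h \<circ> q)) \<in> {(y, s y \<circ> h) | y h. y \<in> U \<and> h \<in> H}"
    using U(1) H(2)[OF h(1) q] by blast
  then show ?thesis
    unfolding U(2)[symmetric] by (simp add: h(2) o_assoc)
qed

lemma reduction_transitive:
  assumes P: "is_reduction M A H P" and f: "(x, u) \<in> P" "(x, v) \<in> P"
    and H: "id \<in> H" "\<And>h k. h \<in> H \<Longrightarrow> k \<in> H \<Longrightarrow> h \<circ> k \<in> H"
      "\<And>h. h \<in> H \<Longrightarrow> inv h \<in> H" "\<And>h. h \<in> H \<Longrightarrow> bij h"
  obtains q where "q \<in> H" "v = u \<circ> q"
proof -
  have x: "x \<in> topspace M" using reduction_subset[OF P] f frame_bundleD(1) by blast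
  obtain U s where U: "x \<in> U" "{f \<in> P. fst f \<in> U} = {(y, s y \<circ> h) | y h. y \<in> U \<and> h \<in> H}"
    by (rule reduction_frame_field[OF P x H(1)])
  have "(x, u) \<in> {(y, s y \<circ> h) | y h. y \<in> U \<and> h \<in> H}" "(x, v) \<in> {(y, s y \<circ> h) | y h. y \<in> U \<and> h \<in> H}"
    using f U(1) unfolding U(2)[symmetric] by simp_all
  then obtain h k where h: "h \<in> H" "u = s x \<circ> h" and k: "k \<in> H" "v = s x \<circ> k" by auto
  have "h \<circ> (inv h \<circ> k) = k" using H(4)[OF h(1)] by (simp add: fun_eq_iff bij_is_surj surj_f_inv_f)
  then have "v = u \<circ> (inv h \<circ> k)"
    unfolding h(2) k(2) comp_assoc by simp
  then show ?thesis using that H(2)[OF H(3)[OF h(1)] k(1)] by blast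
qed

end

section \<open>Local frames of a Q-structure\<close>

locale Q_manifold = manifold M A
  for M :: "'m topology" and A :: "('m, 'n::finite modelT) chart set" +
  fixes R :: "('m, 'n modelT) frame set"
  assumes Q_structure: "Q_structure M A R"
begin

definition adapted :: "'m set \<Rightarrow> ('m \<Rightarrow> 'n modelT \<Rightarrow> ('m, 'n modelT) chart \<Rightarrow> 'n modelT) \<Rightarrow> bool" where
  "adapted U s \<longleftrightarrow> frame_field M A U s \<and> (\<forall>y\<in>U. (y, s y) \<in> R)"

lemma R_reduction: "is_reduction M A groupQ R"
  using Q_structure by (simp add: Q_structure_def)

lemma R_right_action: "(x, u) \<in> R \<Longrightarrow> q \<in> groupQ \<Longrightarrow> (x, u \<circ> q) \<in> R"
  by (rule reduction_right_action[OF R_reduction _ _ groupQ_id groupQ_comp])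

lemma R_transitive:
  assumes "(x, u) \<in> R" "(x, v) \<in> R" obtains q where "q \<in> groupQ" "v = u \<circ> q"
  by (rule reduction_transitive[OF R_reduction assms groupQ_id groupQ_comp groupQ_inv groupQ_bij])

lemma R_frame_bundle: "(x, u) \<in> R \<Longrightarrow> (x, u) \<in> frame_bundle M A"
  using reduction_subset[OF R_reduction] by blast

lemma adapted_cover:
  assumes "x \<in> topspace M" obtains U s where "adapted U s" "x \<in> U"
proof (rule reduction_local_section[OF R_reduction assms groupQ_id])
  fix U s assume "x \<in> U" "frame_field M A U s" "\<forall>y\<in>U. (y, s y) \<in> R"
  then show thesis by (intro that) (auto simp: adapted_def)
qed

lemma adaptedD: "adapted U s \<Longrightarrow> frame_field M A U s" "adapted U s \<Longrightarrow> y \<in> U \<Longrightarrow> (y, s y) \<in> R"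
  by (auto simp: adapted_def)

text \<open>Right translation of a local section by a constant group element makes it pass through a
  given frame. Formulas for local sections thereby hold at every frame of \<open>R\<close>.\<close>

lemma adapted_through:
  assumes "(x, u) \<in> R"
  obtains U s where "adapted U s" "x \<in> U" "s x = u"
proof -
  have x: "x \<in> topspace M" by (rule frame_bundleD(1)[OF R_frame_bundle[OF assms]])
  obtain U s where U: "adapted U s" "x \<in> U" by (rule adapted_cover[OF x])
  obtain q where q: "q \<in> groupQ" "u = s x \<circ> q" by (rule R_transitive[OF adaptedD(2)[OF U] assms])
  show ?thesis
  proof (rule that)
    show "adapted U (\<lambda>y. s y \<circ> q)"
      unfolding adapted_def
      using frame_field_compose_const[OF adaptedD(1)[OF U(1)] groupQ_linear[OF q(1)] groupQ_bij[OF q(1)]]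
        R_right_action[OF adaptedD(2)[OF U(1)] q(1)] by simp
  qed (use U q in auto)
qed

text \<open>Relative to the parallel frame \<open>s\<close>, the vector \<open>t (x, 0)\<close> has
  a coefficient function \<open>w\<close> with values in \<open>V\<close>, because \<open>s\<close>
  and \<open>t\<close> differ by elements of Q. Its covariant derivative is \<open>s\<close> applied
  to the derivative of \<open>w\<close>, which stays in \<open>V\<close>.\<close>

lemma flat_conn_adapted:
  assumes s: "adapted U s" and t: "adapted V t" and c: "c \<in> A" "y \<in> fst c" and y: "y \<in> U" "y \<in> V"
  shows "\<exists>a\<in>lie_algebra groupQ. \<forall>v.
    deriv_at (\<lambda>p. coords t c p v) (snd c y) X + flat_conn s c y X (t y v c)
      = t y (a v) c"
proof -
  note ff = adaptedD(1)[OF s] adaptedD(1)[OF t]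
  define D where "D = (\<lambda>v. deriv_at (\<lambda>p. coords t c p v) (snd c y) X + flat_conn s c y X (t y v c))"
  have bt: "bij (\<lambda>v. t y v c)" and lt: "linear (\<lambda>v. t y v c)"
    using frame_bij[OF frame_fieldD(2)[OF ff(2) y(2)] c] frame_bundleD(4)[OF frame_fieldD(2)[OF ff(2) y(2)]]
    by auto
  define a where "a = (\<lambda>v. inv (\<lambda>v. t y v c) (D v))"
  have a: "t y (a v) c = D v" for v
    unfolding a_def using surj_f_inv_f[OF bij_is_surj[OF bt]] .
  have "linear D"
    unfolding D_def
  proof (rule linear_compose_add)
    show "linear (\<lambda>v. deriv_at (\<lambda>p. coords t c p v) (snd c y) X)"
      by (rule linear_deriv_at_family[OF eventually_linear_coords[OF ff(2) c y(2)]
            coords_differentiable[OF ff(2) c y(2)]])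
    show "linear (\<lambda>v. flat_conn s c y X (t y v c))"
      using linear_compose[OF lt, of "flat_conn s c y X"] flat_conn_bilinear[OF ff(1) c y(1)]
      unfolding bilinear_def o_def by blast
  qed
  then have "linear a" using linear_compose[of D "inv (\<lambda>v. t y v c)"] bt lt
    by (simp add: a_def o_def inj_linear_imp_inv_linear bij_is_inj)
  moreover have "snd (a (x, 0)) = 0" for x
  proof -
    define w where "w = (\<lambda>p. inv (coords s c p) (coords t c p (x, 0)))"
    have UV: "openin M (U \<inter> V)" using ff by (simp add: frame_fieldD openin_Int)
    have yD: "snd c y \<in> cimage c (U \<inter> V)" using c y by simp
    note ffUV = frame_field_subset[OF ff(1) UV Int_lower1] frame_field_subset[OF ff(2) UV Int_lower2]
    have "smooth_on (cimage c (U \<inter> V)) w"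
      unfolding w_def
      by (rule smooth_on_linear_apply[where F = "\<lambda>p. inv (coords s c p)",
            OF open_chart_image[OF c(1) UV] _ smooth_on_coords_inv[OF ffUV(1) c(1)] frame_fieldD(3)[OF ffUV(2) c(1)]])
        (intro inj_linear_imp_inv_linear bij_is_inj coords_linear[OF ffUV(1) c(1)])
    then have w: "(w has_derivative deriv_at w (snd c y)) (at (snd c y))"
      using c y by (intro has_derivative_frechet smooth_on_imp_differentiable[where S = "cimage c (U \<inter> V)"]) auto
    have w0: "snd (w p) = 0" and sw: "coords s c p (w p) = coords t c p (x, 0)"
      if p: "p \<in> cimage c (U \<inter> V)" for p
    proof -
      obtain z where z: "z \<in> fst c" "z \<in> U" "z \<in> V" "p = snd c z" using p by auto
      obtain q where q: "q \<in> groupQ" "t z = s z \<circ> q"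
        by (rule R_transitive[OF adaptedD(2)[OF s z(2)] adaptedD(2)[OF t z(3)]])
      have b: "bij (\<lambda>v. s z v c)" using frame_bij[OF frame_fieldD(2)[OF ff(1) z(2)] c(1) z(1)] .
      have "w p = q (x, 0)" using z q c by (simp add: w_def inv_f_eq[OF bij_is_inj[OF b]])
      then show "snd (w p) = 0" "coords s c p (w p) = coords t c p (x, 0)"
        using q z c by (simp_all add: groupQ_snd)
    qed
    have w': "snd (deriv_at w (snd c y) X) = 0"
    proof -
      have "((\<lambda>p. snd (w p)) has_derivative (\<lambda>h. snd (deriv_at w (snd c y) h))) (at (snd c y))"
        by (rule has_derivative_snd[OF w])
      then have "((\<lambda>p. 0) has_derivative (\<lambda>h. snd (deriv_at w (snd c y) h))) (at (snd c y))"
        by (rule has_derivative_transform_within_open[OF _ open_chart_image[OF c(1) UV] yD w0])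
      from fun_cong[OF has_derivative_unique[OF this has_derivative_const], of X] show ?thesis by simp
    qed
    have "((\<lambda>p. coords s c p (w p)) has_derivative
        (\<lambda>h. deriv_at (\<lambda>p. coords s c p (w (snd c y))) (snd c y) h +
          coords s c (snd c y) (deriv_at w (snd c y) h))) (at (snd c y))"
      by (rule has_derivative_linear_apply[OF eventually_linear_coords[OF ff(1) c y(1)]
            coords_differentiable[OF ff(1) c y(1)] w])
    then have "((\<lambda>p. coords t c p (x, 0)) has_derivative
        (\<lambda>h. deriv_at (\<lambda>p. coords s c p (w (snd c y))) (snd c y) h +
          coords s c (snd c y) (deriv_at w (snd c y) h))) (at (snd c y))"
      by (rule has_derivative_transform_within_open[OF _ open_chart_image[OF c(1) UV] yD sw])
    from fun_cong[OF frechet_derivative_at[OF this], of X]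
    have "deriv_at (\<lambda>p. coords t c p (x, 0)) (snd c y) X =
        deriv_at (\<lambda>p. coords s c p (w (snd c y))) (snd c y) X +
          s y (deriv_at w (snd c y) X) c" using c by simp
    moreover have "t y (x, 0) c = s y (w (snd c y)) c" using sw[of "snd c y"] c y by auto
    ultimately have Dx: "D (x, 0) = s y (deriv_at w (snd c y) X) c"
      by (simp add: D_def flat_conn_frame[OF ff(1) c y(1)])
    \<comment> \<open>The derivative was found in the frame \<open>s\<close>; passing to the frame
      \<open>t\<close> applies an element of Q, which preserves \<open>V\<close>.\<close>
    obtain q where q: "q \<in> groupQ" "s y = t y \<circ> q"
      by (rule R_transitive[OF adaptedD(2)[OF t y(2)] adaptedD(2)[OF s y(1)]])
    have "a (x, 0) = q (deriv_at w (snd c y) X)"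
      unfolding a_def Dx by (rule inv_f_eq[OF bij_is_inj[OF bt]]) (simp add: q(2))
    then show ?thesis using w' groupQ_snd[OF q(1)] by (metis prod.collapse)
  qed
  ultimately have "a \<in> lie_algebra groupQ" by (rule lie_algebra_groupQ(1))
  then show ?thesis by (intro bexI[of _ a] allI) (simp_all only: a D_def)
qed

text \<open>At each point the transformation law and the compatibility with \<open>R\<close> are
  affine conditions on the Christoffel symbols, so weighted sums of flat connections with total
  weight 1 satisfy them.\<close>

theorem connection_exists: "\<exists>\<Gamma>. connection_on M A groupQ R \<Gamma>"
proof (cases "topspace M = {}")
  case True
  then have "fst c = {}" if "c \<in> A" for c
    using chart_subset[OF that] by auto
  then have "connection_on M A groupQ R (\<lambda>_ _ _ _. 0)"
    by (auto simp: connection_on_def linear_connection_def)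
  then show ?thesis by blast
next
  case False
  have cover: "\<exists>U. openin M U \<and> x \<in> U \<and> (\<exists>s. adapted U s)" if "x \<in> topspace M" for x
  proof -
    obtain U s where "adapted U s" "x \<in> U" by (rule adapted_cover[OF \<open>x \<in> topspace M\<close>])
    then show ?thesis using frame_fieldD(1)[OF adaptedD(1)] by blast
  qed
  obtain U N :: "nat \<Rightarrow> 'm set" and K and \<rho> :: "nat \<Rightarrow> 'm \<Rightarrow> real" where
    U: "\<And>i. openin M (U i)" "\<And>i. \<exists>s. adapted (U i) s"
    and N: "\<And>i. openin M (N i)" "(\<Union>i. N i) = topspace M"
    and K: "\<And>i. closedin M (K i)" "\<And>i. K i \<subseteq> U i"
    and \<rho>: "\<And>i c. c \<in> A \<Longrightarrow> smooth_on (snd c ` fst c) (\<lambda>p. \<rho> i (chart_inv c p))"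
      "\<And>i y. y \<in> topspace M \<Longrightarrow> y \<notin> K i \<Longrightarrow> \<rho> i y = 0"
      "\<And>i j y. y \<in> N j \<Longrightarrow> j < i \<Longrightarrow> \<rho> i y = 0"
      "\<And>j y. y \<in> N j \<Longrightarrow> (\<Sum>i\<le>j. \<rho> i y) = 1"
    by (rule partition_of_unity[OF False, of "\<lambda>U. \<exists>s. adapted U s"]) (use cover in auto)
  obtain s where s: "\<And>i. adapted (U i) (s i)" using U(2) by metis
  note ff = adaptedD(1)[OF s]
  \<comment> \<open>Makes the sum finite at every point. On \<open>N j\<close> all terms beyond
    \<open>j\<close> vanish, so there it equals a sum of fixed length, which shows
    smoothness.\<close>
  define n where "n = (\<lambda>y. LEAST j. y \<in> N j)"
  define \<Gamma> where "\<Gamma> = (\<lambda>c y X Y. \<Sum>i\<le>n y. \<rho> i y *\<^sub>R flat_conn (s i) c y X Y)"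
  have \<Gamma>: "\<Gamma> c y X Y = (\<Sum>i\<le>j. \<rho> i y *\<^sub>R flat_conn (s i) c y X Y)" if "y \<in> N j" for c y X Y j
    unfolding \<Gamma>_def
  proof (rule sum.mono_neutral_left)
    show "{..n y} \<subseteq> {..j}" using that by (auto simp: n_def intro: order_trans Least_le)
    have "y \<in> N (n y)"
      unfolding n_def using that by (rule LeastI)
    then show "\<forall>i\<in>{..j} - {..n y}. \<rho> i y *\<^sub>R flat_conn (s i) c y X Y = 0" using \<rho>(3) by auto
  qed simp
  have Nex: "\<exists>j. y \<in> N j" if "c \<in> A" "y \<in> fst c" for c y
    using chart_subset[OF that(1)] that(2) N(2) by blast
  have inU: "y \<in> U i" if "c \<in> A" "y \<in> fst c" "\<rho> i y \<noteq> 0" for i c y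
    using \<rho>(2)[of y i] K(2)[of i] that chart_subset[OF that(1)] by blast
  have smooth_i: "smooth_on (snd c ` fst c) (\<lambda>p. \<rho> i (chart_inv c p) *\<^sub>R flat_conn (s i) c (chart_inv c p) X Y)"
    (is "smooth_on _ ?f") if c: "c \<in> A" for i c X Y
  proof (rule smooth_on_local)
    fix p assume "p \<in> snd c ` fst c"
    then obtain y where y: "y \<in> fst c" "p = snd c y" by auto
    show "\<exists>T. open T \<and> p \<in> T \<and> smooth_on T ?f"
    proof (cases "y \<in> U i")
      case True
      have op: "open (snd c ` (fst c \<inter> U i))" by (rule open_chart_image[OF c U(1)])
      have "smooth_on (snd c ` (fst c \<inter> U i)) ?f"
        by (rule smooth_on_scaleR[OF op smooth_on_subset[OF \<rho>(1)[OF c]] smooth_on_flat_conn[OF ff c]]) auto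
      then show ?thesis using op y True by blast
    next
      case False
      have op: "open (cimage c (topspace M - K i))"
        using K(1) by (intro open_chart_image[OF c]) auto
      have "smooth_on (cimage c (topspace M - K i)) ?f"
        by (rule smooth_on_cong[OF op smooth_on_const[of _ 0]]) (use c \<rho>(2) in auto)
      moreover have "p \<in> cimage c (topspace M - K i)"
        using y False K(2) chart_subset[OF c] by auto
      ultimately show ?thesis using op by blast
    qed
  qed
  have lc: "linear_connection A \<Gamma>"
    unfolding linear_connection_def Let_def
  proof (intro conjI ballI allI)
    fix c y assume c: "c \<in> A" "y \<in> fst c"
    obtain j where j: "y \<in> N j" using Nex[OF c] by blast
    \<comment> \<open>Off \<open>U i\<close> nothing is known of \<open>flat_conn (s i)\<close>, so
      the weight 0 is a case of its own, here and below.\<close>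
    have "bilinear (\<lambda>X Y. \<rho> i y *\<^sub>R flat_conn (s i) c y X Y)" for i
    proof (cases "\<rho> i y = 0")
      case True
      then show ?thesis by (simp add: bilinear_def linear_zero)
    next
      case False
      then show ?thesis using flat_conn_bilinear[OF ff c inU[OF c False]]
        by (simp add: bilinear_def linear_compose_scale_right)
    qed
    then show "bilinear (\<Gamma> c y)" using \<Gamma>[OF j] by (simp add: bilinear_def linear_compose_sum)
  next
    fix c X Y assume c: "c \<in> A"
    show "smooth_on (snd c ` fst c) (\<lambda>p. \<Gamma> c (chart_inv c p) X Y)"
    proof (rule smooth_on_local)
      fix p assume "p \<in> snd c ` fst c"
      then obtain y where y: "y \<in> fst c" "p = snd c y" by auto
      obtain j where j: "y \<in> N j" using Nex[OF c y(1)] by blast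
      have op: "open (snd c ` (fst c \<inter> N j))" by (rule open_chart_image[OF c N(1)])
      have "smooth_on (snd c ` (fst c \<inter> N j))
          (\<lambda>p. \<Sum>i\<le>j. \<rho> i (chart_inv c p) *\<^sub>R flat_conn (s i) c (chart_inv c p) X Y)"
        by (rule smooth_on_sum[OF op smooth_on_subset[OF smooth_i[OF c]]]) auto
      then have "smooth_on (snd c ` (fst c \<inter> N j)) (\<lambda>p. \<Gamma> c (chart_inv c p) X Y)"
        by (rule smooth_on_cong[OF op]) (use c in \<open>clarsimp simp: \<Gamma> simp del: split_paired_All\<close>)
      then show "\<exists>T. open T \<and> p \<in> T \<and> smooth_on T (\<lambda>p. \<Gamma> c (chart_inv c p) X Y)"
        using op y j by blast
    qed
  next
    fix c d y X Y assume c: "c \<in> A" and d: "d \<in> A" and y: "y \<in> fst c \<inter> fst d"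
    then have yc: "y \<in> fst c" and yd: "y \<in> fst d" by auto
    obtain j where j: "y \<in> N j" using Nex[OF c yc] by blast
    let ?J = "\<lambda>q. deriv_at (transition c d) q"
    let ?H = "deriv_at (\<lambda>q. ?J q Y) (snd c y) X"
    interpret J: linear "?J (snd c y)" by (rule linear_transition[OF c d yc yd])
    have eq: "\<rho> i y *\<^sub>R ?J (snd c y) (flat_conn (s i) c y X Y) =
        \<rho> i y *\<^sub>R flat_conn (s i) d y (?J (snd c y) X) (?J (snd c y) Y) + \<rho> i y *\<^sub>R ?H" for i
    proof (cases "\<rho> i y = 0")
      case False
      show ?thesis
        by (simp only: flat_conn_transition[OF ff c yc d yd inU[OF c yc False]] scaleR_add_right)
    qed simp
    have "?J (snd c y) (\<Gamma> c y X Y) = (\<Sum>i\<le>j. \<rho> i y *\<^sub>R ?J (snd c y) (flat_conn (s i) c y X Y))"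
      by (simp add: \<Gamma>[OF j] J.sum J.scale)
    \<comment> \<open>The inhomogeneous term is the same for all \<open>i\<close>, so weights of sum
      1 reproduce it exactly once.\<close>
    also have "\<dots> = \<Gamma> d y (?J (snd c y) X) (?J (snd c y) Y) + (\<Sum>i\<le>j. \<rho> i y) *\<^sub>R ?H"
      by (simp only: eq sum.distrib \<Gamma>[OF j] scaleR_left.sum)
    also have "(\<Sum>i\<le>j. \<rho> i y) = 1" by (rule \<rho>(4)[OF j])
    finally show "?J (snd c y) (\<Gamma> c y X Y) = \<Gamma> d y (?J (snd c y) X) (?J (snd c y) Y) + ?H" by simp
  qed
  have compat: "\<exists>a\<in>lie_algebra groupQ. \<forall>v.
      deriv_at (\<lambda>p. t (chart_inv c p) v c) (snd c y) X + \<Gamma> c y X (t y v c) = t y (a v) c"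
    if t: "frame_field M A V t" "\<forall>x\<in>V. (x, t x) \<in> R" and c: "c \<in> A" and y: "y \<in> V \<inter> fst c" for V t c y X
  proof -
    have y: "y \<in> V" "y \<in> fst c" using y by auto
    have t: "adapted V t" using t by (simp add: adapted_def)
    obtain j where j: "y \<in> N j" using Nex[OF c y(2)] by blast
    let ?D = "\<lambda>v. deriv_at (\<lambda>p. t (chart_inv c p) v c) (snd c y) X"
    have "\<exists>a\<in>lie_algebra groupQ. \<forall>v. \<rho> i y *\<^sub>R (?D v + flat_conn (s i) c y X (t y v c)) = \<rho> i y *\<^sub>R t y (a v) c" for i
    proof (cases "\<rho> i y = 0")
      case True
      have "(\<lambda>_. 0) \<in> lie_algebra groupQ" by (rule lie_algebra_groupQ(1)) (auto simp: linear_zero)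
      then show ?thesis using True by auto
    next
      case False
      then show ?thesis
        using flat_conn_adapted[OF s t c y(2) inU[OF c y(2) False] y(1), of X]
        unfolding coords_def by metis
    qed
    then obtain a where a: "\<And>i. a i \<in> lie_algebra groupQ"
      "\<And>i v. \<rho> i y *\<^sub>R (?D v + flat_conn (s i) c y X (t y v c)) = \<rho> i y *\<^sub>R t y (a i v) c"
      by metis
    interpret t: linear "\<lambda>v. t y v c"
      by (rule frame_bundleD(4)[OF frame_fieldD(2)[OF adaptedD(1)[OF t] y(1)]])
    have "?D v + \<Gamma> c y X (t y v c) = t y (\<Sum>i\<le>j. \<rho> i y *\<^sub>R a i v) c" for v
    proof -
      have "?D v + \<Gamma> c y X (t y v c) = (\<Sum>i\<le>j. \<rho> i y) *\<^sub>R ?D v + (\<Sum>i\<le>j. \<rho> i y *\<^sub>R flat_conn (s i) c y X (t y v c))"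
        by (simp add: \<Gamma>[OF j] \<rho>(4)[OF j])
      also have "\<dots> = (\<Sum>i\<le>j. \<rho> i y *\<^sub>R (?D v + flat_conn (s i) c y X (t y v c)))"
        by (simp add: scaleR_left.sum scaleR_add_right sum.distrib)
      also have "\<dots> = t y (\<Sum>i\<le>j. \<rho> i y *\<^sub>R a i v) c" by (simp only: a(2) t.sum t.scale)
      finally show ?thesis .
    qed
    moreover have "(\<lambda>v. \<Sum>i\<le>j. \<rho> i y *\<^sub>R a i v) \<in> lie_algebra groupQ" by (rule lie_algebra_groupQ(1))
        (auto intro!: linear_compose_sum linear_compose_scale_right lie_algebra_linear[OF groupQ_linear a(1)]
          simp: snd_sum lie_algebra_groupQ(2)[OF a(1)])
    ultimately show ?thesis by (intro bexI[of _ "\<lambda>v. \<Sum>i\<le>j. \<rho> i y *\<^sub>R a i v"]) simp_all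
  qed
  have "connection_on M A groupQ R \<Gamma>"
    unfolding connection_on_def
    by (intro conjI allI impI ballI lc; elim conjE; rule compat; assumption)
  then show ?thesis by blast
qed

end

section \<open>Intrinsic torsion\<close>

lemma groupQ_snd_eq:
  assumes "q \<in> groupQ" shows "snd (q (0, snd t)) = snd (q t)"
proof -
  have "q t = q ((fst t, 0) + (0, snd t))" by simp
  also have "\<dots> = q (fst t, 0) + q (0, snd t)" using groupQ_linear[OF assms] by (rule linear_add)
  finally show ?thesis by (simp add: groupQ_snd[OF assms])
qed

lemma actQ_inv:
  assumes "q \<in> groupQ"
  shows "actQ (inv q) \<theta> x z = snd (inv q (0, \<theta> (fst (q (x, 0))) (fst (q (z, 0)))))"
  by (simp add: actQ_def inv_inv_eq[OF groupQ_bij[OF assms]])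

lemma actQ_id: "actQ id \<theta> = \<theta>"
  by (simp add: actQ_def fun_eq_iff)

lemma actQ_comp:
  assumes q: "q \<in> groupQ" and r: "r \<in> groupQ"
  shows "actQ (q \<circ> r) \<theta> = actQ q (actQ r \<theta>)"
proof (intro ext)
  fix x y
  have "inv (q \<circ> r) (x, 0) = inv r (fst (inv q (x, 0)), 0)" for x
    by (simp add: o_inv_distrib[OF groupQ_bij[OF q] groupQ_bij[OF r]] groupQ_fst[OF groupQ_inv[OF q], symmetric])
  then show "actQ (q \<circ> r) \<theta> x y = actQ q (actQ r \<theta>) x y" by (simp add: actQ_def groupQ_snd_eq[OF q])
qed

lemma actQ_inv_cancel: "q \<in> groupQ \<Longrightarrow> actQ (inv q) (actQ q \<theta>) = \<theta>"
  by (simp add: actQ_comp[symmetric] groupQ_inv bij_is_inj groupQ_bij actQ_id)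

lemma groupB_iff: "q \<in> groupB \<longleftrightarrow> q \<in> groupQ \<and> actQ q \<Theta>0 = \<Theta>0"
  by (simp add: groupB_def)

lemma groupB_id [simp]: "id \<in> groupB"
  by (simp add: groupB_iff actQ_id)

lemma groupB_comp: "q \<in> groupB \<Longrightarrow> r \<in> groupB \<Longrightarrow> q \<circ> r \<in> groupB"
  by (simp add: groupB_iff groupQ_comp actQ_comp)

lemma groupB_inv: "q \<in> groupB \<Longrightarrow> inv q \<in> groupB"
  using actQ_inv_cancel[of q \<Theta>0] by (simp add: groupB_iff groupQ_inv)

text \<open>The inhomogeneous term in the law for \<Gamma> is a second derivative of the transition
  map; being symmetric, it cancels in the antisymmetrization.\<close>

lemma (in manifold) torsion_tensor_tangent:
  assumes \<Gamma>: "linear_connection A \<Gamma>" and \<xi>: "\<xi> \<in> tangent_space A x" and \<eta>: "\<eta> \<in> tangent_space A x"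
  shows "torsion_tensor A \<Gamma> x \<xi> \<eta> \<in> tangent_space A x"
proof -
  have "torsion_tensor A \<Gamma> x \<xi> \<eta> d =
      deriv_at (transition c d) (snd c x) (torsion_tensor A \<Gamma> x \<xi> \<eta> c)"
    if "c \<in> charts_at A x" "d \<in> charts_at A x" for c d
  proof -
    have c: "c \<in> A" "x \<in> fst c" and d: "d \<in> A" "x \<in> fst d" using that by (auto simp: charts_at_def)
    let ?J = "\<lambda>q. deriv_at (transition c d) q"
    interpret J: linear "?J (snd c x)"
      by (rule linear_transition[OF c(1) d(1) c(2) d(2)])
    have \<Gamma>J: "?J (snd c x) (\<Gamma> c x X Y) = \<Gamma> d x (?J (snd c x) X) (?J (snd c x) Y) +
        deriv_at (\<lambda>q. ?J q Y) (snd c x) X" for X Y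
      using \<Gamma> c d unfolding linear_connection_def Let_def by blast
    have sym: "deriv_at (\<lambda>q. ?J q Y) (snd c x) X = deriv_at (\<lambda>q. ?J q X) (snd c x) Y" for X Y
      by (rule deriv_at_commute[OF open_overlap[OF c(1) d(1)] _ smooth_transition[OF c(1) d(1)]])
        (use c d in auto)
    show ?thesis
      using that tangent_space_transition[OF \<xi> c(1) d(1) c(2) d(2)] tangent_space_transition[OF \<eta> c(1) d(1) c(2) d(2)]
      by (simp add: torsion_tensor_def J.diff \<Gamma>J sym[of "\<eta> c"])
  qed
  moreover have "torsion_tensor A \<Gamma> x \<xi> \<eta> c = 0" if "c \<notin> charts_at A x" for c
    using that by (simp add: torsion_tensor_def)
  ultimately show ?thesis
    unfolding tangent_space_def by blast
qed

text \<open>In a chart, this is minus the class modulo \<open>V\<close> of the Lie bracket of the vector fields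
  \<open>s (x, 0)\<close> and \<open>s (z, 0)\<close>.\<close>

definition bracket_torsion ::
  "('m \<Rightarrow> 'n::finite modelT \<Rightarrow> ('m, 'n modelT) chart \<Rightarrow> 'n modelT) \<Rightarrow> ('m, 'n modelT) chart \<Rightarrow> 'n modelT \<Rightarrow> 'n coker" where
  "bracket_torsion s c p x z = snd (inv (coords s c p)
    (deriv_at (\<lambda>q. coords s c q (x, 0)) p (coords s c p (z, 0)) -
     deriv_at (\<lambda>q. coords s c q (z, 0)) p (coords s c p (x, 0))))"

context Q_manifold
begin

section \<open>The torsion along an adapted frame\<close>

lemma smooth_on_bracket_torsion:
  assumes s: "adapted U s" and c: "c \<in> A"
  shows "smooth_on (cimage c U) (\<lambda>p. bracket_torsion s c p x z)"
proof -
  let ?D = "cimage c U"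
  note ff = adaptedD(1)[OF s]
  have op: "open ?D" by (rule open_chart_image[OF c frame_fieldD(1)[OF ff]])
  have D: "smooth_on ?D (\<lambda>p. deriv_at (\<lambda>q. coords s c q v) p (coords s c p w))" for v w
    by (rule smooth_on_linear_apply[where F = "\<lambda>p. deriv_at (\<lambda>q. coords s c q v) p",
          OF op linear_frechet_derivative[OF smooth_on_imp_differentiable[OF frame_fieldD(3)[OF ff c]]]
          smooth_on_deriv_at[OF frame_fieldD(3)[OF ff c]] frame_fieldD(3)[OF ff c]])
  have lin: "linear (inv (coords s c p))" if "p \<in> ?D" for p
    using coords_linear[OF ff c that] by (simp add: linear_inv)
  show ?thesis
    unfolding bracket_torsion_def
    by (rule smooth_on_bounded_linear[OF op bounded_linear_snd
          smooth_on_linear_apply[where F = "\<lambda>p. inv (coords s c p)",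
            OF op lin smooth_on_coords_inv[OF ff c] smooth_on_diff[OF op D D]]])
qed

text \<open>Compatibility trades each Christoffel term for a Lie algebra term minus a derivative of
  the frame. The Lie algebra terms \<open>a (z, 0)\<close> and \<open>b (x, 0)\<close> lie in
  \<open>V\<close> and disappear in \<open>T/V\<close>, so the right side is the same for every
  connection on \<open>R\<close>.\<close>

lemma torsion_connection:
  assumes \<Gamma>: "connection_on M A groupQ R \<Gamma>" and s: "adapted U s" and y: "y \<in> U" and c: "c \<in> A" "y \<in> fst c"
  shows "proj_coker (torsion A \<Gamma> (y, s y)) = bracket_torsion s c (snd c y)"
proof (intro ext)
  fix x z
  note ff = adaptedD(1)[OF s]
  note u = frame_fieldD(2)[OF ff y]
  have lc: "linear_connection A \<Gamma>" using \<Gamma> by (simp add: connection_on_def)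
  let ?D = "\<lambda>v. deriv_at (\<lambda>p. coords s c p v) (snd c y)"
  have conn: "\<exists>a\<in>lie_algebra groupQ. \<forall>v. ?D v X + \<Gamma> c y X (s y v c) = s y (a v) c" for X
    using \<Gamma> s y c unfolding connection_on_def adapted_def coords_def by blast
  obtain a where a: "a \<in> lie_algebra groupQ" "\<And>v. ?D v (s y (x, 0) c) + \<Gamma> c y (s y (x, 0) c) (s y v c) = s y (a v) c"
    using conn[of "s y (x, 0) c"] by blast
  obtain b where b: "b \<in> lie_algebra groupQ" "\<And>v. ?D v (s y (z, 0) c) + \<Gamma> c y (s y (z, 0) c) (s y v c) = s y (b v) c"
    using conn[of "s y (z, 0) c"] by blast
  let ?T = "torsion_tensor A \<Gamma> y (s y (x, 0)) (s y (z, 0))"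
  define w where "w = torsion A \<Gamma> (y, s y) (x, 0) (z, 0)"
  have "?T \<in> range (s y)"
    using torsion_tensor_tangent[OF lc frame_bundleD(2)[OF u] frame_bundleD(2)[OF u]] frame_bundleD(3)[OF u]
    by (auto simp: bij_betw_def)
  then have w: "s y w = ?T"
    unfolding w_def torsion_def by (simp add: f_inv_into_f)
  interpret S: linear "\<lambda>v. s y v c" by (rule frame_bundleD(4)[OF u])
  have bS: "bij (\<lambda>v. s y v c)" by (rule frame_bij[OF u c])
  interpret S': linear "inv (\<lambda>v. s y v c)" using S.linear_axioms bS by (simp add: linear_inv)
  have "s y w c = \<Gamma> c y (s y (x, 0) c) (s y (z, 0) c) - \<Gamma> c y (s y (z, 0) c) (s y (x, 0) c)"
    unfolding w using c by (simp add: torsion_tensor_def charts_at_def)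
  also have "\<dots> = (s y (a (z, 0)) c - ?D (z, 0) (s y (x, 0) c)) - (s y (b (x, 0)) c - ?D (x, 0) (s y (z, 0) c))"
    by (simp only: a(2)[symmetric] b(2)[symmetric]) simp
  also have "\<dots> = s y (a (z, 0) - b (x, 0)) c + (?D (x, 0) (s y (z, 0) c) - ?D (z, 0) (s y (x, 0) c))"
    by (simp add: S.diff)
  finally have "inv (\<lambda>v. s y v c) (s y w c) = inv (\<lambda>v. s y v c) (s y (a (z, 0) - b (x, 0)) c) +
      inv (\<lambda>v. s y v c) (?D (x, 0) (s y (z, 0) c) - ?D (z, 0) (s y (x, 0) c))"
    by (simp only: S'.add)
  then have "w = (a (z, 0) - b (x, 0)) +
      inv (\<lambda>v. s y v c) (?D (x, 0) (s y (z, 0) c) - ?D (z, 0) (s y (x, 0) c))"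
    by (simp only: inv_f_f[OF bij_is_inj[OF bS]])
  then have "snd w = snd (inv (\<lambda>v. s y v c) (?D (x, 0) (s y (z, 0) c) - ?D (z, 0) (s y (x, 0) c)))"
    by (simp add: lie_algebra_groupQ(2)[OF a(1)] lie_algebra_groupQ(2)[OF b(1)])
  then show "proj_coker (torsion A \<Gamma> (y, s y)) x z = bracket_torsion s c (snd c y) x z"
    using c by (simp add: proj_coker_def bracket_torsion_def w_def)
qed

abbreviation \<Theta>Q :: "('m, 'n modelT) frame \<Rightarrow> 'n coker" where
  "\<Theta>Q \<equiv> intrinsic_torsion M A R"

lemma intrinsic_torsion_adapted:
  assumes s: "adapted U s" and y: "y \<in> U" and c: "c \<in> A" "y \<in> fst c"
  shows "\<Theta>Q (y, s y) = bracket_torsion s c (snd c y)"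
  unfolding intrinsic_torsion_def
proof (rule the_equality)
  obtain \<Gamma> where "connection_on M A groupQ R \<Gamma>" using connection_exists by blast
  then show "\<exists>\<Gamma>. connection_on M A groupQ R \<Gamma> \<and>
      bracket_torsion s c (snd c y) = proj_coker (torsion A \<Gamma> (y, s y))"
    using torsion_connection[OF _ s y c] by metis
qed (use torsion_connection[OF _ s y c] in blast)

lemma intrinsic_torsion_equivariant:
  assumes f: "(y, u) \<in> R" and q: "q \<in> groupQ"
  shows "\<Theta>Q (y, u \<circ> q) = actQ (inv q) (\<Theta>Q (y, u))"
proof -
  obtain \<Gamma> where \<Gamma>: "connection_on M A groupQ R \<Gamma>" using connection_exists by blast
  then have lc: "linear_connection A \<Gamma>" by (simp add: connection_on_def)
  note fb = R_frame_bundle[OF f]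
  obtain c where c: "c \<in> A" "y \<in> fst c" using chart_cover[OF frame_bundleD(1)[OF fb]] by blast
  \<comment> \<open>One fixed \<Gamma> computes the intrinsic torsion at \<open>u\<close> and at
    \<open>u \<circ> q\<close>, so only the torsion of \<Gamma> has to be compared at the two
    frames.\<close>
  have proj: "\<Theta>Q (y, v) = proj_coker (torsion A \<Gamma> (y, v))" if v: "(y, v) \<in> R" for v
  proof -
    obtain U s where s: "adapted U s" "y \<in> U" "s y = v" by (rule adapted_through[OF v])
    show ?thesis
      using intrinsic_torsion_adapted[OF s(1,2) c] torsion_connection[OF \<Gamma> s(1,2) c] s(3) by simp
  qed
  have tors: "torsion A \<Gamma> (y, u \<circ> q) v w = inv q (torsion A \<Gamma> (y, u) (q v) (q w))" for v w
  proof -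
    let ?T = "torsion_tensor A \<Gamma> y (u (q v)) (u (q w))"
    have T: "?T \<in> range u"
      using torsion_tensor_tangent[OF lc frame_bundleD(2)[OF fb] frame_bundleD(2)[OF fb]] frame_bundleD(3)[OF fb]
      by (auto simp: bij_betw_def)
    have inj: "inj (u \<circ> q)"
      using frame_bundleD(3)[OF fb] groupQ_bij[OF q] by (simp add: bij_betw_def inj_compose bij_is_inj)
    have "inv (u \<circ> q) ?T = inv q (inv u ?T)" by (rule inv_f_eq[OF inj])
        (simp add: surj_f_inv_f[OF bij_is_surj[OF groupQ_bij[OF q]]] f_inv_into_f[OF T])
    then show ?thesis by (simp add: torsion_def)
  qed
  have "proj_coker (torsion A \<Gamma> (y, u \<circ> q)) = actQ (inv q) (proj_coker (torsion A \<Gamma> (y, u)))"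
    by (intro ext) (simp add: proj_coker_def tors actQ_inv[OF q] groupQ_fst[OF q, symmetric]
        groupQ_snd_eq[OF groupQ_inv[OF q]])
  then show ?thesis using proj[OF f] proj[OF R_right_action[OF f q]] by simp
qed

end

section \<open>Quaternionic linear algebra\<close>

text \<open>The endomorphism dual to the two-form \<open>b $ 1 * \<omega>1 + b $ 2 * \<omega>2 + b $ 3 * \<omega>3\<close>: multiplication by an
  imaginary quaternion.\<close>

definition im_mult :: "real ^ 3 \<Rightarrow> 'n::finite modelV \<Rightarrow> 'n modelV" where
  "im_mult b x = (\<chi> j i.
     if i = 1 then - b $ 1 * x $ j $ 2 - b $ 2 * x $ j $ 3 - b $ 3 * x $ j $ 4
     else if i = 2 then b $ 1 * x $ j $ 1 - b $ 2 * x $ j $ 4 + b $ 3 * x $ j $ 3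
     else if i = 3 then b $ 1 * x $ j $ 4 + b $ 2 * x $ j $ 1 - b $ 3 * x $ j $ 2
     else - b $ 1 * x $ j $ 3 + b $ 2 * x $ j $ 2 + b $ 3 * x $ j $ 1)"

lemma im_mult_nth [simp]:
  "im_mult b x $ j $ 1 = - b $ 1 * x $ j $ 2 - b $ 2 * x $ j $ 3 - b $ 3 * x $ j $ 4"
  "im_mult b x $ j $ 2 = b $ 1 * x $ j $ 1 - b $ 2 * x $ j $ 4 + b $ 3 * x $ j $ 3"
  "im_mult b x $ j $ 3 = b $ 1 * x $ j $ 4 + b $ 2 * x $ j $ 1 - b $ 3 * x $ j $ 2"
  "im_mult b x $ j $ 4 = - b $ 1 * x $ j $ 3 + b $ 2 * x $ j $ 2 + b $ 3 * x $ j $ 1"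
  by (simp_all add: im_mult_def)

lemma modelV_eqI:
  fixes x y :: "'n::finite modelV"
  assumes "\<And>j. x $ j $ 1 = y $ j $ 1" "\<And>j. x $ j $ 2 = y $ j $ 2"
    "\<And>j. x $ j $ 3 = y $ j $ 3" "\<And>j. x $ j $ 4 = y $ j $ 4"
  shows "x = y" using assms by (simp add: vec_eq_iff forall_4)

lemma inner_modelV:
  fixes x y :: "'n::finite modelV"
  shows "x \<bullet> y = (\<Sum>j\<in>UNIV. x $ j $ 1 * y $ j $ 1 + x $ j $ 2 * y $ j $ 2 + x $ j $ 3 * y $ j $ 3 + x $ j $ 4 * y $ j $ 4)"
  by (simp add: inner_vec_def sum_4)

lemma Theta0_nth [simp]: "\<Theta>0 x y $ 1 = \<omega>1 x y" "\<Theta>0 x y $ 2 = \<omega>2 x y" "\<Theta>0 x y $ 3 = \<omega>3 x y"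
  by (simp_all add: \<Theta>0_def axis_def)

lemma im_mult_inner: "im_mult b x \<bullet> y = b \<bullet> \<Theta>0 x y"
  unfolding inner_modelV
  by (simp add: inner_vec_def[of b] sum_3 \<omega>1_def \<omega>2_def \<omega>3_def sum_distrib_left sum.distrib[symmetric] wedge_def algebra_simps)

lemma bilinear_im_mult: "bilinear (im_mult :: _ \<Rightarrow> 'n::finite modelV \<Rightarrow> _)"
  unfolding bilinear_def
  by (intro conjI allI linearI modelV_eqI) (simp_all add: algebra_simps)

text \<open>The sign of the cross product shows that the order of factors is reversed:
  \<open>im_mult b\<close> is right multiplication by the quaternion with imaginary part
  \<open>b\<close>.\<close>

lemma im_mult_im_mult: "im_mult a (im_mult b x) = - (a \<bullet> b) *\<^sub>R x - im_mult (cross3 a b) x"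
  by (rule modelV_eqI) (simp_all add: inner_vec_def[of a] sum_3 cross3_def vector_3 algebra_simps)

lemma im_mult_skew: "x \<bullet> im_mult b y = - (im_mult b x \<bullet> y)"
  unfolding inner_modelV sum_negf[symmetric]
  by (intro sum.cong refl) (simp add: algebra_simps)

lemma im_mult_linear: "linear (im_mult b)"
  using bilinear_im_mult unfolding bilinear_def by blast

lemma im_mult_left: 
  "im_mult (a + b) x = im_mult a x + im_mult b x"
  "im_mult (c *\<^sub>R a) x = c *\<^sub>R im_mult a x"
  "im_mult (- a) x = - im_mult a x"
  "im_mult (a - b) x = im_mult a x - im_mult b x"
  "im_mult 0 x = 0"
  using bilinear_ladd[OF bilinear_im_mult] bilinear_lmul[OF bilinear_im_mult] bilinear_lneg[OF bilinear_im_mult]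
    bilinear_lsub[OF bilinear_im_mult] bilinear_lzero[OF bilinear_im_mult] by blast+

lemma im_mult_inner_im_mult:
  "im_mult a x \<bullet> im_mult b y = (a \<bullet> b) * (x \<bullet> y) + x \<bullet> im_mult (cross3 a b) y"
  using im_mult_skew[of x a "im_mult b y"] by (simp add: im_mult_im_mult inner_diff_right)

lemma im_mult_self: "x \<bullet> im_mult b x = 0"
  using im_mult_skew[of x b x] by (simp add: inner_commute)

lemma im_mult_axis:
  "im_mult (axis 1 1) (axis j (axis 1 1)) = axis j (axis 2 1)"
  "im_mult (axis 2 1) (axis j (axis 1 1)) = axis j (axis 3 1)"
  "im_mult (axis 3 1) (axis j (axis 1 1)) = axis j (axis 4 1)"
  by (rule modelV_eqI; simp add: axis_def)+

section \<open>Traces of products of imaginary quaternions\<close>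

definition lin_trace :: "('v::euclidean_space \<Rightarrow> 'v) \<Rightarrow> real" where
  "lin_trace K = (\<Sum>e\<in>Basis. K e \<bullet> e)"

lemma lin_trace_comp_commute:
  fixes X :: "'w::euclidean_space \<Rightarrow> 'v::euclidean_space" and Y :: "'v \<Rightarrow> 'w"
  assumes "linear X" "linear Y"
  shows "lin_trace (\<lambda>v. X (Y v)) = lin_trace (\<lambda>v. Y (X v))"
proof -
  have "lin_trace (\<lambda>v. X (Y v)) = (\<Sum>e\<in>Basis. \<Sum>f\<in>Basis. (Y e \<bullet> f) * (X f \<bullet> e))"
    unfolding lin_trace_def
    by (subst linear_sum_Basis[OF assms(1), symmetric]) (simp add: inner_sum_left)
  also have "\<dots> = (\<Sum>f\<in>Basis. \<Sum>e\<in>Basis. (X f \<bullet> e) * (Y e \<bullet> f))"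
    by (subst sum.swap) (simp add: mult.commute)
  also have "\<dots> = lin_trace (\<lambda>v. Y (X v))"
    unfolding lin_trace_def
    by (subst (2) linear_sum_Basis[OF assms(2), symmetric]) (simp add: inner_sum_left)
  finally show ?thesis .
qed

text \<open>Makes the unknown change of basis \<open>S\<close> drop out of every quantity computed
  as a trace.\<close>

lemma lin_trace_conjugate:
  fixes S :: "'v::euclidean_space \<Rightarrow> 'v"
  assumes "linear S" "bij S" "linear K" "\<And>x. L (S x) = S (K x)"
  shows "lin_trace L = lin_trace K"
proof -
  have li: "linear (inv S)" using assms by (simp add: linear_inv)
  have "L = (\<lambda>v. S (K (inv S v)))"
    using assms(4) surj_f_inv_f[OF bij_is_surj[OF assms(2)]] by (metis (no_types))
  then have "lin_trace L = lin_trace (\<lambda>v. K (inv S (S v)))"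
    using lin_trace_comp_commute[OF assms(1) linear_compose[OF li assms(3)]] by (simp add: o_def)
  then show ?thesis using assms(2) by (simp add: bij_is_inj)
qed

lemma lin_trace_scale: "lin_trace (\<lambda>x. c *\<^sub>R K x) = c * lin_trace K"
  by (simp add: lin_trace_def sum_distrib_left)

lemma lin_trace_im_mult:
  "lin_trace (\<lambda>x. im_mult a (im_mult b x) :: 'n::finite modelV) = - (a \<bullet> b) * DIM('n modelV)"
  by (simp add: lin_trace_def im_mult_im_mult inner_diff_left inner_commute[of "im_mult _ _"] im_mult_self
      inner_Basis del: DIM_cart)

text \<open>For imaginary quaternions the map from a to cac is \<open>c \<bullet> c\<close> times
  the reflection in the plane orthogonal to c. It shortens products of four factors to products of
  two.\<close>

lemma im_mult_sandwich:
  "im_mult c (im_mult a (im_mult c x)) = (c \<bullet> c) *\<^sub>R im_mult a x - (2 * (c \<bullet> a)) *\<^sub>R im_mult c x"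
  by (rule modelV_eqI) (simp_all add: inner_vec_def[of c] sum_3 algebra_simps)

lemma lin_trace_im_mult4:
  "lin_trace (\<lambda>x. im_mult c (im_mult a (im_mult c (im_mult b x))) :: 'n::finite modelV) =
    (2 * (c \<bullet> a) * (c \<bullet> b) - (c \<bullet> c) * (a \<bullet> b)) * DIM('n modelV)"
proof -
  have "lin_trace (\<lambda>x. im_mult c (im_mult a (im_mult c (im_mult b x))) :: 'n::finite modelV) =
      (c \<bullet> c) * lin_trace (\<lambda>x. im_mult a (im_mult b x) :: 'n modelV) -
      (2 * (c \<bullet> a)) * lin_trace (\<lambda>x. im_mult c (im_mult b x) :: 'n modelV)"
    by (simp add: im_mult_sandwich lin_trace_def inner_diff_left sum_subtractf sum_distrib_left)
  then show ?thesis
    unfolding lin_trace_im_mult by (simp add: algebra_simps)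
qed

text \<open>By the double cross product identity c x (a x b) = 0. A further cross product with c,
  expanded by the same identity, exhibits a x b as a multiple of c.\<close>

lemma cross3_orthogonal_triple:
  fixes a b c :: "real ^ 3"
  assumes "a \<bullet> c = 0" "b \<bullet> c = 0" "c \<bullet> c = k" "k \<noteq> 0"
  shows "cross3 a b = ((c \<bullet> cross3 a b) / k) *\<^sub>R c"
proof -
  have lagrange: "cross3 x (cross3 y z) = (x \<bullet> z) *\<^sub>R y - (x \<bullet> y) *\<^sub>R z" for x y z :: "real ^ 3"
    by (simp add: cross3_simps) (auto simp: algebra_simps forall_3)
  have "0 = cross3 c (cross3 c (cross3 a b))"
    using assms by (simp add: lagrange[of c a b] inner_commute)
  also have "\<dots> = (c \<bullet> cross3 a b) *\<^sub>R c - k *\<^sub>R cross3 a b"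
    using assms by (simp add: lagrange[of c c])
  finally have "inverse k *\<^sub>R (k *\<^sub>R cross3 a b) = inverse k *\<^sub>R ((c \<bullet> cross3 a b) *\<^sub>R c)" by simp
  then show ?thesis
    using assms(4) by (simp add: divide_inverse mult.commute del: scaleR_cancel_left)
qed

section \<open>Orthonormal systems that depend smoothly on a parameter\<close>

lemma smooth_on_bilinear:
  fixes g :: "'e::euclidean_space \<Rightarrow> 'v::euclidean_space \<Rightarrow> 'w::euclidean_space \<Rightarrow> 'b::real_normed_vector"
  assumes "open S" "\<And>p. p \<in> S \<Longrightarrow> bilinear (g p)" "\<And>x y. smooth_on S (\<lambda>p. g p x y)"
    and "smooth_on S u" "smooth_on S w"
  shows "smooth_on S (\<lambda>p. g p (u p) (w p))"
proof (rule smooth_on_linear_apply[where F = "\<lambda>p. g p (u p)", OF assms(1) _ _ assms(5)])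
  show "linear (g p (u p))" if "p \<in> S" for p
    using assms(2)[OF that] by (simp add: bilinear_def)
  show "smooth_on S (\<lambda>p. g p (u p) y)" for y
    by (rule smooth_on_linear_apply[where F = "\<lambda>p x. g p x y", OF assms(1) _ assms(3,4)])
      (use assms(2) in \<open>simp add: bilinear_def\<close>)
qed

text \<open>With the single operator \<open>J k0 = id\<close> this is the usual Gram--Schmidt process; for the four operators
  \<open>1, J1, J2, J3\<close> of a quaternionic structure it yields a quaternionic orthonormal basis.\<close>

lemma smooth_gram_schmidt:
  fixes g :: "'e::euclidean_space \<Rightarrow> 'v::euclidean_space \<Rightarrow> 'v \<Rightarrow> real"
    and J :: "'k \<Rightarrow> 'e \<Rightarrow> 'v \<Rightarrow> 'v" and e :: "'i \<Rightarrow> 'v"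
  assumes S: "open S" "p0 \<in> S" and F: "finite F" and I: "finite I" "k0 \<in> I"
    and bil: "\<And>p. p \<in> S \<Longrightarrow> bilinear (g p)" and sym: "\<And>p x y. p \<in> S \<Longrightarrow> g p x y = g p y x"
    and pos: "\<And>p x. p \<in> S \<Longrightarrow> x \<noteq> 0 \<Longrightarrow> g p x x > 0" and g: "\<And>x y. smooth_on S (\<lambda>p. g p x y)"
    and linJ: "\<And>k p. k \<in> I \<Longrightarrow> p \<in> S \<Longrightarrow> linear (J k p)" and J: "\<And>k x. k \<in> I \<Longrightarrow> smooth_on S (\<lambda>p. J k p x)"
    and J0: "\<And>p x. p \<in> S \<Longrightarrow> J k0 p x = x"
    and orthJ: "\<And>p k l x. p \<in> S \<Longrightarrow> k \<in> I \<Longrightarrow> l \<in> I \<Longrightarrow>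
      g p (J k p x) (J l p x) = (if k = l then g p x x else 0)"
    and perpJ: "\<And>p x y k l. p \<in> S \<Longrightarrow> (\<And>k. k \<in> I \<Longrightarrow> g p x (J k p y) = 0) \<Longrightarrow> k \<in> I \<Longrightarrow> l \<in> I \<Longrightarrow>
      g p (J k p x) (J l p y) = 0"
    and e: "\<And>i j k l. i \<in> F \<Longrightarrow> j \<in> F \<Longrightarrow> k \<in> I \<Longrightarrow> l \<in> I \<Longrightarrow>
      g p0 (J k p0 (e i)) (J l p0 (e j)) = (if i = j \<and> k = l then 1 else 0)"
  shows "\<exists>T f. open T \<and> p0 \<in> T \<and> T \<subseteq> S \<and> (\<forall>i\<in>F. f i p0 = e i \<and> smooth_on T (f i)) \<and>
    (\<forall>p\<in>T. \<forall>i\<in>F. \<forall>j\<in>F. \<forall>k\<in>I. \<forall>l\<in>I.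
      g p (J k p (f i p)) (J l p (f j p)) = (if i = j \<and> k = l then 1 else 0))" using F e
proof (induction F rule: finite_induct)
  case empty
  then show ?case using S by auto
next
  case (insert m F)
  have eF: "g p0 (J k p0 (e i)) (J l p0 (e j)) = (if i = j \<and> k = l then 1 else 0)"
    if "i \<in> F" "j \<in> F" "k \<in> I" "l \<in> I" for i j k l
    using insert.prems that by simp
  obtain T f where T: "open T" "p0 \<in> T" "T \<subseteq> S"
    and f0: "\<And>i. i \<in> F \<Longrightarrow> f i p0 = e i" and f: "\<And>i. i \<in> F \<Longrightarrow> smooth_on T (f i)"
    and on: "\<And>p i j k l. p \<in> T \<Longrightarrow> i \<in> F \<Longrightarrow> j \<in> F \<Longrightarrow> k \<in> I \<Longrightarrow> l \<in> I \<Longrightarrow>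
      g p (J k p (f i p)) (J l p (f j p)) = (if i = j \<and> k = l then 1 else 0)"
    using insert.IH[OF eF] by (clarsimp; metis)
  have bilT: "bilinear (g p)" if "p \<in> T" for p using bil that T by blast
  have gT: "smooth_on T (\<lambda>p. g p x y)" for x y using g T(3) by (rule smooth_on_subset)
  have Jf: "smooth_on T (\<lambda>p. J k p (f i p))" if "k \<in> I" "i \<in> F" for k i
    by (rule smooth_on_linear_apply[where F = "J k", OF T(1) _ smooth_on_subset[OF J T(3)] f])
      (use linJ T that in auto)
  define v where "v = (\<lambda>p. e m - (\<Sum>i\<in>F. \<Sum>k\<in>I. g p (e m) (J k p (f i p)) *\<^sub>R J k p (f i p)))"
  have v: "smooth_on T v"
    unfolding v_def
    by (intro smooth_on_diff[OF T(1)] smooth_on_const smooth_on_sum[OF T(1)] smooth_on_scaleR[OF T(1)] Jf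
        smooth_on_bilinear[where g = g, OF T(1) bilT gT smooth_on_const])
  have perp: "g p (v p) (J l p (f j p)) = 0" if p: "p \<in> T" and j: "j \<in> F" and l: "l \<in> I" for p j l
  proof -
    note b = bilT[OF p]
    have "g p (v p) (J l p (f j p)) = g p (e m) (J l p (f j p)) -
        (\<Sum>i\<in>F. \<Sum>k\<in>I. g p (e m) (J k p (f i p)) * g p (J k p (f i p)) (J l p (f j p)))"
      unfolding v_def bilinear_lsub[OF b] bilinear_def
      using b[unfolded bilinear_def]
      by (simp add: linear_sum[of "\<lambda>x. g p x _"] linear_scale[of "\<lambda>x. g p x _"])
    also have "(\<Sum>i\<in>F. \<Sum>k\<in>I. g p (e m) (J k p (f i p)) * g p (J k p (f i p)) (J l p (f j p))) =
        (\<Sum>i\<in>F. \<Sum>k\<in>I. if k = l \<and> i = j then g p (e m) (J k p (f i p)) else 0)"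
      by (intro sum.cong refl) (simp add: on[OF p _ j _ l])
    also have "\<dots> = (\<Sum>i\<in>F. if i = j then g p (e m) (J l p (f i p)) else 0)"
      using I l by (intro sum.cong refl) (auto simp: sum.delta)
    also have "\<dots> = g p (e m) (J l p (f j p))" using insert.hyps j by (simp add: sum.delta)
    finally show ?thesis by simp
  qed
  \<comment> \<open>The given system is already orthonormal at \<open>p0\<close>, so nothing is
    subtracted there. Hence the process keeps the prescribed values, and \<open>v\<close> is nonzero
    near \<open>p0\<close>.\<close>
  have v0: "v p0 = e m"
  proof -
    have "g p0 (e m) (J k p0 (f i p0)) = 0" if "i \<in> F" "k \<in> I" for i k
      using insert.prems[of m i k0 k] that insert.hyps I J0[OF S(2)] f0 by auto
    then show ?thesis by (simp add: v_def)
  qed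
  have em: "g p0 (e m) (e m) = 1" using insert.prems[of m m k0 k0] I J0[OF S(2)] by simp
  have em0: "e m \<noteq> 0" using em bilinear_lzero[OF bil[OF S(2)]] by auto
  define T' where "T' = {p \<in> T. v p \<in> - {0}}"
  have "open T'"
    using continuous_open_preimage[OF smooth_on_imp_continuous_on[OF v] T(1), of "- {0}"]
    unfolding T'_def Int_def vimage_def by (simp add: open_Compl)
  have T': "p0 \<in> T'" "T' \<subseteq> T" using T v0 em0 by (auto simp: T'_def)
  define r where "r = (\<lambda>p. inverse (sqrt (g p (v p) (v p))))"
  have gv: "g p (v p) (v p) > 0" if "p \<in> T'" for p
    using that pos T by (auto simp: T'_def)
  have r2: "r p * r p * g p (v p) (v p) = 1" if "p \<in> T'" for p
    using gv[OF that] unfolding r_def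
    by (metis inverse_mult_distrib less_imp_le less_irrefl real_sqrt_mult_self abs_of_pos left_inverse)
  have smr: "smooth_on T' r"
    unfolding r_def
    by (intro smooth_on_inverse smooth_on_sqrt \<open>open T'\<close> smooth_on_subset[OF _ T'(2)]
        smooth_on_bilinear[where g = g, OF T(1) bilT gT v v])
      (use gv in \<open>auto simp: less_imp_neq[symmetric] dest: gv\<close>)
  define f' where "f' = (\<lambda>i. if i = m then (\<lambda>p. r p *\<^sub>R v p) else f i)"
  have f'm: "f' m p = r p *\<^sub>R v p" for p by (simp add: f'_def)
  have f'F: "f' i = f i" if "i \<in> F" for i using that insert.hyps by (auto simp: f'_def)
  \<comment> \<open>By \<open>orthJ\<close> the vectors \<open>J k p (v p)\<close> are mutually
    orthogonal and of equal length, so normalizing \<open>v\<close> normalizes them all.\<close>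
  have mm: "g p (J k p (f' m p)) (J l p (f' m p)) = (if k = l then 1 else 0)"
    if p: "p \<in> T'" and k: "k \<in> I" "l \<in> I" for p k l
  proof -
    have pS: "p \<in> S" using p T' T by auto
    have "g p (J k p (f' m p)) (J l p (f' m p)) = r p * r p * (if k = l then g p (v p) (v p) else 0)"
      unfolding f'm linear_scale[OF linJ[OF k(1) pS]] linear_scale[OF linJ[OF k(2) pS]]
        bilinear_lmul[OF bil[OF pS]] bilinear_rmul[OF bil[OF pS]] orthJ[OF pS k] by simp
    then show ?thesis using r2[OF p] by simp
  qed
  \<comment> \<open>The projection made only \<open>v\<close> itself orthogonal to the old vectors;
    \<open>perpJ\<close> carries this over to its images under \<open>J k\<close>.\<close>
  have mF: "g p (J k p (f' m p)) (J l p (f i p)) = 0"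
    if p: "p \<in> T'" and k: "k \<in> I" "l \<in> I" and i: "i \<in> F" for p k l i
  proof -
    have pS: "p \<in> S" and pT: "p \<in> T" using p T' T by auto
    show ?thesis
      unfolding f'm linear_scale[OF linJ[OF k(1) pS]] bilinear_lmul[OF bil[OF pS]]
      using perpJ[OF pS perp[OF pT i] k] by simp
  qed
  have "g p (J k p (f' i p)) (J l p (f' j p)) = (if i = j \<and> k = l then 1 else 0)"
    if p: "p \<in> T'" and ij: "i \<in> insert m F" "j \<in> insert m F" and k: "k \<in> I" "l \<in> I" for p i j k l
  proof -
    have pS: "p \<in> S" and pT: "p \<in> T" using p T' T by auto
    consider "i = m" "j = m" | "i = m" "j \<in> F" | "i \<in> F" "j = m" | "i \<in> F" "j \<in> F" using ij by auto
    then show ?thesis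
    proof cases
      case 1 then show ?thesis using mm[OF p k] by simp
    next
      case 2 then show ?thesis using mF[OF p k] insert.hyps f'F by auto
    next
      case 3 then show ?thesis using mF[OF p k(2,1)] insert.hyps f'F sym[OF pS] by auto
    next
      case 4 then show ?thesis using on[OF pT _ _ k] f'F by simp
    qed
  qed
  moreover have "f' i p0 = e i \<and> smooth_on T' (f' i)" if "i \<in> insert m F" for i
  proof (cases "i = m")
    case True
    have "f' m p0 = e m" by (simp add: f'm v0 r_def em)
    moreover have "smooth_on T' (f' m)"
      unfolding f'_def using smooth_on_scaleR[OF \<open>open T'\<close> smr smooth_on_subset[OF v T'(2)]] by simp
    ultimately show ?thesis using True by simp
  next
    case False
    then show ?thesis using that f0 f f'F smooth_on_subset[OF _ T'(2)] by auto
  qed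
  ultimately show ?case using \<open>open T'\<close> T' T by (intro exI[of _ T'] exI[of _ f']) auto
qed

section \<open>Smooth lifts to the structure group\<close>

text \<open>The form \<open>a \<bullet> \<theta>\<close> as an endomorphism. The Euclidean inner
  product used for this is auxiliary: it cancels in \<open>form_ratio\<close> and in
  \<open>quat_metric\<close>.\<close>

definition form_op :: "'n::finite coker \<Rightarrow> modelW \<Rightarrow> 'n modelV \<Rightarrow> 'n modelV" where
  "form_op \<theta> a x = (\<Sum>e\<in>Basis. (a \<bullet> \<theta> x e) *\<^sub>R e)"

lemma form_op_inner:
  assumes "bilinear \<theta>" shows "form_op \<theta> a x \<bullet> y = a \<bullet> \<theta> x y"
proof -
  have lin: "linear (\<lambda>y. a \<bullet> \<theta> x y)" using assms linear_compose[of "\<theta> x" "\<lambda>w. a \<bullet> w"]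
    by (simp add: bilinear_def o_def bounded_linear.linear bounded_linear_inner_right)
  show ?thesis
    using linear_sum_Basis[OF lin, of y] by (simp add: form_op_def inner_sum_left inner_commute[of y] mult.commute)
qed

lemma form_op_linear:
  assumes "bilinear \<theta>" shows "linear (form_op \<theta> a)"
proof (rule linearI)
  show "form_op \<theta> a (x + y) = form_op \<theta> a x + form_op \<theta> a y" for x y
    by (simp add: form_op_def bilinear_ladd[OF assms] inner_add_right scaleR_add_left sum.distrib)
  show "form_op \<theta> a (c *\<^sub>R x) = c *\<^sub>R form_op \<theta> a x" for c x
    by (simp add: form_op_def bilinear_lmul[OF assms] scaleR_right.sum)
qed

lemma bilinear_Theta0: "bilinear (\<Theta>0 :: 'n::finite coker)"
proof -
  have i: "\<Theta>0 x y \<bullet> b = im_mult b x \<bullet> y" for x y :: "'n modelV" and b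
    using im_mult_inner[of b x y] by (simp only: inner_commute[of "\<Theta>0 x y" b])
  have "a = b" if "\<And>c. a \<bullet> c = b \<bullet> c" for a b :: modelW using that vector_eq_rdot by blast
  then show ?thesis
    unfolding bilinear_def
    by (intro conjI allI linearI; simp add: i inner_add_left inner_add_right
        linear_add[OF im_mult_linear] linear_scale[OF im_mult_linear])
qed

text \<open>A triple of forms in the orbit of \<open>\<Theta>0\<close>: \<open>S\<close> is the change of basis in \<open>V\<close>, and \<open>D\<close> is the
  transpose of the change of basis in \<open>T/V\<close>.\<close>

definition orbit_form ::
  "'n::finite coker \<Rightarrow> ('n modelV \<Rightarrow> 'n modelV) \<Rightarrow> (modelW \<Rightarrow> modelW) \<Rightarrow> bool" where
  "orbit_form \<theta> S D \<longleftrightarrow> bilinear \<theta> \<and> linear S \<and> bij S \<and> linear D \<and> inj D \<and>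
    (\<forall>a x y. a \<bullet> \<theta> (S x) (S y) = D a \<bullet> \<Theta>0 x y)"

lemma orbit_form_Theta0: "orbit_form (\<Theta>0 :: 'n::finite coker) (\<lambda>x. x) (\<lambda>a. a)"
  by (simp add: orbit_form_def bilinear_Theta0 linear_ident bij_id[unfolded id_def])

text \<open>\<open>q\<close> acts through its restriction \<open>S\<close> to \<open>V\<close> and
  the map \<open>E\<close> that it induces on \<open>T/V\<close>; moving \<open>E\<close> to the
  covector side gives \<open>D = adjoint E\<close>.\<close>

lemma orbit_form_exists:
  assumes q: "q \<in> groupQ" and \<theta>: "\<theta> = actQ q \<Theta>0"
  shows "\<exists>S D. orbit_form \<theta> S D"
proof -
  define S where "S = (\<lambda>x. fst (q (x, 0)))"
  define E where "E = (\<lambda>w. snd (q (0, w)))"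
  interpret q: linear q by (rule groupQ_linear[OF q])
  have S: "linear S" using q.add[of "(_, 0)" "(_, 0)"] q.scale[of _ "(_, 0)"]
    by (intro linearI) (simp_all add: S_def)
  have E: "linear E" using q.add[of "(0, _)" "(0, _)"] q.scale[of _ "(0, _)"]
    by (intro linearI) (simp_all add: E_def)
  have qS: "q (x, 0) = (S x, 0)" for x
    by (simp add: S_def groupQ_fst[OF q, symmetric])
  have "inj S"
  proof (rule injI)
    fix x y assume "S x = S y"
    then have "q (x, 0) = q (y, 0)" by (simp add: qS)
    then show "x = y" using groupQ_bij[OF q] by (auto simp: bij_def dest: injD)
  qed
  then have bS: "bij S" using S by (simp add: bij_def linear_injective_imp_surjective)
  \<comment> \<open>If \<open>q\<close> sends \<open>(0, w)\<close> into \<open>V\<close>, then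
    \<open>(0, w)\<close> lies in \<open>V\<close>, because the inverse of \<open>q\<close>
    preserves \<open>V\<close> too.\<close>
  have "inj E"
    unfolding linear_injective_0[OF E]
  proof (intro allI impI)
    fix w assume "E w = 0"
    then have e: "q (0, w) = (fst (q (0, w)), 0)" by (simp add: E_def prod_eq_iff)
    have "(0, w) = inv q (q (0, w))"
      by (rule inv_f_f[OF bij_is_inj[OF groupQ_bij[OF q]], symmetric])
    also have "\<dots> = inv q (fst (q (0, w)), 0)" by (rule arg_cong[OF e])
    finally show "w = 0" using groupQ_snd[OF groupQ_inv[OF q]] by (metis snd_conv)
  qed
  then have sE: "surj E" using E by (simp add: linear_injective_imp_surjective)
  have \<theta>S: "\<theta> (S x) (S y) = E (\<Theta>0 x y)" for x y
    unfolding \<theta> actQ_def qS[symmetric] inv_f_f[OF bij_is_inj[OF groupQ_bij[OF q]]]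
    by (simp add: E_def)
  have iS: "linear (inv S)" using S bS by (simp add: linear_inv)
  have \<theta>': "\<theta> = (\<lambda>x y. E (\<Theta>0 (inv S x) (inv S y)))"
    using \<theta>S surj_f_inv_f[OF bij_is_surj[OF bS]] by (metis (no_types))
  have "bilinear \<theta>"
    unfolding \<theta>' bilinear_def
    by (intro conjI allI linearI)
      (simp_all add: linear_add[OF iS] linear_scale[OF iS] linear_add[OF E] linear_scale[OF E]
        bilinear_ladd[OF bilinear_Theta0] bilinear_radd[OF bilinear_Theta0]
        bilinear_lmul[OF bilinear_Theta0] bilinear_rmul[OF bilinear_Theta0])
  moreover have "a \<bullet> \<theta> (S x) (S y) = adjoint E a \<bullet> \<Theta>0 x y" for a x y
    by (simp add: \<theta>S adjoint_clauses(2)[OF E])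
  moreover have "inj (adjoint E)"
    unfolding linear_injective_0[OF adjoint_linear[OF E]]
  proof (intro allI impI)
    fix a assume "adjoint E a = 0"
    then have "a \<bullet> E w = 0" for w
      by (metis adjoint_clauses(2)[OF E] inner_zero_left)
    then show "a = 0" using sE by (metis inner_eq_zero_iff surjD)
  qed
  ultimately have "orbit_form \<theta> S (adjoint E)"
    by (simp add: orbit_form_def S bS adjoint_linear[OF E])
  then show ?thesis by blast
qed

definition form_ratio :: "'n::finite coker \<Rightarrow> modelW \<Rightarrow> modelW \<Rightarrow> 'n modelV \<Rightarrow> 'n modelV" where
  "form_ratio \<theta> a b x = inv (form_op \<theta> a) (form_op \<theta> b x)"

text \<open>A bilinear form transforms with \<open>adjoint (inv S)\<close> on the left, not with
  \<open>S\<close>; hence single operators have no invariant trace and ratios are taken.\<close>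

lemma orbit_form_op:
  assumes "orbit_form \<theta> S D"
  shows "form_op \<theta> a (S x) = adjoint (inv S) (im_mult (D a) x)"
proof -
  have S: "linear S" "bij S" and b: "bilinear \<theta>" using assms by (auto simp: orbit_form_def)
  have iS: "linear (inv S)" using S by (simp add: linear_inv)
  have "form_op \<theta> a (S x) \<bullet> S y = adjoint (inv S) (im_mult (D a) x) \<bullet> S y" for y
    using assms S(2)
    by (simp add: form_op_inner[OF b] adjoint_clauses[OF iS] im_mult_inner orbit_form_def bij_is_inj)
  then show ?thesis using S(2) by (metis bij_is_surj surjD vector_eq_rdot)
qed

text \<open>A nonzero imaginary quaternion is invertible, its square being a negative
  number.\<close>

lemma orbit_form_op_bij:
  assumes "orbit_form \<theta> S D" "a \<noteq> 0"
  shows "bij (form_op \<theta> a)"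
proof -
  have S: "linear S" "bij S" and b: "bilinear \<theta>" and D: "linear D" "inj D"
    using assms by (auto simp: orbit_form_def)
  have Da: "D a \<noteq> 0" using D assms(2) linear_injective_0[OF D(1)] by blast
  have "inj (form_op \<theta> a)"
    unfolding linear_injective_0[OF form_op_linear[OF b]]
  proof (intro allI impI)
    fix z assume z: "form_op \<theta> a z = 0"
    obtain x where x: "z = S x" using S(2) by (metis bij_is_surj surjD)
    have "im_mult (D a) x \<bullet> y = 0" for y
      using assms z b form_op_inner[OF b, of a "S x" "S y"] by (simp add: x im_mult_inner orbit_form_def)
    then have "im_mult (D a) x = 0" by (metis inner_eq_zero_iff)
    then have "im_mult (D a) (im_mult (D a) x) = 0" by (simp add: linear_0[OF im_mult_linear])
    then have "x = 0" using Da by (simp add: im_mult_im_mult im_mult_left)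
    then show "z = 0" by (simp add: x linear_0[OF S(1)])
  qed
  then show ?thesis
    using form_op_linear[OF b] by (simp add: bij_def linear_injective_imp_surjective)
qed

text \<open>The common left factor \<open>adjoint (inv S)\<close> of the two operators cancels,
  which leaves a conjugate by \<open>S\<close>; the scalar comes from inverting
  \<open>im_mult (D a)\<close>.\<close>

lemma orbit_form_ratio:
  assumes "orbit_form \<theta> S D" "a \<noteq> 0"
  shows "form_ratio \<theta> a b (S x) = S ((- 1 / (D a \<bullet> D a)) *\<^sub>R im_mult (D a) (im_mult (D b) x))"
  unfolding form_ratio_def
proof (rule inv_f_eq[OF bij_is_inj[OF orbit_form_op_bij[OF assms]]])
  have D: "linear D" "inj D" using assms by (auto simp: orbit_form_def)
  have Da: "D a \<noteq> 0" using D assms(2) linear_injective_0[OF D(1)] by blast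
  show "form_op \<theta> a (S ((- 1 / (D a \<bullet> D a)) *\<^sub>R im_mult (D a) (im_mult (D b) x))) = form_op \<theta> b (S x)"
    unfolding orbit_form_op[OF assms(1)]
    using Da by (simp add: linear_scale[OF im_mult_linear] im_mult_im_mult[of "D a" "D a"] im_mult_left
        linear_neg[OF im_mult_linear])
qed

lemma form_ratio_linear:
  assumes "bilinear \<theta>" "bij (form_op \<theta> a)"
  shows "linear (form_ratio \<theta> a b)"
proof -
  have "linear (inv (form_op \<theta> a))"
    using form_op_linear[OF assms(1)] assms(2) by (simp add: linear_inv)
  then show ?thesis
    using linear_compose[OF form_op_linear[OF assms(1)]] by (simp add: form_ratio_def[abs_def] o_def)
qed

text \<open>For \<open>\<theta>\<close> in the orbit of \<open>\<Theta>0\<close> this recovers, up to a factor, the Euclidean metric on the dual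
  of \<open>T/V\<close> by a formula that is smooth in \<open>\<theta>\<close>.\<close>

definition orbit_metric :: "'n::finite coker \<Rightarrow> modelW \<Rightarrow> modelW \<Rightarrow> real" where
  "orbit_metric \<theta> a b =
    2 * (lin_trace (form_ratio \<theta> (axis 1 1) a) / DIM('n modelV)) * (lin_trace (form_ratio \<theta> (axis 1 1) b) / DIM('n modelV)) -
    lin_trace (\<lambda>x. form_ratio \<theta> (axis 1 1) a (form_ratio \<theta> (axis 1 1) b x)) / DIM('n modelV)"

lemma orbit_metric_eq:
  fixes \<theta> :: "'n::finite coker"
  assumes "orbit_form \<theta> S D"
  shows "orbit_metric \<theta> a b = (D a \<bullet> D b) / (D (axis 1 1) \<bullet> D (axis 1 1))"
proof -
  have S: "linear S" "bij S" and D: "linear D" "inj D" using assms by (auto simp: orbit_form_def)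
  let ?N = "real DIM('n modelV)"
  define c where "c = D (axis 1 1)"
  define k where "k = c \<bullet> c"
  have ax: "axis 1 1 \<noteq> (0 :: modelW)" by simp
  have "c \<noteq> 0"
    unfolding c_def using D ax linear_injective_0[OF D(1)] by blast
  then have k: "k > 0" by (simp add: k_def)
  have r: "form_ratio \<theta> (axis 1 1) a (S x) = S ((- 1 / k) *\<^sub>R im_mult c (im_mult (D a) x))" for a x
    unfolding c_def k_def by (rule orbit_form_ratio[OF assms ax])
  have lin: "linear (\<lambda>x. e *\<^sub>R im_mult c (im_mult (D a) x))" for e a
    by (intro linear_compose_scale_right linear_compose[OF im_mult_linear im_mult_linear, unfolded o_def])
  have t1: "lin_trace (form_ratio \<theta> (axis 1 1) a) = ((c \<bullet> D a) / k) * ?N" for a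
  proof -
    have "lin_trace (form_ratio \<theta> (axis 1 1) a) = lin_trace (\<lambda>x. (- 1 / k) *\<^sub>R im_mult c (im_mult (D a) x) :: 'n modelV)"
      by (rule lin_trace_conjugate[OF S]) (rule lin, rule r)
    also have "\<dots> = (- 1 / k) * (- (c \<bullet> D a) * ?N)"
      unfolding lin_trace_scale lin_trace_im_mult ..
    finally show ?thesis by (simp del: DIM_cart)
  qed
  have r2: "form_ratio \<theta> (axis 1 1) a (form_ratio \<theta> (axis 1 1) b (S x)) =
      S ((1 / k\<^sup>2) *\<^sub>R im_mult c (im_mult (D a) (im_mult c (im_mult (D b) x))))" for x
    unfolding r by (simp add: linear_scale[OF im_mult_linear] linear_neg[OF im_mult_linear] power2_eq_square)
  have lin2: "linear (\<lambda>x. (1 / k\<^sup>2) *\<^sub>R im_mult c (im_mult (D a) (im_mult c (im_mult (D b) x))))"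
    by (intro linear_compose_scale_right
        linear_compose[OF linear_compose[OF linear_compose[OF im_mult_linear im_mult_linear] im_mult_linear] im_mult_linear, unfolded o_def])
  have t2: "lin_trace (\<lambda>x. form_ratio \<theta> (axis 1 1) a (form_ratio \<theta> (axis 1 1) b x)) =
      ((2 * (c \<bullet> D a) * (c \<bullet> D b) - k * (D a \<bullet> D b)) / k\<^sup>2) * ?N"
  proof -
    have "lin_trace (\<lambda>x. form_ratio \<theta> (axis 1 1) a (form_ratio \<theta> (axis 1 1) b x)) =
        lin_trace (\<lambda>x. (1 / k\<^sup>2) *\<^sub>R im_mult c (im_mult (D a) (im_mult c (im_mult (D b) x))) :: 'n modelV)"
      by (rule lin_trace_conjugate[OF S]) (rule lin2, rule r2)
    also have "\<dots> = (1 / k\<^sup>2) * ((2 * (c \<bullet> D a) * (c \<bullet> D b) - k * (D a \<bullet> D b)) * ?N)"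
      unfolding lin_trace_scale lin_trace_im_mult4 k_def ..
    finally show ?thesis by (simp del: DIM_cart)
  qed
  have N: "?N > 0" using DIM_positive[where 'a = "'n modelV"] by linarith
  \<comment> \<open>The product of the two single traces, taken twice, removes the term
    \<open>2 * (c \<bullet> D a) * (c \<bullet> D b)\<close> from the trace of the product; only the
    inner product of \<open>D a\<close> and \<open>D b\<close> remains.\<close>
  have "orbit_metric \<theta> a b = 2 * ((c \<bullet> D a) / k) * ((c \<bullet> D b) / k) - (2 * (c \<bullet> D a) * (c \<bullet> D b) - k * (D a \<bullet> D b)) / k\<^sup>2"
    unfolding orbit_metric_def t1 t2 using N by (simp del: DIM_cart)
  also have "\<dots> = (D a \<bullet> D b) / k" using k by (simp add: field_simps power2_eq_square)
  finally show ?thesis by (simp add: k_def c_def)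
qed

lemma orbit_metric_inner_product:
  assumes "orbit_form \<theta> S D"
  shows "bilinear (orbit_metric \<theta>)" "orbit_metric \<theta> a b = orbit_metric \<theta> b a"
    "a \<noteq> 0 \<Longrightarrow> orbit_metric \<theta> a a > 0"
proof -
  have D: "linear D" "inj D" using assms by (auto simp: orbit_form_def)
  have nz: "D a \<noteq> 0" if "a \<noteq> 0" for a
    using D that linear_injective_0[OF D(1)] by blast
  show "bilinear (orbit_metric \<theta>)"
    unfolding bilinear_def
    by (intro conjI allI linearI)
      (simp_all add: orbit_metric_eq[OF assms] linear_add[OF D(1)] linear_scale[OF D(1)]
        inner_add_left inner_add_right add_divide_distrib)
  show "orbit_metric \<theta> a b = orbit_metric \<theta> b a"
    by (simp add: orbit_metric_eq[OF assms] inner_commute)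
  show "orbit_metric \<theta> a a > 0" if "a \<noteq> 0"
    using nz[OF that] nz[of "axis 1 1"] by (simp add: orbit_metric_eq[OF assms])
qed

lemma smooth_on_form_op:
  assumes "open S" "\<And>x y. smooth_on S (\<lambda>p. \<theta> p x y)" "smooth_on S a"
  shows "smooth_on S (\<lambda>p. form_op (\<theta> p) (a p) x)"
  unfolding form_op_def
  by (intro smooth_on_sum[OF assms(1)] smooth_on_scaleR[OF assms(1)] smooth_on_inner[OF assms(1,3)] assms(2) smooth_on_const)

lemma smooth_on_form_ratio:
  fixes \<theta> :: "'e::euclidean_space \<Rightarrow> 'n::finite coker"
  assumes S: "open S" and \<theta>: "\<And>x y. smooth_on S (\<lambda>p. \<theta> p x y)" "\<And>p. p \<in> S \<Longrightarrow> bilinear (\<theta> p)"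
    and a: "smooth_on S a" "\<And>p. p \<in> S \<Longrightarrow> bij (form_op (\<theta> p) (a p))" and b: "smooth_on S b"
  shows "smooth_on S (\<lambda>p. form_ratio (\<theta> p) (a p) (b p) x)"
  unfolding form_ratio_def
proof (rule smooth_on_linear_apply[where F = "\<lambda>p. inv (form_op (\<theta> p) (a p))", OF S])
  show "linear (inv (form_op (\<theta> p) (a p)))" if "p \<in> S" for p
    using form_op_linear[OF \<theta>(2)] a(2) that by (simp add: linear_inv)
  show "smooth_on S (\<lambda>p. inv (form_op (\<theta> p) (a p)) v)" for v
    by (rule smooth_on_inv_linear[OF S form_op_linear[OF \<theta>(2)] a(2) smooth_on_form_op[OF S \<theta>(1) a(1)]])
qed (rule smooth_on_form_op[OF S \<theta>(1) b])

lemma smooth_on_orbit_metric: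
  fixes \<theta> :: "'e::euclidean_space \<Rightarrow> 'n::finite coker"
  assumes S: "open S" and \<theta>: "\<And>x y. smooth_on S (\<lambda>p. \<theta> p x y)" "\<And>p. p \<in> S \<Longrightarrow> bilinear (\<theta> p)"
    and bij: "\<And>p. p \<in> S \<Longrightarrow> bij (form_op (\<theta> p) (axis 1 1))"
  shows "smooth_on S (\<lambda>p. orbit_metric (\<theta> p) a b)"
proof -
  have r: "smooth_on S (\<lambda>p. form_ratio (\<theta> p) (axis 1 1) a x)" for a x
    by (rule smooth_on_form_ratio[OF S \<theta> smooth_on_const bij smooth_on_const])
  have rr: "smooth_on S (\<lambda>p. form_ratio (\<theta> p) (axis 1 1) a (form_ratio (\<theta> p) (axis 1 1) b x))" for x
    by (rule smooth_on_linear_apply[where F = "\<lambda>p. form_ratio (\<theta> p) (axis 1 1) a",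
          OF S form_ratio_linear[OF \<theta>(2) bij] r r])
  have tr: "smooth_on S (\<lambda>p. lin_trace (K p) / c)" if "\<And>x. smooth_on S (\<lambda>p. K p x)" for K :: "'e \<Rightarrow> 'n modelV \<Rightarrow> 'n modelV" and c
    unfolding lin_trace_def divide_inverse
    by (intro smooth_on_mult[OF S] smooth_on_sum[OF S] smooth_on_inner[OF S] that smooth_on_const)
  show ?thesis
    unfolding orbit_metric_def
    by (intro smooth_on_diff[OF S] smooth_on_mult[OF S] smooth_on_const tr r rr)
qed

text \<open>Gram--Schmidt for \<open>orbit_metric\<close> can start from the standard basis, since
  at \<open>p0\<close> this metric is the Euclidean one.\<close>

lemma smooth_triple:
  fixes \<theta> :: "'e::euclidean_space \<Rightarrow> 'n::finite coker"
  assumes S: "open S" "p0 \<in> S" and \<theta>: "\<And>x y. smooth_on S (\<lambda>p. \<theta> p x y)" "\<theta> p0 = \<Theta>0"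
    and orb: "\<And>p. p \<in> S \<Longrightarrow> \<exists>L D. orbit_form (\<theta> p) L D"
  obtains T and a :: "3 \<Rightarrow> 'e \<Rightarrow> modelW" where "open T" "p0 \<in> T" "T \<subseteq> S" "\<And>s. a s p0 = axis s 1" "\<And>s. smooth_on T (a s)"
    "\<And>p s t. p \<in> T \<Longrightarrow> orbit_metric (\<theta> p) (a s p) (a t p) = (if s = t then 1 else 0)"
proof -
  have bil: "bilinear (\<theta> p)" if "p \<in> S" for p
    using orb[OF that] by (auto simp: orbit_form_def)
  have bij: "bij (form_op (\<theta> p) (axis 1 1))" if "p \<in> S" for p
    using orb[OF that] orbit_form_op_bij[of "\<theta> p" _ _ "axis 1 1"] by auto
  have "\<exists>T a. open T \<and> p0 \<in> T \<and> T \<subseteq> S \<and> (\<forall>s\<in>(UNIV :: 3 set). a s p0 = axis s 1 \<and> smooth_on T (a s)) \<and>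
    (\<forall>p\<in>T. \<forall>s\<in>UNIV. \<forall>t\<in>UNIV. \<forall>k\<in>{()}. \<forall>l\<in>{()}.
      orbit_metric (\<theta> p) (a s p) (a t p) = (if s = t \<and> k = l then 1 else 0))"
  proof (rule smooth_gram_schmidt[where g = "\<lambda>p. orbit_metric (\<theta> p)" and J = "\<lambda>_ _ x. x" and ?k0.0 = "()", OF S])
    show "bilinear (orbit_metric (\<theta> p))" if "p \<in> S" for p
      using orb[OF that] orbit_metric_inner_product(1) by blast
    show "orbit_metric (\<theta> p) x y = orbit_metric (\<theta> p) y x" if "p \<in> S" for p x y
      using orb[OF that] orbit_metric_inner_product(2) by blast
    show "orbit_metric (\<theta> p) x x > 0" if "p \<in> S" "x \<noteq> 0" for p x
      using orb[OF that(1)] orbit_metric_inner_product(3) that(2) by blast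
    show "smooth_on S (\<lambda>p. orbit_metric (\<theta> p) x y)" for x y
      by (rule smooth_on_orbit_metric[OF S(1) \<theta>(1) bil bij])
    show "orbit_metric (\<theta> p0) (axis s 1) (axis t 1) = (if s = t \<and> k = l then 1 else 0)" for s t :: 3 and k l :: unit
      by (simp add: \<theta>(2) orbit_metric_eq[OF orbit_form_Theta0] inner_axis_axis)
  qed (auto simp: linear_ident)
  then obtain T and a :: "3 \<Rightarrow> 'e \<Rightarrow> modelW" where "open T" "p0 \<in> T" "T \<subseteq> S"
    "\<forall>s\<in>UNIV. a s p0 = axis s 1 \<and> smooth_on T (a s)"
    "\<forall>p\<in>T. \<forall>s\<in>UNIV. \<forall>t\<in>UNIV. \<forall>k\<in>{()}. \<forall>l\<in>{()}.
      orbit_metric (\<theta> p) (a s p) (a t p) = (if s = t \<and> k = l then 1 else 0)" by (elim exE conjE)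
  then show thesis by (intro that[of T a]) simp_all
qed

text \<open>If the covectors \<open>a s\<close> are orthonormal for \<open>orbit_metric \<theta>\<close>, then the ratios of the forms
  \<open>a s \<bullet> \<theta>\<close> form a quaternionic structure with the same orientation as the model, and the
  sign ambiguity of the triple \<open>a\<close> is absorbed in the sign of \<open>quat_metric\<close>.\<close>

definition quat_op :: "'n::finite coker \<Rightarrow> (3 \<Rightarrow> modelW) \<Rightarrow> 4 \<Rightarrow> 'n modelV \<Rightarrow> 'n modelV" where
  "quat_op \<theta> a k x = (if k = 1 then x else if k = 2 then form_ratio \<theta> (a 2) (a 3) x
    else if k = 3 then form_ratio \<theta> (a 3) (a 1) x else form_ratio \<theta> (a 1) (a 2) x)"

definition quat_metric :: "'n::finite coker \<Rightarrow> (3 \<Rightarrow> modelW) \<Rightarrow> 'n modelV \<Rightarrow> 'n modelV \<Rightarrow> real" where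
  "quat_metric \<theta> a x y = - (form_op \<theta> (a 1) (quat_op \<theta> a 2 x) \<bullet> y)"

definition quat_model :: "(3 \<Rightarrow> modelW) \<Rightarrow> 4 \<Rightarrow> 'n::finite modelV \<Rightarrow> 'n modelV" where
  "quat_model u k x = (if k = 1 then x else if k = 2 then im_mult (u 1) x
    else if k = 3 then im_mult (u 2) x else im_mult (u 3) x)"

lemma quat_model_simps [simp]:
  "quat_model u 1 x = x" "quat_model u 2 x = im_mult (u 1) x"
  "quat_model u 3 x = im_mult (u 2) x" "quat_model u 4 x = im_mult (u 3) x"
  by (simp_all add: quat_model_def)

definition oriented :: "(3 \<Rightarrow> modelW) \<Rightarrow> bool" where
  "oriented u \<longleftrightarrow> (\<forall>s t. u s \<bullet> u t = (if s = t then 1 else 0)) \<and>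
    cross3 (u 1) (u 2) = u 3 \<and> cross3 (u 2) (u 3) = u 1 \<and> cross3 (u 3) (u 1) = u 2"

lemma oriented_cross:
  assumes "oriented u"
  shows "cross3 (u 1) (u 2) = u 3" "cross3 (u 2) (u 3) = u 1" "cross3 (u 3) (u 1) = u 2"
    "cross3 (u 2) (u 1) = - u 3" "cross3 (u 3) (u 2) = - u 1" "cross3 (u 1) (u 3) = - u 2"
    "u s \<bullet> u t = (if s = t then 1 else 0)"
  using assms cross_skew[of "u 2" "u 1"] cross_skew[of "u 3" "u 2"] cross_skew[of "u 1" "u 3"]
  by (simp_all add: oriented_def)

lemma quat_model_linear: "linear (quat_model u k)"
  by (intro linearI) (simp_all add: quat_model_def linear_add[OF im_mult_linear] linear_scale[OF im_mult_linear])

lemma quat_model_orthogonal: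
  assumes "oriented u"
  shows "quat_model u k x \<bullet> quat_model u l x = (if k = l then x \<bullet> x else 0)"
proof -
  note u = oriented_cross[OF assms]
  have s: "im_mult b x \<bullet> x = 0" for b by (simp add: inner_commute im_mult_self)
  have "\<forall>k l. quat_model u k x \<bullet> quat_model u l x = (if k = l then x \<bullet> x else 0)"
    unfolding forall_4 by (simp add: im_mult_inner_im_mult u im_mult_self s im_mult_left)
  then show ?thesis by blast
qed

lemma quat_model_perp:
  assumes "oriented u" "\<And>k. x \<bullet> quat_model u k y = 0"
  shows "quat_model u k x \<bullet> quat_model u l y = 0"
proof -
  note u = oriented_cross[OF assms(1)]
  have p: "x \<bullet> y = 0" "x \<bullet> im_mult (u 1) y = 0" "x \<bullet> im_mult (u 2) y = 0" "x \<bullet> im_mult (u 3) y = 0"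
    using assms(2)[of 1] assms(2)[of 2] assms(2)[of 3] assms(2)[of 4] by simp_all
  have s: "im_mult b x \<bullet> y = - (x \<bullet> im_mult b y)" for b by (simp add: im_mult_skew)
  have "\<forall>k l. quat_model u k x \<bullet> quat_model u l y = 0"
    unfolding forall_4 by (simp add: im_mult_inner_im_mult u p s im_mult_left)
  then show ?thesis by blast
qed

text \<open>The linear map that sends the standard basis vector number \<open>k\<close> of block
  \<open>j\<close> to \<open>J k (f j)\<close>.\<close>

definition quat_comb :: "(4 \<Rightarrow> 'n::finite modelV \<Rightarrow> 'n modelV) \<Rightarrow> ('n \<Rightarrow> 'n modelV) \<Rightarrow> 'n modelV \<Rightarrow> 'n modelV" where
  "quat_comb J f x = (\<Sum>j\<in>UNIV. \<Sum>k\<in>UNIV. x $ j $ k *\<^sub>R J k (f j))"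

lemma quat_comb_linear: "linear (quat_comb J f)"
  by (intro linearI) (simp_all add: quat_comb_def scaleR_add_left sum.distrib scaleR_right.sum)

text \<open>The \<open>u s\<close> have the multiplication table of the standard imaginary units, so
  the change of basis intertwines the two quaternionic structures.\<close>

lemma im_mult_quat_comb:
  assumes "oriented u"
  shows "im_mult (u s) (quat_comb (quat_model u) f x) = quat_comb (quat_model u) f (im_mult (axis s 1) x)"
proof -
  note u = oriented_cross[OF assms]
  have ax: "(axis s 1 :: real ^ 3) $ i = (if i = s then 1 else 0)" for s i
    by (simp add: axis_def)
  have "\<forall>s. im_mult (u s) (quat_comb (quat_model u) f x) = quat_comb (quat_model u) f (im_mult (axis s 1) x)"
    unfolding forall_3 quat_comb_def sum_4 linear_sum[OF im_mult_linear] linear_add[OF im_mult_linear]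
      linear_scale[OF im_mult_linear] by (intro conjI sum.cong refl)
      (simp_all add: ax im_mult_im_mult[of "u _" "u _"] u im_mult_left)
  then show ?thesis by blast
qed

lemma inner_quat_comb:
  fixes g :: "'n::finite modelV \<Rightarrow> 'n modelV \<Rightarrow> real"
  assumes b: "bilinear g" and on: "\<And>i j k l. g (J k (f i)) (J l (f j)) = (if i = j \<and> k = l then 1 else 0)"
  shows "g (quat_comb J f x) (quat_comb J f y) = x \<bullet> y"
proof -
  have l: "linear (g v)" "linear (\<lambda>x. g x v)" for v
    using b by (auto simp: bilinear_def)
  have r: "g (J k (f i)) (quat_comb J f y) = y $ i $ k" for i k
  proof -
    have "g (J k (f i)) (quat_comb J f y) = (\<Sum>j\<in>UNIV. \<Sum>l\<in>UNIV. y $ j $ l * (if i = j \<and> k = l then 1 else 0))"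
      by (simp only: quat_comb_def linear_sum[OF l(1)] linear_scale[OF l(1)] on real_scaleR_def)
    also have "\<dots> = (\<Sum>j\<in>UNIV. if i = j then y $ j $ k else 0)"
      by (intro sum.cong refl) (simp add: if_distrib[of "\<lambda>t. _ * t"] cong: if_cong)
    finally show ?thesis by simp
  qed
  have "g (quat_comb J f x) (quat_comb J f y) = (\<Sum>i\<in>UNIV. \<Sum>k\<in>UNIV. x $ i $ k * y $ i $ k)"
    unfolding quat_comb_def[of J f x]
    by (simp only: linear_sum[OF l(2)] linear_scale[OF l(2)] r real_scaleR_def)
  then show ?thesis by (simp add: inner_vec_def)
qed

lemma orbit_form_quat:
  fixes \<theta> :: "'n::finite coker"
  assumes orb: "orbit_form \<theta> S D" and a: "\<And>s t. orbit_metric \<theta> (a s) (a t) = (if s = t then 1 else 0)"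
  shows "\<exists>u \<mu>. oriented u \<and> \<mu> \<noteq> 0 \<and> (\<forall>k x. quat_op \<theta> a k (S x) = S (quat_model u k x)) \<and>
    (\<forall>x y. quat_metric \<theta> a (S x) (S y) = \<mu> * (x \<bullet> y)) \<and>
    (\<forall>s x y. a s \<bullet> \<theta> (S x) (S y) = \<mu> * (im_mult (u s) x \<bullet> y))"
proof -
  have D: "linear D" "inj D" and S: "linear S" and bil: "bilinear \<theta>"
    and \<theta>S: "\<And>a x y. a \<bullet> \<theta> (S x) (S y) = D a \<bullet> \<Theta>0 x y" using orb by (auto simp: orbit_form_def)
  define k where "k = D (axis 1 1) \<bullet> D (axis 1 1)"
  have "D (axis 1 1) \<noteq> 0" using D linear_injective_0[OF D(1)] by (metis axis_eq_0_iff zero_neq_one)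
  then have k: "k > 0" by (simp add: k_def)
  define b where "b = (\<lambda>s. D (a s))"
  have bb: "b s \<bullet> b t = (if s = t then k else 0)" for s t
    using a[of s t] k by (simp add: orbit_metric_eq[OF orb] b_def k_def[symmetric] field_simps split: if_splits)
  have a0: "a s \<noteq> 0" for s
    using bb[of s s] k linear_0[OF D(1)] by (auto simp: b_def)
  \<comment> \<open>Up to the factor \<open>k\<close> the determinant of the triple
    \<open>b\<close>; its sign is the orientation of the triple.\<close>
  define \<mu> where "\<mu> = (b 3 \<bullet> cross3 (b 1) (b 2)) / k"
  have c12: "cross3 (b 1) (b 2) = \<mu> *\<^sub>R b 3"
    unfolding \<mu>_def by (rule cross3_orthogonal_triple) (use k in \<open>simp_all add: bb\<close>)
  have c23: "cross3 (b 2) (b 3) = \<mu> *\<^sub>R b 1"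
  proof -
    have "b 3 \<bullet> cross3 (b 1) (b 2) = b 1 \<bullet> cross3 (b 2) (b 3)" by (simp add: cross3_simps)
    then show ?thesis
      unfolding \<mu>_def by (simp only:) (rule cross3_orthogonal_triple; use k in \<open>simp add: bb\<close>)
  qed
  have c31: "cross3 (b 3) (b 1) = \<mu> *\<^sub>R b 2"
  proof -
    have "b 3 \<bullet> cross3 (b 1) (b 2) = b 2 \<bullet> cross3 (b 3) (b 1)" by (simp add: cross3_simps)
    then show ?thesis
      unfolding \<mu>_def by (simp only:) (rule cross3_orthogonal_triple; use k in \<open>simp add: bb\<close>)
  qed
  \<comment> \<open>The squared length of the cross product is \<open>k * k\<close> by Lagrange's
    identity, and it equals \<open>\<mu> * \<mu> * k\<close> by \<open>c12\<close>.\<close>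
  have \<mu>2: "\<mu> * \<mu> = k"
  proof -
    have "cross3 x y \<bullet> cross3 x y = (x \<bullet> x) * (y \<bullet> y) - (x \<bullet> y)\<^sup>2" for x y :: "real ^ 3"
      by (simp add: cross3_simps power2_eq_square)
    from this[of "b 1" "b 2"] have "\<mu> * \<mu> * k = k * k" by (simp add: c12 bb)
    then show ?thesis using k by simp
  qed
  then have \<mu>: "\<mu> \<noteq> 0" using k by auto
  \<comment> \<open>Division by \<mu>, which has the sign of the orientation, and not by the length
    of \<open>b s\<close>: for a negatively oriented triple this also reverses all three vectors, so
    \<open>u\<close> is positively oriented in either case.\<close>
  define u where "u = (\<lambda>s. (1 / \<mu>) *\<^sub>R b s)"
  have bu: "b s = \<mu> *\<^sub>R u s" for s
    using \<mu> by (simp add: u_def)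
  have orient: "oriented u"
    using \<mu> \<mu>2[symmetric] by (simp add: oriented_def u_def bb cross_mult_left cross_mult_right c12 c23 c31)
  have ratio: "form_ratio \<theta> (a s) (a t) (S x) = S (im_mult (u r) x)"
    if "cross3 (b s) (b t) = \<mu> *\<^sub>R b r" "s \<noteq> t" for s t r x
    using that \<mu> \<mu>2[symmetric] unfolding orbit_form_ratio[OF orb a0] b_def[symmetric] im_mult_im_mult
    by (simp add: b_def[symmetric, THEN fun_cong] fun_cong[OF b_def, symmetric] bb im_mult_left u_def)
  have op: "quat_op \<theta> a k (S x) = S (quat_model u k x)" for k x
    unfolding quat_op_def quat_model_def using ratio[OF c12] ratio[OF c23] ratio[OF c31] by simp
  have form: "a s \<bullet> \<theta> (S x) (S y) = \<mu> * (im_mult (u s) x \<bullet> y)" for s x y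
    unfolding \<theta>S im_mult_inner[symmetric] using bu[of s] by (simp add: b_def im_mult_left)
  \<comment> \<open>The first form evaluated on the first unit times \<open>x\<close>: the unit
    occurs twice and squares to -1, which the sign in \<open>quat_metric\<close>
    compensates.\<close>
  have "quat_metric \<theta> a (S x) (S y) = \<mu> * (x \<bullet> y)" for x y
    unfolding quat_metric_def op quat_model_simps form_op_inner[OF bil] form
    by (simp add: im_mult_im_mult oriented_cross[OF orient] im_mult_left)
  then show ?thesis using orient \<mu> op form by (intro exI[of _ u] exI[of _ \<mu>]) simp
qed

lemma quat_comb_pullback:
  assumes "linear S" "\<And>k x. J k (S x) = S (J' k x)"
  shows "quat_comb J (\<lambda>j. S (f j)) x = S (quat_comb J' f x)"
  by (simp add: quat_comb_def assms(2) linear_sum[OF assms(1)] linear_scale[OF assms(1)])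

text \<open>Pulled back by \<open>S\<close>, the map \<open>L\<close> becomes an \<open>L'\<close>
  that intertwines \<open>u s\<close> with the standard units and satisfies
  \<open>\<mu> * (L' x \<bullet> L' y) = x \<bullet> y\<close>. The factor \<mu> in the forms is
  thereby absorbed, and they become the standard ones.\<close>

lemma quat_frame_form:
  fixes \<theta> :: "'n::finite coker"
  assumes orb: "orbit_form \<theta> S D" and a: "\<And>s t. orbit_metric \<theta> (a s) (a t) = (if s = t then 1 else 0)"
    and f: "\<And>i j k l. quat_metric \<theta> a (quat_op \<theta> a k (f i)) (quat_op \<theta> a l (f j)) = (if i = j \<and> k = l then 1 else 0)"
  defines "L \<equiv> quat_comb (quat_op \<theta> a) f"
  shows "bij L" "a s \<bullet> \<theta> (L x) (L y) = \<Theta>0 x y $ s"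
proof -
  obtain u \<mu> where *: "oriented u" "\<mu> \<noteq> 0" "\<forall>k x. quat_op \<theta> a k (S x) = S (quat_model u k x)"
    "\<forall>x y. quat_metric \<theta> a (S x) (S y) = \<mu> * (x \<bullet> y)"
    "\<forall>s x y. a s \<bullet> \<theta> (S x) (S y) = \<mu> * (im_mult (u s) x \<bullet> y)"
    using orbit_form_quat[OF orb a] by (elim exE conjE)
  note u = *(1,2) *(3-5)[rule_format]
  have S: "linear S" "bij S" using orb by (auto simp: orbit_form_def)
  define f' where "f' = (\<lambda>j. inv S (f j))"
  have fS: "f = (\<lambda>j. S (f' j))" using S(2) by (simp add: f'_def surj_f_inv_f bij_is_surj)
  define L' where "L' = quat_comb (quat_model u) f'"
  have L: "L x = S (L' x)" for x
    unfolding L_def L'_def by (subst fS) (rule quat_comb_pullback[where S = S and J = "quat_op \<theta> a" and J' = "quat_model u", OF S(1) u(3)])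
  have bil: "bilinear (\<lambda>x y :: 'n modelV. \<mu> * (x \<bullet> y))"
    unfolding bilinear_def by (intro conjI allI linearI) (simp_all add: inner_add_left inner_add_right algebra_simps)
  have inner: "\<mu> * (L' x \<bullet> L' y) = x \<bullet> y" for x y
    unfolding L'_def
  proof (rule inner_quat_comb[OF bil])
    show "\<mu> * (quat_model u k (f' i) \<bullet> quat_model u l (f' j)) = (if i = j \<and> k = l then 1 else 0)" for i j k l
      using f[of k i l j] by (subst (asm) (1 2) fS) (simp add: u(3,4))
  qed
  have "inj L'"
  proof (rule injI)
    fix x y assume "L' x = L' y"
    then have "x \<bullet> z = y \<bullet> z" for z
      using inner[of x z] inner[of y z] by simp
    then show "x = y" using vector_eq_rdot by blast
  qed
  then have "inj L" using inj_compose[OF bij_is_inj[OF S(2)], of L'] by (simp add: L[abs_def] o_def)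
  then show "bij L"
    using quat_comb_linear[of "quat_op \<theta> a" f] by (simp add: bij_def linear_injective_imp_surjective L_def)
  have "a s \<bullet> \<theta> (L x) (L y) = \<mu> * (im_mult (u s) (L' x) \<bullet> L' y)" by (simp add: L u(5))
  also have "\<dots> = im_mult (axis s 1) x \<bullet> y"
    unfolding L'_def im_mult_quat_comb[OF u(1)] by (rule inner[unfolded L'_def])
  also have "\<dots> = \<Theta>0 x y $ s"
    unfolding im_mult_inner by (simp add: inner_axis')
  finally show "a s \<bullet> \<theta> (L x) (L y) = \<Theta>0 x y $ s" .
qed

section \<open>Assembling the group element\<close>

lemma smooth_on_Pair:
  fixes f :: "'a::real_normed_vector \<Rightarrow> 'b::real_normed_vector" and g :: "'a \<Rightarrow> 'c::real_normed_vector"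
  assumes "open S" "smooth_on S f" "smooth_on S g" shows "smooth_on S (\<lambda>x. (f x, g x))"
proof -
  have b: "bounded_linear (\<lambda>y :: 'b. (y, 0 :: 'c))" "bounded_linear (\<lambda>y :: 'c. (0 :: 'b, y))"
    by (intro bounded_linear_Pair bounded_linear_ident bounded_linear_zero)+
  have "smooth_on S (\<lambda>x. (f x, 0) + (0, g x))"
    by (rule smooth_on_add[OF assms(1) smooth_on_bounded_linear[OF assms(1) b(1) assms(2)]
          smooth_on_bounded_linear[OF assms(1) b(2) assms(3)]])
  then show ?thesis by simp
qed

text \<open>\<open>E\<close> leads from \<theta> back to the normal form, while \<open>q\<close> has
  to lead from the normal form to \<theta>; hence \<open>inv E\<close> in the second block.\<close>

lemma groupQ_block:
  fixes L :: "'n::finite modelV \<Rightarrow> 'n modelV" and E :: "modelW \<Rightarrow> modelW"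
  assumes L: "linear L" "bij L" and E: "linear E" "bij E" and \<theta>: "\<And>x y. E (\<theta> (L x) (L y)) = \<Theta>0 x y"
  defines "q \<equiv> \<lambda>v. (L (fst v), inv E (snd v))"
  shows "q \<in> groupQ" "actQ q \<Theta>0 = \<theta>"
proof -
  have iE: "linear (inv E)" using E by (simp add: linear_inv)
  have q: "linear q"
    by (intro linearI) (simp_all add: q_def linear_add[OF L(1)] linear_scale[OF L(1)] linear_add[OF iE] linear_scale[OF iE])
  have inj: "inj q" using bij_is_inj[OF L(2)] bij_is_inj[OF bij_imp_bij_inv[OF E(2)]]
    by (auto simp: q_def inj_def prod_eq_iff)
  show "q \<in> groupQ" using q inj by (simp add: groupQ_iff q_def linear_0[OF iE])
  have "inv q (x, 0) = (inv L x, 0)" for x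
    by (rule inv_f_eq[OF inj]) (simp add: q_def linear_0[OF iE] surj_f_inv_f[OF bij_is_surj[OF L(2)]])
  then show "actQ q \<Theta>0 = \<theta>" using \<theta> L(2) E(2) by (intro ext)
      (simp add: actQ_def q_def \<theta>[symmetric] surj_f_inv_f bij_is_surj bij_is_inj)
qed

text \<open>At the base point the recovered structure is the standard one, so the quaternionic
  Gram--Schmidt process can start from standard basis vectors.\<close>

lemma quat_Theta0:
  fixes x y :: "'n::finite modelV"
  shows "quat_op \<Theta>0 (\<lambda>s. axis s 1) k x = quat_model (\<lambda>s. axis s 1) k x"
    "quat_metric \<Theta>0 (\<lambda>s. axis s 1) x y = x \<bullet> y"
proof -
  have r: "form_ratio \<Theta>0 (axis s 1) (axis t 1) x = - im_mult (axis s 1) (im_mult (axis t 1) x)"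
    for s t and x :: "'n modelV"
    using orbit_form_ratio[OF orbit_form_Theta0, of "axis s 1" "axis t 1" x] by (simp add: inner_axis_axis)
  have op: "quat_op \<Theta>0 (\<lambda>s. axis s 1) k x = quat_model (\<lambda>s. axis s 1) k x" for k and x :: "'n modelV"
    by (simp add: quat_op_def quat_model_def r im_mult_im_mult inner_axis_axis cross_basis)
  then show "quat_op \<Theta>0 (\<lambda>s. axis s 1) k x = quat_model (\<lambda>s. axis s 1) k x" .
  show "quat_metric \<Theta>0 (\<lambda>s. axis s 1) x y = x \<bullet> y"
    by (simp add: quat_metric_def op form_op_inner[OF bilinear_Theta0] im_mult_inner[symmetric] im_mult_im_mult
        inner_axis_axis im_mult_left)
qed

lemma smooth_on_quat_op:
  fixes \<theta> :: "'e::euclidean_space \<Rightarrow> 'n::finite coker"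
  assumes S: "open S" and \<theta>: "\<And>x y. smooth_on S (\<lambda>p. \<theta> p x y)" "\<And>p. p \<in> S \<Longrightarrow> bilinear (\<theta> p)"
    and a: "\<And>s. smooth_on S (a s)" "\<And>s p. p \<in> S \<Longrightarrow> bij (form_op (\<theta> p) (a s p))"
  shows "smooth_on S (\<lambda>p. quat_op (\<theta> p) (\<lambda>s. a s p) k x)"
  unfolding quat_op_def using smooth_on_form_ratio[OF S \<theta> a a(1)]
  by (cases "k = 1"; cases "k = 2"; cases "k = 3") simp_all

lemma smooth_on_quat_metric:
  fixes \<theta> :: "'e::euclidean_space \<Rightarrow> 'n::finite coker"
  assumes S: "open S" and \<theta>: "\<And>x y. smooth_on S (\<lambda>p. \<theta> p x y)" "\<And>p. p \<in> S \<Longrightarrow> bilinear (\<theta> p)"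
    and a: "\<And>s. smooth_on S (a s)" "\<And>s p. p \<in> S \<Longrightarrow> bij (form_op (\<theta> p) (a s p))"
  shows "smooth_on S (\<lambda>p. quat_metric (\<theta> p) (\<lambda>s. a s p) x y)"
  unfolding quat_metric_def
  by (rule smooth_on_minus[OF S smooth_on_inner[OF S
        smooth_on_linear_apply[where F = "\<lambda>p. form_op (\<theta> p) (a 1 p)",
          OF S form_op_linear[OF \<theta>(2)] smooth_on_form_op[OF S \<theta>(1) a(1)] smooth_on_quat_op[OF S \<theta> a]]
        smooth_on_const]])

text \<open>The group element is found from \<open>\<theta>\<close> by two Gram--Schmidt processes: for \<open>orbit_metric\<close> on
  the dual of \<open>T/V\<close>, and quaternionically for \<open>quat_metric\<close> on \<open>V\<close>.\<close>

lemma smooth_orbit_lift: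
  fixes \<theta> :: "'e::euclidean_space \<Rightarrow> 'n::finite coker"
  assumes S: "open S" "p0 \<in> S" and \<theta>: "\<And>x y. smooth_on S (\<lambda>p. \<theta> p x y)" "\<theta> p0 = \<Theta>0"
    and orb: "\<And>p. p \<in> S \<Longrightarrow> \<exists>q\<in>groupQ. \<theta> p = actQ q \<Theta>0"
  obtains T h where "open T" "p0 \<in> T" "T \<subseteq> S" "\<And>p. p \<in> T \<Longrightarrow> h p \<in> groupQ"
    "\<And>p. p \<in> T \<Longrightarrow> actQ (h p) \<Theta>0 = \<theta> p" "\<And>v. smooth_on T (\<lambda>p. h p v)"
proof -
  have orb: "\<exists>L D. orbit_form (\<theta> p) L D" if "p \<in> S" for p
    using orb[OF that] orbit_form_exists by blast
  have bil: "bilinear (\<theta> p)" if "p \<in> S" for p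
    using orb[OF that] by (auto simp: orbit_form_def)
  obtain T1 and a :: "3 \<Rightarrow> 'e \<Rightarrow> modelW" where T1: "open T1" "p0 \<in> T1" "T1 \<subseteq> S"
    and a0: "\<forall>s. a s p0 = axis s 1" and a: "\<forall>s. smooth_on T1 (a s)"
    and on: "\<forall>p\<in>T1. \<forall>s t. orbit_metric (\<theta> p) (a s p) (a t p) = (if s = t then 1 else 0)"
    using smooth_triple[OF S \<theta> orb] by (metis (no_types, lifting))
  note on = on[rule_format]
  have bij1: "bij (form_op (\<theta> p) (a s p))" if p: "p \<in> T1" for s p
  proof -
    obtain L D where LD: "orbit_form (\<theta> p) L D" using orb p T1(3) by blast
    have "a s p \<noteq> 0"
      using on[OF p, of s s] bilinear_lzero[OF orbit_metric_inner_product(1)[OF LD]] by auto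
    then show ?thesis by (rule orbit_form_op_bij[OF LD])
  qed
  define J where "J = (\<lambda>k p. quat_op (\<theta> p) (\<lambda>s. a s p) k)"
  define g where "g = (\<lambda>p. quat_metric (\<theta> p) (\<lambda>s. a s p))"
  have \<theta>1: "smooth_on T1 (\<lambda>p. \<theta> p x y)" for x y by (rule smooth_on_subset[OF \<theta>(1) T1(3)])
  have bil1: "bilinear (\<theta> p)" if "p \<in> T1" for p using bil T1(3) that by blast
  have J1: "smooth_on T1 (\<lambda>p. J k p x)" for k x
    unfolding J_def by (rule smooth_on_quat_op[OF T1(1) \<theta>1 bil1 a[rule_format] bij1])
  have g1: "smooth_on T1 (\<lambda>p. g p x y)" for x y
    unfolding g_def by (rule smooth_on_quat_metric[OF T1(1) \<theta>1 bil1 a[rule_format] bij1])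
  have a00: "(\<lambda>s. a s p0) = (\<lambda>s. axis s 1)" using a0 by auto
  have J0: "J k p0 x = quat_model (\<lambda>s. axis s 1) k x" for k x
    unfolding J_def a00 \<theta>(2) by (rule quat_Theta0)
  have g0: "g p0 x y = x \<bullet> y" for x y
    unfolding g_def a00 \<theta>(2) by (rule quat_Theta0)
  define v0 :: "'n modelV" where "v0 = axis undefined (axis 1 1)"
  \<comment> \<open>The metric \<open>g p\<close> is definite with the sign of its factor \<mu>, so
    its value on one nonzero vector decides that sign. Positivity there is an open condition that
    holds at \<open>p0\<close>.\<close>
  define T2 where "T2 = {p \<in> T1. g p v0 v0 \<in> {0<..}}"
  have "open T2"
    using continuous_open_preimage[OF smooth_on_imp_continuous_on[OF g1[of v0 v0]] T1(1), of "{0<..}"]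
    unfolding T2_def Int_def vimage_def by simp
  moreover have "p0 \<in> T2" using T1(2) by (simp add: T2_def g0 v0_def inner_axis_axis)
  ultimately have T2: "open T2" "p0 \<in> T2" "T2 \<subseteq> T1" by (auto simp: T2_def)
  have data: "\<exists>(L :: 'n modelV \<Rightarrow> 'n modelV) u \<mu>. linear L \<and> bij L \<and> oriented u \<and> \<mu> > 0 \<and> (\<forall>k x. J k p (L x) = L (quat_model u k x)) \<and>
      (\<forall>x y. g p (L x) (L y) = \<mu> * (x \<bullet> y))" if p: "p \<in> T2" for p
  proof -
    have p1: "p \<in> T1" using p T2 by blast
    obtain L D where LD: "orbit_form (\<theta> p) L D" using orb p1 T1(3) by blast
    have L: "linear L" "bij L" using LD by (auto simp: orbit_form_def)
    obtain u \<mu> where *: "oriented u" "\<mu> \<noteq> 0" "\<forall>k x. J k p (L x) = L (quat_model u k x)"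
      "\<forall>x y. g p (L x) (L y) = \<mu> * (x \<bullet> y)"
      using orbit_form_quat[OF LD, of "\<lambda>s. a s p", OF on[OF p1]] unfolding J_def g_def by (elim exE conjE)
    obtain z where "v0 = L z" using L(2) by (metis bij_is_surj surjD)
    then have "\<mu> * (z \<bullet> z) > 0" using p *(4) by (simp add: T2_def)
    then have "\<mu> > 0" using inner_ge_zero[of z] by (simp add: zero_less_mult_iff)
    then have "linear L \<and> bij L \<and> oriented u \<and> \<mu> > 0 \<and> (\<forall>k x. J k p (L x) = L (quat_model u k x)) \<and>
        (\<forall>x y. g p (L x) (L y) = \<mu> * (x \<bullet> y))" using L * by simp
    then show ?thesis by - (rule exI, rule exI, rule exI, assumption)
  qed
  have "\<exists>T f. open T \<and> p0 \<in> T \<and> T \<subseteq> T2 \<and> (\<forall>j\<in>(UNIV :: 'n set). f j p0 = axis j (axis 1 1) \<and> smooth_on T (f j)) \<and>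
    (\<forall>p\<in>T. \<forall>i\<in>UNIV. \<forall>j\<in>UNIV. \<forall>k\<in>(UNIV :: 4 set). \<forall>l\<in>UNIV.
      g p (J k p (f i p)) (J l p (f j p)) = (if i = j \<and> k = l then 1 else 0))"
  proof (rule smooth_gram_schmidt[where ?k0.0 = 1, OF T2(1,2)])
    fix p assume p: "p \<in> T2"
    obtain L :: "'n modelV \<Rightarrow> 'n modelV" and u \<mu> where L: "linear L" "bij L" and u: "oriented u" and \<mu>: "\<mu> > 0"
      and J: "\<forall>k x. J k p (L x) = L (quat_model u k x)" and g: "\<forall>x y. g p (L x) (L y) = \<mu> * (x \<bullet> y)"
      using data[OF p] by (elim exE conjE)
    note J = J[rule_format] and g = g[rule_format]
    have iL: "linear (inv L)" using L by (simp add: linear_inv)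
    have LL: "L (inv L x) = x" for x
      using L(2) by (simp add: surj_f_inv_f bij_is_surj)
    have g': "g p x y = \<mu> * (inv L x \<bullet> inv L y)" for x y
      using g[of "inv L x" "inv L y"] by (simp add: LL)
    have J': "J k p x = L (quat_model u k (inv L x))" for k x
      using J[of k "inv L x"] by (simp add: LL)
    have L': "inv L (L x) = x" for x
      using L(2) by (simp add: bij_is_inj)
    show "bilinear (g p)"
      unfolding bilinear_def g'
      by (intro conjI allI linearI)
        (simp_all add: g' linear_add[OF iL] linear_scale[OF iL] inner_add_left inner_add_right algebra_simps)
    show "g p x y = g p y x" for x y
      by (simp add: g' inner_commute)
    show "g p x x > 0" if "x \<noteq> 0" for x
    proof -
      have "inv L x \<noteq> 0" using that LL[of x] linear_0[OF L(1)] by auto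
      then show ?thesis using \<mu> by (simp add: g')
    qed
    show "linear (J k p)" for k
      by (intro linearI) (simp_all add: J' linear_add[OF iL] linear_scale[OF iL] linear_add[OF L(1)]
          linear_scale[OF L(1)] linear_add[OF quat_model_linear] linear_scale[OF quat_model_linear])
    show "J 1 p x = x" for x
      by (simp add: J_def quat_op_def)
    show "g p (J k p x) (J l p x) = (if k = l then g p x x else 0)" for k l x
      by (simp add: J' g' L' quat_model_orthogonal[OF u])
    show "g p (J k p x) (J l p y) = 0" if perp: "\<And>k. k \<in> UNIV \<Longrightarrow> g p x (J k p y) = 0" for x y k l
    proof -
      have "inv L x \<bullet> quat_model u k (inv L y) = 0" for k
        using perp[of k] \<mu> by (simp add: J' g' L')
      then show ?thesis by (simp add: J' g' L' quat_model_perp[OF u])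
    qed
  next
    fix i j :: 'n and k l :: 4
    \<comment> \<open>One vector per block is enough: 1 and the three units carry it to the standard
      basis of the block.\<close>
    have ax: "quat_model (\<lambda>s. axis s 1) k (axis i (axis 1 1)) = axis i (axis k 1)" for k and i :: 'n
      using exhaust_4[of k] by (auto simp: im_mult_axis)
    show "g p0 (J k p0 (axis i (axis 1 1))) (J l p0 (axis j (axis 1 1))) = (if i = j \<and> k = l then 1 else 0)"
      by (simp add: J0 g0 ax inner_axis_axis)
  qed (auto intro: smooth_on_subset[OF g1 T2(3)] smooth_on_subset[OF J1 T2(3)])
  then obtain T f where T: "open T" "p0 \<in> T" "T \<subseteq> T2" and
    f: "\<forall>j\<in>(UNIV :: 'n set). f j p0 = axis j (axis 1 1) \<and> smooth_on T (f j)"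
    and onf: "\<forall>p\<in>T. \<forall>i\<in>UNIV. \<forall>j\<in>UNIV. \<forall>k\<in>(UNIV :: 4 set). \<forall>l\<in>UNIV.
      g p (J k p (f i p)) (J l p (f j p)) = (if i = j \<and> k = l then 1 else 0)" by (elim exE conjE)
  define L where "L = (\<lambda>p. quat_comb (\<lambda>k. J k p) (\<lambda>j. f j p))"
  \<comment> \<open>Coordinates in \<open>T/V\<close> with respect to the covectors
    \<open>a s p\<close>; in them the pullback of \<theta> by \<open>L p\<close> is
    \<open>\<Theta>0\<close>.\<close>
  define E where "E = (\<lambda>p w. \<chi> s. a s p \<bullet> w :: modelW)"
  have linE: "linear (E p)" for p
    by (intro linearI) (simp_all add: E_def vec_eq_iff inner_add_right)
  have pt: "bij (L p)" "\<And>x y. E p (\<theta> p (L p x) (L p y)) = \<Theta>0 x y" if p: "p \<in> T" for p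
  proof -
    have p1: "p \<in> T1" using p T T2 by blast
    obtain S' D where SD: "orbit_form (\<theta> p) S' D" using orb p1 T1(3) by blast
    have on': "orbit_metric (\<theta> p) (a s p) (a t p) = (if s = t then 1 else 0)" for s t
      by (rule on[OF p1])
    have f': "quat_metric (\<theta> p) (\<lambda>s. a s p) (quat_op (\<theta> p) (\<lambda>s. a s p) k (f i p)) (quat_op (\<theta> p) (\<lambda>s. a s p) l (f j p)) =
        (if i = j \<and> k = l then 1 else 0)" for i j k l
      using onf p by (simp add: J_def g_def)
    have Lp: "L p = quat_comb (quat_op (\<theta> p) (\<lambda>s. a s p)) (\<lambda>j. f j p)" by (simp add: L_def J_def)
    show "bij (L p)"
      unfolding Lp by (rule quat_frame_form(1)[where a = "\<lambda>s. a s p", OF SD on' f'])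
    show "E p (\<theta> p (L p x) (L p y)) = \<Theta>0 x y" for x y
      unfolding Lp E_def vec_eq_iff
      by (intro allI, subst vec_lambda_beta) (rule quat_frame_form(2)[where a = "\<lambda>s. a s p", OF SD on' f'])
  qed
  have linL: "linear (L p)" for p
    unfolding L_def by (rule quat_comb_linear)
  have bijE: "bij (E p)" if p: "p \<in> T" for p
  proof -
    have "w \<in> range (E p)" for w
    proof -
      \<comment> \<open>Every \<open>w\<close> is a value of \<open>\<Theta>0\<close>, attained at
        the unit vector \<open>v0\<close> and its product with \<open>w\<close>. Since
        \<open>E p\<close> takes on all values of \<open>\<Theta>0\<close>, it is
        surjective.\<close>
      have "b \<bullet> \<Theta>0 v0 (im_mult w v0) = b \<bullet> w" for b
        by (simp add: im_mult_inner[symmetric] im_mult_inner_im_mult im_mult_self) (simp add: v0_def inner_axis_axis)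
      then have "\<Theta>0 v0 (im_mult w v0) = w" using vector_eq_ldot by blast
      then show ?thesis using pt(2)[OF p, of v0 "im_mult w v0"] by (metis rangeI)
    qed
    then have "surj (E p)" by blast
    then show ?thesis using linE by (simp add: bij_def linear_surjective_imp_injective)
  qed
  define h where "h = (\<lambda>p v. (L p (fst v), inv (E p) (snd v)))"
  show thesis
  proof (rule that)
    show "open T" "p0 \<in> T" "T \<subseteq> S" using T T2 T1 by auto
    show "h p \<in> groupQ" "actQ (h p) \<Theta>0 = \<theta> p" if "p \<in> T" for p
      unfolding h_def using groupQ_block[OF linL pt(1)[OF that] linE bijE[OF that] pt(2)[OF that]] by blast+
    have T1T: "T \<subseteq> T1" using T T2 by blast
    have J_linear: "linear (J k p)" if p: "p \<in> T" for k p
    proof -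
      have "p \<in> T1" using p T1T by blast
      then show ?thesis
        unfolding J_def quat_op_def[abs_def]
        using form_ratio_linear[OF bil1 bij1]
        by (cases "k = 1"; cases "k = 2"; cases "k = 3") (simp_all add: linear_ident)
    qed
    have "smooth_on T (\<lambda>p. L p x)" for x
      unfolding L_def quat_comb_def
    proof (intro smooth_on_sum[OF T(1)] smooth_on_scaleR[OF T(1)] smooth_on_const)
      show "smooth_on T (\<lambda>p. J k p (f j p))" for j k
        by (rule smooth_on_linear_apply[where F = "J k", OF T(1) J_linear smooth_on_subset[OF J1 T1T]])
          (use f in auto)
    qed
    moreover have "smooth_on T (\<lambda>p. inv (E p) w)" for w
    proof (rule smooth_on_inv_linear[OF T(1) linE bijE])
      fix w
      have "E p w = (\<Sum>s\<in>UNIV. (a s p \<bullet> w) *\<^sub>R axis s 1)" for p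
        by (simp add: E_def vec_eq_iff axis_def if_distrib[of "\<lambda>t. _ * t"] cong: if_cong)
      moreover have "smooth_on T (\<lambda>p. \<Sum>s\<in>UNIV. (a s p \<bullet> w) *\<^sub>R axis s 1)"
        by (intro smooth_on_sum[OF T(1)] smooth_on_scaleR[OF T(1)] smooth_on_inner[OF T(1)] smooth_on_const
            smooth_on_subset[OF a[rule_format] T1T])
      ultimately show "smooth_on T (\<lambda>p. E p w)" by simp
    qed
    ultimately show "smooth_on T (\<lambda>p. h p v)" for v
      unfolding h_def by (intro smooth_on_Pair[OF T(1)])
  qed
qed

section \<open>Normalized frames\<close>

context Q_manifold
begin

definition normalized :: "('m, 'n modelT) frame set" where
  "normalized = {f \<in> R. \<Theta>Q f = \<Theta>0}"

text \<open>By equivariance \<open>u \<circ> q\<close> is normalized iff \<open>inv q\<close> fixes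
  \<open>\<Theta>0\<close>, and the stabilizer is closed under inverses.\<close>

lemma normalized_related:
  assumes u: "(y, u) \<in> R" "\<Theta>Q (y, u) = \<Theta>0" and q: "q \<in> groupQ"
  shows "\<Theta>Q (y, u \<circ> q) = \<Theta>0 \<longleftrightarrow> q \<in> groupB"
proof -
  have "\<Theta>Q (y, u \<circ> q) = \<Theta>0 \<longleftrightarrow> inv q \<in> groupB"
    by (simp add: intrinsic_torsion_equivariant[OF u(1) q] u(2) groupB_iff groupQ_inv[OF q])
  also have "\<dots> \<longleftrightarrow> q \<in> groupB"
    using groupB_inv[of q] groupB_inv[of "inv q"] by (auto simp: inv_inv_eq[OF groupQ_bij[OF q]])
  finally show ?thesis .
qed

lemma frame_field_lift:
  assumes s: "adapted U s" and c: "c \<in> A" and T: "open T" "T \<subseteq> cimage c U"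
    and h: "\<And>p. p \<in> T \<Longrightarrow> h p \<in> groupQ" "\<And>v. smooth_on T (\<lambda>p. h p v)"
  shows "adapted (fst c \<inter> snd c -` T) (\<lambda>y. s y \<circ> h (snd c y))"
proof -
  let ?U = "fst c \<inter> snd c -` T"
  note ff = adaptedD(1)[OF s]
  have sub: "?U \<subseteq> U"
  proof
    fix y assume y: "y \<in> ?U"
    then obtain z where "z \<in> fst c \<inter> U" "snd c y = snd c z" using T(2) by auto
    then show "y \<in> U" using y inj_onD[OF chart_inj[OF c], of y z] by auto
  qed
  have mem: "(y, s y \<circ> h (snd c y)) \<in> R" if y: "y \<in> ?U" for y
    using R_right_action[OF adaptedD(2)[OF s]] h(1) y sub by blast
  have op: "openin M ?U" by (rule openin_chart_vimage[OF c T(1)])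
  have "smooth_on (snd d ` (fst d \<inter> ?U)) (\<lambda>p. (s (chart_inv d p) \<circ> h (snd c (chart_inv d p))) v d)"
    if d: "d \<in> A" for d v
  proof -
    let ?D = "snd d ` (fst d \<inter> ?U)"
    have opD: "open ?D" by (rule open_chart_image[OF d op])
    \<comment> \<open>\<open>h\<close> is given in the chart \<open>c\<close>; in another chart it
      has to be preceded by the transition map.\<close>
    have hd: "smooth_on ?D (\<lambda>p. h (transition d c p) v)"
    proof (rule smooth_on_compose[OF opD T(1) _ _ h(2)])
      show "transition d c ` ?D \<subseteq> T" using d by auto
      show "smooth_on ?D (transition d c)"
        by (rule smooth_on_subset[OF smooth_transition[OF d c]]) auto
    qed
    have "smooth_on ?D (\<lambda>p. coords s d p (h (transition d c p) v))"
    proof (rule smooth_on_linear_apply[OF opD _ _ hd])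
      show "linear (coords s d p)" if "p \<in> ?D" for p
        by (rule coords_linear[OF ff d]) (use that sub in auto)
      show "smooth_on ?D (\<lambda>p. coords s d p w)" for w
        by (rule smooth_on_subset[OF frame_fieldD(3)[OF ff d]]) (use sub in auto)
    qed
    then show ?thesis by (rule smooth_on_cong[OF opD]) (use d in auto)
  qed
  then show ?thesis using op mem R_frame_bundle by (simp add: adapted_def frame_field_def)
qed

lemma normalized_reduction:
  assumes orbit: "\<And>f. f \<in> R \<Longrightarrow> \<exists>q\<in>groupQ. \<Theta>Q f = actQ q \<Theta>0"
  shows "is_reduction M A groupB normalized"
  unfolding is_reduction_def
proof (intro conjI ballI)
  show "normalized \<subseteq> frame_bundle M A"
    using reduction_subset[OF R_reduction] by (auto simp: normalized_def)
next
  fix x assume x: "x \<in> topspace M"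
  obtain U0 s0 where s0: "adapted U0 s0" "x \<in> U0" by (rule adapted_cover[OF x])
  obtain q where q: "q \<in> groupQ" "\<Theta>Q (x, s0 x) = actQ q \<Theta>0"
    using orbit[OF adaptedD(2)[OF s0]] by blast
  \<comment> \<open>\<open>smooth_orbit_lift\<close> starts at a point where the value is
    \<open>\<Theta>0\<close> itself, so the section is first corrected at \<open>x\<close> by a
    constant element of Q.\<close>
  have "\<Theta>Q (x, s0 x \<circ> q) = \<Theta>0"
    by (simp add: intrinsic_torsion_equivariant[OF adaptedD(2)[OF s0] q(1)] q actQ_inv_cancel)
  moreover obtain U s where s: "adapted U s" "x \<in> U" "s x = s0 x \<circ> q"
    by (rule adapted_through[OF R_right_action[OF adaptedD(2)[OF s0] q(1)]])
  ultimately have \<Theta>x: "\<Theta>Q (x, s x) = \<Theta>0" by simp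
  obtain c where c: "c \<in> A" "x \<in> fst c" using chart_cover[OF x] by blast
  let ?D = "cimage c U"
  have opD: "open ?D" by (rule open_chart_image[OF c(1) frame_fieldD(1)[OF adaptedD(1)[OF s(1)]]])
  have xD: "snd c x \<in> ?D" using c s(2) by simp
  have tors: "\<Theta>Q (y, s y) = bracket_torsion s c (snd c y)" if "y \<in> fst c" "y \<in> U" for y
    by (rule intrinsic_torsion_adapted[OF s(1) that(2) c(1) that(1)])
  have orb: "\<exists>q\<in>groupQ. bracket_torsion s c p = actQ q \<Theta>0" if p: "p \<in> ?D" for p
  proof -
    obtain y where y: "y \<in> fst c" "y \<in> U" "p = snd c y" using p by auto
    show ?thesis using orbit[OF adaptedD(2)[OF s(1) y(2)]] tors[OF y(1,2)] y(3) by simp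
  qed
  have \<Theta>p: "bracket_torsion s c (snd c x) = \<Theta>0" using tors[OF c(2) s(2)] \<Theta>x by simp
  obtain T h where T: "open T" "snd c x \<in> T" "T \<subseteq> ?D" and h: "\<And>p. p \<in> T \<Longrightarrow> h p \<in> groupQ"
    "\<And>p. p \<in> T \<Longrightarrow> actQ (h p) \<Theta>0 = bracket_torsion s c p" "\<And>v. smooth_on T (\<lambda>p. h p v)"
    by (rule smooth_orbit_lift[where \<theta> = "bracket_torsion s c",
          OF opD xD smooth_on_bracket_torsion[OF s(1) c(1)] \<Theta>p orb]) blast+
  define V where "V = fst c \<inter> snd c -` T"
  define t where "t = (\<lambda>y. s y \<circ> h (snd c y))"
  have t: "adapted V t"
    unfolding V_def t_def by (rule frame_field_lift[OF s(1) c(1) T(1,3) h(1,3)])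
  have tR: "(y, t y) \<in> R" if "y \<in> V" for y
    by (rule adaptedD(2)[OF t that])
  \<comment> \<open>\<open>h p\<close> carries \<open>\<Theta>0\<close> to the torsion of
    \<open>s\<close>; replacing \<open>s\<close> by \<open>s \<circ> h\<close> acts by the inverse
    and brings it back to \<open>\<Theta>0\<close>.\<close>
  have t\<Theta>: "\<Theta>Q (y, t y) = \<Theta>0" if y: "y \<in> V" for y
  proof -
    obtain z where z: "z \<in> fst c" "z \<in> U" "snd c y = snd c z" using y T(3) by (auto simp: V_def)
    then have "y = z" using y inj_onD[OF chart_inj[OF c(1)], of y z] by (auto simp: V_def)
    then have yU: "y \<in> U" "y \<in> fst c" using z by auto
    have yT: "snd c y \<in> T" using y by (simp add: V_def)
    show ?thesis
      unfolding t_def intrinsic_torsion_equivariant[OF adaptedD(2)[OF s(1) yU(1)] h(1)[OF yT]] tors[OF yU(2,1)]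
        h(2)[OF yT, symmetric] by (rule actQ_inv_cancel[OF h(1)[OF yT]])
  qed
  have "{f \<in> normalized. fst f \<in> V} = {(y, t y \<circ> b) | y b. y \<in> V \<and> b \<in> groupB}"
  proof (intro equalityI subsetI)
    fix f assume "f \<in> {f \<in> normalized. fst f \<in> V}"
    then obtain y u where f: "f = (y, u)" "y \<in> V" "(y, u) \<in> R" "\<Theta>Q (y, u) = \<Theta>0"
      by (cases f) (auto simp: normalized_def)
    obtain q where q: "q \<in> groupQ" "u = t y \<circ> q" by (rule R_transitive[OF tR[OF f(2)] f(3)])
    have "q \<in> groupB"
      using normalized_related[OF tR[OF f(2)] t\<Theta>[OF f(2)] q(1)] f(4) q(2) by simp
    then show "f \<in> {(y, t y \<circ> b) | y b. y \<in> V \<and> b \<in> groupB}" using f(1,2) q(2) by blast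
  next
    fix f assume "f \<in> {(y, t y \<circ> b) | y b. y \<in> V \<and> b \<in> groupB}"
    then obtain y b where f: "f = (y, t y \<circ> b)" "y \<in> V" "b \<in> groupB" by blast
    have b: "b \<in> groupQ" using f(3) by (simp add: groupB_iff)
    show "f \<in> {f \<in> normalized. fst f \<in> V}"
      using R_right_action[OF tR[OF f(2)] b] normalized_related[OF tR[OF f(2)] t\<Theta>[OF f(2)] b] f
      by (simp add: normalized_def)
  qed
  moreover have "x \<in> V" using c(2) T(2) by (simp add: V_def)
  ultimately show "\<exists>U s. x \<in> U \<and> frame_field M A U s \<and>
      {f \<in> normalized. fst f \<in> U} = {(y, s y \<circ> h) | y h. y \<in> U \<and> h \<in> groupB}"
    using adaptedD(1)[OF t] by (intro exI[of _ V] exI[of _ t] conjI)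
qed

text \<open>\<open>P\<close> has a frame over every point, this frame is normalized, and all
  normalized frames over the point arise from it by the action of B, under which \<open>P\<close> is
  closed.\<close>

lemma normalized_unique:
  assumes P: "P \<subseteq> R" "is_reduction M A groupB P" "\<forall>u\<in>P. \<Theta>Q u = \<Theta>0"
  shows "P = normalized"
proof
  show "P \<subseteq> normalized" using P by (auto simp: normalized_def)
  show "normalized \<subseteq> P"
  proof
    fix f assume "f \<in> normalized"
    then obtain y u where f: "f = (y, u)" "(y, u) \<in> R" "\<Theta>Q (y, u) = \<Theta>0"
      by (cases f) (auto simp: normalized_def)
    have y: "y \<in> topspace M" by (rule frame_bundleD(1)[OF R_frame_bundle[OF f(2)]])
    obtain U s where U: "y \<in> U" "frame_field M A U s" "\<forall>y\<in>U. (y, s y) \<in> P"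
      by (rule reduction_local_section[OF P(2) y groupB_id])
    then have s: "(y, s y) \<in> P" by blast
    have sR: "(y, s y) \<in> R" "\<Theta>Q (y, s y) = \<Theta>0" using s P(1,3) by auto
    obtain q where q: "q \<in> groupQ" "u = s y \<circ> q" by (rule R_transitive[OF sR(1) f(2)])
    have "q \<in> groupB" using normalized_related[OF sR q(1)] f(3) q(2) by simp
    then show "f \<in> P"
      using reduction_right_action[OF P(2) s _ groupB_id groupB_comp] f(1) q(2) by simp
  qed
qed

end

theorem corollary10:
  fixes M :: "'m topology"
    and A :: "('m, 'n::finite modelT) chart set"
    and R :: "('m, 'n modelT) frame set"
  assumes "smooth_manifold M A"
    and "qc_Q_structure M A R"
  shows "\<exists>!P. P \<subseteq> R \<and> is_reduction M A groupB P \<and>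
           (\<forall>u\<in>P. intrinsic_torsion M A R u = \<Theta>0)"
proof -
  interpret Q_manifold M A R using assms by unfold_locales (simp_all add: qc_Q_structure_def)
  have orbit: "\<exists>q\<in>groupQ. intrinsic_torsion M A R f = actQ q \<Theta>0" if "f \<in> R" for f
    using assms(2) that by (fastforce simp: qc_Q_structure_def)
  show ?thesis
  proof (rule ex1I[of _ normalized])
    show "normalized \<subseteq> R \<and> is_reduction M A groupB normalized \<and>
        (\<forall>u\<in>normalized. intrinsic_torsion M A R u = \<Theta>0)"
      using normalized_reduction[OF orbit] by (auto simp: normalized_def)
  qed (use normalized_unique in blast)
qed

end
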